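(* Let $\mathbf{H}$ be a differentially cohesive topos and $\Sigma$ a $V$-manifold in $\mathbf{H}$. The category $\mathrm{PDE}_{/\Sigma}(\mathbf{H})$ of formally integrable generalized PDEs over $\Sigma$ has all finite limits, and they can be computed as limits in $\mathbf{H}_{/\Sigma}$ (i.e. the underlying object of the limit of a finite diagram is the limit in $\mathbf{H}_{/\Sigma}$ of the diagram of underlying objects, where the underlying object of a PDE $\mathcal{E}\hookrightarrow J^\infty_\Sigma Y$ is $\mathcal{E}$).
   Context: **Differential cohesion.** A differentially cohesive topos is a (Grothendieck) topos $\mathbf{H}$ with a full inclusion of toposes $i_!:\mathbf{H}_\Re\hookrightarrow\mathbf{H}$ having three successive right adjoints, $i_!\dashv i^\ast\dashv i_\ast\dashv i^!$. Set $\Im:=i_\ast i^\ast$ with unit $\eta:\mathrm{id}\to\Im$. A morphism $f:X\to Y$ is formally étale if the naturality square of $\eta$ on $f$ is a pullback. For $V$ a group object in $\mathbf{H}$, a $V$-manifold is an object $X$ for which there is a span $V\leftarrow U\to X$ with both legs formally étale and the right leg an epimorphism. **Disk bundles and jets.** For $f:X\to Y$ there is the base change triple $f_!\dashv f^\ast\dashv f_\ast$ between slices. Set $T^\infty_\Sigma:=(\eta_\Sigma)^\ast(\eta_\Sigma)_!$ (a monad on $\mathbf{H}_{/\Sigma}$, unit $\eta^T$) and $J^\infty_\Sigma:=(\eta_\Sigma)^\ast(\eta_\Sigma)_\ast$ (a comonad, counit $\epsilon$, coproduct $\Delta$); $T^\infty_\Sigma\dashv J^\infty_\Sigma$. For $\sigma:T^\infty_\Sigma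 X\to Y$ write $\widetilde\sigma:X\to J^\infty_\Sigma Y$ for its adjunct. **Generalized PDEs.** A generalized PDE over $\Sigma$ is a monomorphism $e_Y:\mathcal{E}\hookrightarrow J^\infty_\Sigma Y$ in $\mathbf{H}_{/\Sigma}$. For $E\in\mathbf{H}_{/\Sigma}$, an $E$-parametrized family of formal solutions of it is a morphism $s_E:T^\infty_\Sigma E\to\mathcal{E}$ such that $\sigma_E:=e_Y\circ s_E$ satisfies $\Delta_Y\circ\sigma_E\circ\eta^T_E=\widetilde{\sigma_E}:E\to J^\infty_\Sigma J^\infty_\Sigma Y$. The prolongation $e^\infty_Y:\mathcal{E}^\infty\hookrightarrow J^\infty_\Sigma Y$ is the pullback of $J^\infty_\Sigma e_Y:J^\infty_\Sigma\mathcal{E}\to J^\infty_\Sigma J^\infty_\Sigma Y$ along $\Delta_Y$, with other projection $\rho^\infty_{\mathcal{E}}:\mathcal{E}^\infty\to J^\infty_\Sigma\mathcal{E}$; its canonical inclusion is $e^\infty_{\mathcal{E}}:=\epsilon_{\mathcal{E}}\circ\rho^\infty_{\mathcal{E}}:\mathcal{E}^\infty\hookrightarrow\mathcal{E}$. The PDE is formally integrable if $e^\infty_{\mathcal{E}}$ is an isomorphism. $\mathrm{PDE}_{/\Sigma}(\mathbf{H})$ has as objects the formally integrable generalized PDEs and as morphisms the $\mathbf{H}_{/\Sigma}$-morphisms $\phi:\mathcal{E}\to\mathcal{E}'$ such that composition with $\phi$ sends parametrized families of formal solutions of $\mathcal{E}$ to such families of $\mathcal{E}'$. *)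

theory Defs
  imports "HOL-Library.FuncSet" "HOL-Library.Equipollence"
begin

section \<open>Categories, functors, adjunctions\<close>

record ('o, 'a) cat =
  Obj :: "'o set"
  Arr :: "'a set"
  Dom :: "'a \<Rightarrow> 'o"
  Cod :: "'a \<Rightarrow> 'o"
  Id :: "'o \<Rightarrow> 'a"
  Comp :: "'a \<Rightarrow> 'a \<Rightarrow> 'a" (infixr "\<bullet>\<index>" 70)

definition hom :: "('o, 'a) cat \<Rightarrow> 'o \<Rightarrow> 'o \<Rightarrow> 'a set" where
  "hom C x y = {f \<in> Arr C. Dom C f = x \<and> Cod C f = y}"

locale category =
  fixes C :: "('o, 'a) cat" (structure)
  assumes Dom_closed: "f \<in> Arr C \<Longrightarrow> Dom C f \<in> Obj C"
    and Cod_closed: "f \<in> Arr C \<Longrightarrow> Cod C f \<in> Obj C"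
    and Id_hom: "x \<in> Obj C \<Longrightarrow> Id C x \<in> hom C x x"
    and Comp_hom: "\<lbrakk>f \<in> hom C x y; g \<in> hom C y z\<rbrakk> \<Longrightarrow> g \<bullet> f \<in> hom C x z"
    and Comp_Id_left: "f \<in> hom C x y \<Longrightarrow> Id C y \<bullet> f = f"
    and Comp_Id_right: "f \<in> hom C x y \<Longrightarrow> f \<bullet> Id C x = f"
    and Comp_assoc: "\<lbrakk>f \<in> hom C w x; g \<in> hom C x y; h \<in> hom C y z\<rbrakk>
      \<Longrightarrow> (h \<bullet> g) \<bullet> f = h \<bullet> (g \<bullet> f)"

definition monic :: "('o, 'a) cat \<Rightarrow> 'a \<Rightarrow> bool" where
  "monic C f \<longleftrightarrow> f \<in> Arr C \<and>
    (\<forall>x. \<forall>g \<in> hom C x (Dom C f). \<forall>h \<in> hom C x (Dom C f). f \<bullet>\<^bsub>C\<^esub> g = f \<bullet>\<^bsub>C\<^esub> h \<longrightarrow> g = h)"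

definition epic :: "('o, 'a) cat \<Rightarrow> 'a \<Rightarrow> bool" where
  "epic C f \<longleftrightarrow> f \<in> Arr C \<and>
    (\<forall>y. \<forall>g \<in> hom C (Cod C f) y. \<forall>h \<in> hom C (Cod C f) y. g \<bullet>\<^bsub>C\<^esub> f = h \<bullet>\<^bsub>C\<^esub> f \<longrightarrow> g = h)"

definition is_iso :: "('o, 'a) cat \<Rightarrow> 'a \<Rightarrow> bool" where
  "is_iso C f \<longleftrightarrow> f \<in> Arr C \<and>
    (\<exists>g \<in> hom C (Cod C f) (Dom C f).
       g \<bullet>\<^bsub>C\<^esub> f = Id C (Dom C f) \<and> f \<bullet>\<^bsub>C\<^esub> g = Id C (Cod C f))"

record ('o, 'a, 'p, 'b) ftor =
  fobj :: "'o \<Rightarrow> 'p"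
  farr :: "'a \<Rightarrow> 'b"

definition is_functor :: "('o, 'a) cat \<Rightarrow> ('p, 'b) cat \<Rightarrow> ('o, 'a, 'p, 'b) ftor \<Rightarrow> bool" where
  "is_functor C D F \<longleftrightarrow>
    (\<forall>x \<in> Obj C. fobj F x \<in> Obj D) \<and>
    (\<forall>x y. \<forall>f \<in> hom C x y. farr F f \<in> hom D (fobj F x) (fobj F y)) \<and>
    (\<forall>x \<in> Obj C. farr F (Id C x) = Id D (fobj F x)) \<and>
    (\<forall>x y z. \<forall>f \<in> hom C x y. \<forall>g \<in> hom C y z.
       farr F (g \<bullet>\<^bsub>C\<^esub> f) = farr F g \<bullet>\<^bsub>D\<^esub> farr F f)"

definition ftor_id :: "('o, 'a, 'o, 'a) ftor" where
  "ftor_id = \<lparr>fobj = (\<lambda>x. x), farr = (\<lambda>f. f)\<rparr>"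

definition ftor_comp :: "('p, 'b, 'q, 'c) ftor \<Rightarrow> ('o, 'a, 'p, 'b) ftor \<Rightarrow> ('o, 'a, 'q, 'c) ftor" where
  "ftor_comp G F = \<lparr>fobj = (\<lambda>x. fobj G (fobj F x)), farr = (\<lambda>f. farr G (farr F f))\<rparr>"

definition fully_faithful :: "('o, 'a) cat \<Rightarrow> ('p, 'b) cat \<Rightarrow> ('o, 'a, 'p, 'b) ftor \<Rightarrow> bool" where
  "fully_faithful C D F \<longleftrightarrow>
    (\<forall>x \<in> Obj C. \<forall>y \<in> Obj C. bij_betw (farr F) (hom C x y) (hom D (fobj F x) (fobj F y)))"

definition nat_trans :: "('o, 'a) cat \<Rightarrow> ('p, 'b) cat \<Rightarrow> ('o, 'a, 'p, 'b) ftor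
    \<Rightarrow> ('o, 'a, 'p, 'b) ftor \<Rightarrow> ('o \<Rightarrow> 'b) \<Rightarrow> bool" where
  "nat_trans C D F G \<alpha> \<longleftrightarrow>
    (\<forall>x \<in> Obj C. \<alpha> x \<in> hom D (fobj F x) (fobj G x)) \<and>
    (\<forall>x y. \<forall>f \<in> hom C x y. \<alpha> y \<bullet>\<^bsub>D\<^esub> farr F f = farr G f \<bullet>\<^bsub>D\<^esub> \<alpha> x)"

definition nat_iso :: "('o, 'a) cat \<Rightarrow> ('p, 'b) cat \<Rightarrow> ('o, 'a, 'p, 'b) ftor
    \<Rightarrow> ('o, 'a, 'p, 'b) ftor \<Rightarrow> ('o \<Rightarrow> 'b) \<Rightarrow> bool" where
  "nat_iso C D F G \<alpha> \<longleftrightarrow> nat_trans C D F G \<alpha> \<and> (\<forall>x \<in> Obj C. is_iso D (\<alpha> x))"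

definition equivalent_categories :: "('o, 'a) cat \<Rightarrow> ('p, 'b) cat \<Rightarrow> bool" where
  "equivalent_categories C D \<longleftrightarrow>
    (\<exists>F G \<alpha> \<beta>. is_functor C D F \<and> is_functor D C G \<and>
       nat_iso C C ftor_id (ftor_comp G F) \<alpha> \<and> nat_iso D D (ftor_comp F G) ftor_id \<beta>)"

record ('o, 'a, 'p, 'b) adj =
  ladj :: "('o, 'a, 'p, 'b) ftor"
  radj :: "('p, 'b, 'o, 'a) ftor"
  adj_unit :: "'o \<Rightarrow> 'a"
  adj_counit :: "'p \<Rightarrow> 'b"

definition adjunction :: "('o, 'a) cat \<Rightarrow> ('p, 'b) cat \<Rightarrow> ('o, 'a, 'p, 'b) adj \<Rightarrow> bool" where
  "adjunction C D A \<longleftrightarrow>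
    is_functor C D (ladj A) \<and> is_functor D C (radj A) \<and>
    nat_trans C C ftor_id (ftor_comp (radj A) (ladj A)) (adj_unit A) \<and>
    nat_trans D D (ftor_comp (ladj A) (radj A)) ftor_id (adj_counit A) \<and>
    (\<forall>x \<in> Obj C.
       adj_counit A (fobj (ladj A) x) \<bullet>\<^bsub>D\<^esub> farr (ladj A) (adj_unit A x) = Id D (fobj (ladj A) x)) \<and>
    (\<forall>y \<in> Obj D.
       farr (radj A) (adj_counit A y) \<bullet>\<^bsub>C\<^esub> adj_unit A (fobj (radj A) y) = Id C (fobj (radj A) y))"

definition transpose_right ::
    "('o, 'a) cat \<Rightarrow> ('o, 'a, 'p, 'b) adj \<Rightarrow> 'o \<Rightarrow> 'b \<Rightarrow> 'a" where
  "transpose_right C A x g = farr (radj A) g \<bullet>\<^bsub>C\<^esub> adj_unit A x"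


section \<open>Limits\<close>

definition terminal :: "('o, 'a) cat \<Rightarrow> 'o \<Rightarrow> bool" where
  "terminal C t \<longleftrightarrow> t \<in> Obj C \<and> (\<forall>x \<in> Obj C. \<exists>!f. f \<in> hom C x t)"

definition is_product :: "('o, 'a) cat \<Rightarrow> 'o \<Rightarrow> 'o \<Rightarrow> 'o \<Rightarrow> 'a \<Rightarrow> 'a \<Rightarrow> bool" where
  "is_product C x y p \<pi>1 \<pi>2 \<longleftrightarrow> \<pi>1 \<in> hom C p x \<and> \<pi>2 \<in> hom C p y \<and>
    (\<forall>z. \<forall>f \<in> hom C z x. \<forall>g \<in> hom C z y.
       \<exists>!u. u \<in> hom C z p \<and> \<pi>1 \<bullet>\<^bsub>C\<^esub> u = f \<and> \<pi>2 \<bullet>\<^bsub>C\<^esub> u = g)"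

definition is_pullback :: "('o, 'a) cat \<Rightarrow> 'a \<Rightarrow> 'a \<Rightarrow> 'a \<Rightarrow> 'a \<Rightarrow> bool" where
  "is_pullback C f g p q \<longleftrightarrow>
    f \<in> Arr C \<and> g \<in> Arr C \<and> Cod C f = Cod C g \<and>
    p \<in> Arr C \<and> q \<in> Arr C \<and> Dom C p = Dom C q \<and>
    Cod C p = Dom C f \<and> Cod C q = Dom C g \<and> f \<bullet>\<^bsub>C\<^esub> p = g \<bullet>\<^bsub>C\<^esub> q \<and>
    (\<forall>z. \<forall>h \<in> hom C z (Dom C f). \<forall>k \<in> hom C z (Dom C g). f \<bullet>\<^bsub>C\<^esub> h = g \<bullet>\<^bsub>C\<^esub> k \<longrightarrow>
       (\<exists>!u. u \<in> hom C z (Dom C p) \<and> p \<bullet>\<^bsub>C\<^esub> u = h \<and> q \<bullet>\<^bsub>C\<^esub> u = k))"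

definition is_cone :: "('j, 'k) cat \<Rightarrow> ('o, 'a) cat \<Rightarrow> ('j, 'k, 'o, 'a) ftor
    \<Rightarrow> 'o \<Rightarrow> ('j \<Rightarrow> 'a) \<Rightarrow> bool" where
  "is_cone J C D x \<kappa> \<longleftrightarrow> x \<in> Obj C \<and>
    (\<forall>j \<in> Obj J. \<kappa> j \<in> hom C x (fobj D j)) \<and>
    (\<forall>i j. \<forall>u \<in> hom J i j. farr D u \<bullet>\<^bsub>C\<^esub> \<kappa> i = \<kappa> j)"

definition is_limit :: "('j, 'k) cat \<Rightarrow> ('o, 'a) cat \<Rightarrow> ('j, 'k, 'o, 'a) ftor
    \<Rightarrow> 'o \<Rightarrow> ('j \<Rightarrow> 'a) \<Rightarrow> bool" where
  "is_limit J C D l \<pi> \<longleftrightarrow> is_cone J C D l \<pi> \<and>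
    (\<forall>x \<kappa>. is_cone J C D x \<kappa> \<longrightarrow>
       (\<exists>!u. u \<in> hom C x l \<and> (\<forall>j \<in> Obj J. \<pi> j \<bullet>\<^bsub>C\<^esub> u = \<kappa> j)))"

definition finite_category :: "('j, 'k) cat \<Rightarrow> bool" where
  "finite_category J \<longleftrightarrow> category J \<and> finite (Obj J) \<and> finite (Arr J)"


section \<open>Grothendieck toposes\<close>

text \<open>
  Size is measured against a type \<open>'u\<close> playing the role of a Grothendieck universe: a set is small
  if it has fewer elements than \<open>'u\<close>, and the cardinality of \<open>'u\<close> is required to be a regular
  strong limit. Uncountability is not required, so \<open>nat\<close> (the universe of hereditarily finite sets)
  is admitted along with the strongly inaccessible cardinals.
\<close>

definition small :: "'u set \<Rightarrow> bool" where
  "small A \<longleftrightarrow> A \<prec> (UNIV :: 'u set)"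

definition grothendieck_universe :: "'u itself \<Rightarrow> bool" where
  "grothendieck_universe _ \<longleftrightarrow>
    infinite (UNIV :: 'u set) \<and>
    (\<forall>A :: 'u set. small A \<longrightarrow> Pow A \<prec> (UNIV :: 'u set)) \<and>
    (\<forall>(I :: 'u set) (F :: 'u \<Rightarrow> 'u set).
       small I \<and> (\<forall>i \<in> I. small (F i)) \<longrightarrow> small (\<Union>i \<in> I. F i))"

definition sieves :: "('o, 'a) cat \<Rightarrow> 'o \<Rightarrow> 'a set set" where
  "sieves C c = {S. S \<subseteq> {f \<in> Arr C. Cod C f = c} \<and>
     (\<forall>f \<in> S. \<forall>g \<in> Arr C. Cod C g = Dom C f \<longrightarrow> f \<bullet>\<^bsub>C\<^esub> g \<in> S)}"

definition pull_sieve :: "('o, 'a) cat \<Rightarrow> 'a \<Rightarrow> 'a set \<Rightarrow> 'a set" where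
  "pull_sieve C h S = {g \<in> Arr C. Cod C g = Dom C h \<and> h \<bullet>\<^bsub>C\<^esub> g \<in> S}"

definition grothendieck_topology :: "('o, 'a) cat \<Rightarrow> ('o \<Rightarrow> 'a set set) \<Rightarrow> bool" where
  "grothendieck_topology C K \<longleftrightarrow>
    (\<forall>c \<in> Obj C. K c \<subseteq> sieves C c) \<and>
    (\<forall>c \<in> Obj C. {f \<in> Arr C. Cod C f = c} \<in> K c) \<and>
    (\<forall>c \<in> Obj C. \<forall>S \<in> K c. \<forall>h \<in> Arr C. Cod C h = c \<longrightarrow> pull_sieve C h S \<in> K (Dom C h)) \<and>
    (\<forall>c \<in> Obj C. \<forall>S \<in> K c. \<forall>S' \<in> sieves C c.
       (\<forall>h \<in> S. pull_sieve C h S' \<in> K (Dom C h)) \<longrightarrow> S' \<in> K c)"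

record ('o, 'a, 'u) psh =
  sections :: "'o \<Rightarrow> 'u set"
  restr :: "'a \<Rightarrow> 'u \<Rightarrow> 'u"

definition presheaf :: "('o, 'a) cat \<Rightarrow> ('o, 'a, 'u) psh \<Rightarrow> bool" where
  "presheaf C F \<longleftrightarrow>
    (\<forall>c \<in> Obj C. small (sections F c)) \<and>
    (\<forall>f \<in> Arr C. \<forall>s \<in> sections F (Cod C f). restr F f s \<in> sections F (Dom C f)) \<and>
    (\<forall>c \<in> Obj C. \<forall>s \<in> sections F c. restr F (Id C c) s = s) \<and>
    (\<forall>b c d. \<forall>f \<in> hom C b c. \<forall>g \<in> hom C c d. \<forall>s \<in> sections F d.
       restr F (g \<bullet>\<^bsub>C\<^esub> f) s = restr F f (restr F g s))"

definition matching_family ::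
    "('o, 'a) cat \<Rightarrow> ('o, 'a, 'u) psh \<Rightarrow> 'a set \<Rightarrow> ('a \<Rightarrow> 'u) \<Rightarrow> bool" where
  "matching_family C F S x \<longleftrightarrow>
    (\<forall>f \<in> S. x f \<in> sections F (Dom C f)) \<and>
    (\<forall>f \<in> S. \<forall>g \<in> Arr C. Cod C g = Dom C f \<longrightarrow> x (f \<bullet>\<^bsub>C\<^esub> g) = restr F g (x f))"

definition sheaf ::
    "('o, 'a) cat \<Rightarrow> ('o \<Rightarrow> 'a set set) \<Rightarrow> ('o, 'a, 'u) psh \<Rightarrow> bool" where
  "sheaf C K F \<longleftrightarrow> presheaf C F \<and>
    (\<forall>c \<in> Obj C. \<forall>S \<in> K c. \<forall>x. matching_family C F S x \<longrightarrow>
       (\<exists>!s. s \<in> sections F c \<and> (\<forall>f \<in> S. restr F f s = x f)))"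

text \<open>
  Components of morphisms are extensional functions (\<open>undefined\<close> outside their domain), so that
  equality of morphisms is equality of natural transformations.
\<close>

definition sheaf_category :: "('o, 'a) cat \<Rightarrow> ('o \<Rightarrow> 'a set set) \<Rightarrow>
    (('o, 'a, 'u) psh, ('o, 'a, 'u) psh \<times> ('o \<Rightarrow> 'u \<Rightarrow> 'u) \<times> ('o, 'a, 'u) psh) cat" where
  "sheaf_category C K = \<lparr>
     Obj = {F. sheaf C K F},
     Arr = {(F, \<alpha>, G). sheaf C K F \<and> sheaf C K G \<and>
              \<alpha> \<in> (\<Pi>\<^sub>E c \<in> Obj C. sections F c \<rightarrow>\<^sub>E sections G c) \<and>
              (\<forall>f \<in> Arr C. \<forall>s \<in> sections F (Cod C f).
                 \<alpha> (Dom C f) (restr F f s) = restr G f (\<alpha> (Cod C f) s))},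
     Dom = (\<lambda>(F, \<alpha>, G). F),
     Cod = (\<lambda>(F, \<alpha>, G). G),
     Id = (\<lambda>F. (F, \<lambda>c \<in> Obj C. \<lambda>s \<in> sections F c. s, F)),
     Comp = (\<lambda>(F', \<beta>, G) (F, \<alpha>, G'). (F, \<lambda>c \<in> Obj C. \<lambda>s \<in> sections F c. \<beta> c (\<alpha> c s), G))\<rparr>"

text \<open>
  A small site can be taken to have its objects and arrows in \<open>'u\<close>, since every small set embeds
  into \<open>'u\<close>.
\<close>

definition grothendieck_topos :: "'u itself \<Rightarrow> ('o, 'a) cat \<Rightarrow> bool" where
  "grothendieck_topos _ H \<longleftrightarrow> category H \<and>
    (\<exists>(C :: ('u, 'u) cat) K.
       category C \<and> small (Obj C) \<and> small (Arr C) \<and> grothendieck_topology C K \<and>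
       equivalent_categories H
         (sheaf_category C K :: (('u, 'u, 'u) psh,
            ('u, 'u, 'u) psh \<times> ('u \<Rightarrow> 'u \<Rightarrow> 'u) \<times> ('u, 'u, 'u) psh) cat))"


section \<open>Differential cohesion and manifolds\<close>

text \<open>
  \<open>A1\<close>, \<open>A2\<close>, \<open>A3\<close> are the adjunctions \<open>i\<^sub>! \<stileturn> i\<^sup>*\<close>, \<open>i\<^sup>* \<stileturn> i\<^sub>*\<close>, \<open>i\<^sub>* \<stileturn> i\<^sup>!\<close>.
\<close>

definition differentially_cohesive :: "'u itself \<Rightarrow> ('o, 'a) cat \<Rightarrow> ('p, 'b) cat \<Rightarrow>
    ('p, 'b, 'o, 'a) adj \<Rightarrow> ('o, 'a, 'p, 'b) adj \<Rightarrow> ('p, 'b, 'o, 'a) adj \<Rightarrow> bool" where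
  "differentially_cohesive U H R A1 A2 A3 \<longleftrightarrow>
    grothendieck_universe U \<and> grothendieck_topos U H \<and> grothendieck_topos U R \<and>
    adjunction R H A1 \<and> adjunction H R A2 \<and> adjunction R H A3 \<and>
    radj A1 = ladj A2 \<and> radj A2 = ladj A3 \<and>
    fully_faithful R H (ladj A1)"

definition inf_shape :: "('o, 'a, 'p, 'b) adj \<Rightarrow> ('o, 'a, 'o, 'a) ftor" where
  "inf_shape A2 = ftor_comp (radj A2) (ladj A2)"

definition inf_unit :: "('o, 'a, 'p, 'b) adj \<Rightarrow> 'o \<Rightarrow> 'a" where
  "inf_unit A2 = adj_unit A2"

definition formally_etale :: "('o, 'a) cat \<Rightarrow> ('o, 'a, 'p, 'b) adj \<Rightarrow> 'a \<Rightarrow> bool" where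
  "formally_etale H A2 f \<longleftrightarrow> f \<in> Arr H \<and>
    is_pullback H (inf_unit A2 (Cod H f)) (farr (inf_shape A2) f) f (inf_unit A2 (Dom H f))"

definition pairing :: "('o, 'a) cat \<Rightarrow> 'a \<Rightarrow> 'a \<Rightarrow> 'a \<Rightarrow> 'a \<Rightarrow> 'a" where
  "pairing C \<pi>1 \<pi>2 f g =
    (THE u. u \<in> hom C (Dom C f) (Dom C \<pi>1) \<and> \<pi>1 \<bullet>\<^bsub>C\<^esub> u = f \<and> \<pi>2 \<bullet>\<^bsub>C\<^esub> u = g)"

text \<open>
  \<open>p = v \<times> v\<close> with projections \<open>\<pi>1\<close>, \<open>\<pi>2\<close>, and \<open>q = (v \<times> v) \<times> v\<close> with projections \<open>\<rho>1\<close>, \<open>\<rho>2\<close>;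
  \<open>b\<close> is the map from \<open>v\<close> to the terminal object \<open>t\<close>.
\<close>

definition group_object :: "('o, 'a) cat \<Rightarrow> 'o \<Rightarrow> bool" where
  "group_object C v \<longleftrightarrow> v \<in> Obj C \<and>
    (\<exists>t p \<pi>1 \<pi>2 q \<rho>1 \<rho>2 m e n b.
       terminal C t \<and> is_product C v v p \<pi>1 \<pi>2 \<and> is_product C p v q \<rho>1 \<rho>2 \<and>
       m \<in> hom C p v \<and> e \<in> hom C t v \<and> n \<in> hom C v v \<and> b \<in> hom C v t \<and>
       m \<bullet>\<^bsub>C\<^esub> pairing C \<pi>1 \<pi>2 (m \<bullet>\<^bsub>C\<^esub> \<rho>1) \<rho>2 =
         m \<bullet>\<^bsub>C\<^esub> pairing C \<pi>1 \<pi>2 (\<pi>1 \<bullet>\<^bsub>C\<^esub> \<rho>1) (m \<bullet>\<^bsub>C\<^esub> pairing C \<pi>1 \<pi>2 (\<pi>2 \<bullet>\<^bsub>C\<^esub> \<rho>1) \<rho>2) \<and>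
       m \<bullet>\<^bsub>C\<^esub> pairing C \<pi>1 \<pi>2 (e \<bullet>\<^bsub>C\<^esub> b) (Id C v) = Id C v \<and>
       m \<bullet>\<^bsub>C\<^esub> pairing C \<pi>1 \<pi>2 (Id C v) (e \<bullet>\<^bsub>C\<^esub> b) = Id C v \<and>
       m \<bullet>\<^bsub>C\<^esub> pairing C \<pi>1 \<pi>2 n (Id C v) = e \<bullet>\<^bsub>C\<^esub> b \<and>
       m \<bullet>\<^bsub>C\<^esub> pairing C \<pi>1 \<pi>2 (Id C v) n = e \<bullet>\<^bsub>C\<^esub> b)"

definition is_manifold :: "('o, 'a) cat \<Rightarrow> ('o, 'a, 'p, 'b) adj \<Rightarrow> 'o \<Rightarrow> 'o \<Rightarrow> bool" where
  "is_manifold H A2 v x \<longleftrightarrow> x \<in> Obj H \<and>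
    (\<exists>u. \<exists>f \<in> hom H u v. \<exists>g \<in> hom H u x.
       formally_etale H A2 f \<and> formally_etale H A2 g \<and> epic H g)"


section \<open>Slices, base change and jets\<close>

text \<open>
  An arrow of the slice is a triple \<open>(f, h, g)\<close> with \<open>h\<close> a morphism over \<open>s\<close> from \<open>f\<close> to \<open>g\<close>.
\<close>

definition slice :: "('o, 'a) cat \<Rightarrow> 'o \<Rightarrow> ('a, 'a \<times> 'a \<times> 'a) cat" where
  "slice C s = \<lparr>
     Obj = {f \<in> Arr C. Cod C f = s},
     Arr = {(f, h, g). f \<in> Arr C \<and> Cod C f = s \<and> g \<in> Arr C \<and> Cod C g = s \<and>
              h \<in> hom C (Dom C f) (Dom C g) \<and> g \<bullet>\<^bsub>C\<^esub> h = f},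
     Dom = (\<lambda>(f, h, g). f),
     Cod = (\<lambda>(f, h, g). g),
     Id = (\<lambda>f. (f, Id C (Dom C f), f)),
     Comp = (\<lambda>(f', h', g') (f, h, g). (f, h' \<bullet>\<^bsub>C\<^esub> h, g'))\<rparr>"

definition post_comp :: "('o, 'a) cat \<Rightarrow> 'a \<Rightarrow> ('a, 'a \<times> 'a \<times> 'a, 'a, 'a \<times> 'a \<times> 'a) ftor" where
  "post_comp C k = \<lparr>fobj = (\<lambda>f. k \<bullet>\<^bsub>C\<^esub> f), farr = (\<lambda>(f, h, g). (k \<bullet>\<^bsub>C\<^esub> f, h, k \<bullet>\<^bsub>C\<^esub> g))\<rparr>"

text \<open>
  \<open>B1\<close> and \<open>B2\<close> are the adjunctions \<open>k\<^sub>! \<stileturn> k\<^sup>*\<close> and \<open>k\<^sup>* \<stileturn> k\<^sub>*\<close>, where \<open>k\<^sub>!\<close> is composition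
  with \<open>k\<close>. The adjoints are determined up to isomorphism only, so they are carried as data.
\<close>

definition base_change_triple :: "('o, 'a) cat \<Rightarrow> 'a \<Rightarrow>
    ('a, 'a \<times> 'a \<times> 'a, 'a, 'a \<times> 'a \<times> 'a) adj \<Rightarrow>
    ('a, 'a \<times> 'a \<times> 'a, 'a, 'a \<times> 'a \<times> 'a) adj \<Rightarrow> bool" where
  "base_change_triple H k B1 B2 \<longleftrightarrow> k \<in> Arr H \<and>
    adjunction (slice H (Dom H k)) (slice H (Cod H k)) B1 \<and>
    adjunction (slice H (Cod H k)) (slice H (Dom H k)) B2 \<and>
    ladj B1 = post_comp H k \<and> radj B1 = ladj B2"

text \<open>
  From here on \<open>B1\<close> and \<open>B2\<close> are adjunctions \<open>L \<stileturn> M\<close> and \<open>M \<stileturn> N\<close>, with \<open>L, N\<close> defined on \<open>C\<close>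
  and \<open>M\<close> taking values in \<open>C\<close>; in the application \<open>C\<close> is the slice over \<open>\<Sigma>\<close> and
  \<open>L, M, N\<close> are \<open>\<eta>\<^sub>!, \<eta>\<^sup>*, \<eta>\<^sub>*\<close> for the unit \<open>\<eta>\<close> at \<open>\<Sigma>\<close>.
\<close>

definition disk_functor :: "('o, 'a, 'p, 'b) adj \<Rightarrow> ('o, 'a, 'o, 'a) ftor" where
  "disk_functor B1 = ftor_comp (radj B1) (ladj B1)"

definition disk_unit :: "('o, 'a, 'p, 'b) adj \<Rightarrow> 'o \<Rightarrow> 'a" where
  "disk_unit B1 = adj_unit B1"

definition jet_functor :: "('p, 'b, 'o, 'a) adj \<Rightarrow> ('o, 'a, 'o, 'a) ftor" where
  "jet_functor B2 = ftor_comp (ladj B2) (radj B2)"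

definition jet_counit :: "('p, 'b, 'o, 'a) adj \<Rightarrow> 'o \<Rightarrow> 'a" where
  "jet_counit B2 = adj_counit B2"

definition jet_coproduct :: "('p, 'b, 'o, 'a) adj \<Rightarrow> 'o \<Rightarrow> 'a" where
  "jet_coproduct B2 y = farr (ladj B2) (adj_unit B2 (fobj (radj B2) y))"

text \<open>
  The adjunct \<open>X \<rightarrow> JY\<close> of \<open>\<sigma> : TX \<rightarrow> Y\<close> under the composite adjunction \<open>T = M L \<stileturn> M N = J\<close>:
  first transpose to \<open>L X \<rightarrow> N Y\<close>, then to \<open>X \<rightarrow> M N Y\<close>.
\<close>

definition jet_adjunct :: "('o, 'a) cat \<Rightarrow> ('p, 'b) cat \<Rightarrow> ('o, 'a, 'p, 'b) adj \<Rightarrow>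
    ('p, 'b, 'o, 'a) adj \<Rightarrow> 'o \<Rightarrow> 'a \<Rightarrow> 'a" where
  "jet_adjunct C D B1 B2 x \<sigma> =
    transpose_right C B1 x (transpose_right D B2 (fobj (ladj B1) x) \<sigma>)"


section \<open>Generalized PDEs\<close>

text \<open>
  A generalized PDE is given by \<open>Y\<close> and the inclusion into \<open>JY\<close>; the domain of the inclusion is
  the underlying object.
\<close>

record ('o, 'a) gpde =
  pde_bundle :: 'o
  pde_incl :: 'a

definition underlying :: "('o, 'a) cat \<Rightarrow> ('o, 'a) gpde \<Rightarrow> 'o" where
  "underlying C P = Dom C (pde_incl P)"

definition generalized_pde ::
    "('o, 'a) cat \<Rightarrow> ('p, 'b, 'o, 'a) adj \<Rightarrow> ('o, 'a) gpde \<Rightarrow> bool" where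
  "generalized_pde C B2 P \<longleftrightarrow> pde_bundle P \<in> Obj C \<and>
    Cod C (pde_incl P) = fobj (jet_functor B2) (pde_bundle P) \<and> monic C (pde_incl P)"

definition formal_solution_family :: "('o, 'a) cat \<Rightarrow> ('p, 'b) cat \<Rightarrow> ('o, 'a, 'p, 'b) adj \<Rightarrow>
    ('p, 'b, 'o, 'a) adj \<Rightarrow> ('o, 'a) gpde \<Rightarrow> 'o \<Rightarrow> 'a \<Rightarrow> bool" where
  "formal_solution_family C D B1 B2 P x s \<longleftrightarrow>
    x \<in> Obj C \<and> s \<in> hom C (fobj (disk_functor B1) x) (underlying C P) \<and>
    (let \<sigma> = pde_incl P \<bullet>\<^bsub>C\<^esub> s in
       jet_coproduct B2 (pde_bundle P) \<bullet>\<^bsub>C\<^esub> (\<sigma> \<bullet>\<^bsub>C\<^esub> disk_unit B1 x) = jet_adjunct C D B1 B2 x \<sigma>)"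

definition is_prolongation ::
    "('o, 'a) cat \<Rightarrow> ('p, 'b, 'o, 'a) adj \<Rightarrow> ('o, 'a) gpde \<Rightarrow> 'a \<Rightarrow> 'a \<Rightarrow> bool" where
  "is_prolongation C B2 P e_inf \<rho>_inf \<longleftrightarrow>
    is_pullback C (jet_coproduct B2 (pde_bundle P)) (farr (jet_functor B2) (pde_incl P)) e_inf \<rho>_inf"

definition formally_integrable ::
    "('o, 'a) cat \<Rightarrow> ('p, 'b, 'o, 'a) adj \<Rightarrow> ('o, 'a) gpde \<Rightarrow> bool" where
  "formally_integrable C B2 P \<longleftrightarrow>
    (\<exists>e_inf \<rho>_inf. is_prolongation C B2 P e_inf \<rho>_inf \<and>
       is_iso C (jet_counit B2 (underlying C P) \<bullet>\<^bsub>C\<^esub> \<rho>_inf))"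

definition pde_morphism :: "('o, 'a) cat \<Rightarrow> ('p, 'b) cat \<Rightarrow> ('o, 'a, 'p, 'b) adj \<Rightarrow>
    ('p, 'b, 'o, 'a) adj \<Rightarrow> ('o, 'a) gpde \<Rightarrow> ('o, 'a) gpde \<Rightarrow> 'a \<Rightarrow> bool" where
  "pde_morphism C D B1 B2 P Q \<phi> \<longleftrightarrow> \<phi> \<in> hom C (underlying C P) (underlying C Q) \<and>
    (\<forall>x s. formal_solution_family C D B1 B2 P x s \<longrightarrow>
       formal_solution_family C D B1 B2 Q x (\<phi> \<bullet>\<^bsub>C\<^esub> s))"

definition pde_category :: "('o, 'a) cat \<Rightarrow> ('p, 'b) cat \<Rightarrow> ('o, 'a, 'p, 'b) adj \<Rightarrow>
    ('p, 'b, 'o, 'a) adj \<Rightarrow> (('o, 'a) gpde, ('o, 'a) gpde \<times> 'a \<times> ('o, 'a) gpde) cat" where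
  "pde_category C D B1 B2 =
    (let pdes = {P. generalized_pde C B2 P \<and> formally_integrable C B2 P} in \<lparr>
       Obj = pdes,
       Arr = {(P, \<phi>, Q). P \<in> pdes \<and> Q \<in> pdes \<and> pde_morphism C D B1 B2 P Q \<phi>},
       Dom = (\<lambda>(P, \<phi>, Q). P),
       Cod = (\<lambda>(P, \<phi>, Q). Q),
       Id = (\<lambda>P. (P, Id C (underlying C P), P)),
       Comp = (\<lambda>(P', \<psi>, Q') (P, \<phi>, Q). (P, \<psi> \<bullet>\<^bsub>C\<^esub> \<phi>, Q'))\<rparr>)"

definition underlying_functor :: "('o, 'a) cat \<Rightarrow>
    (('o, 'a) gpde, ('o, 'a) gpde \<times> 'a \<times> ('o, 'a) gpde, 'o, 'a) ftor" where
  "underlying_functor C = \<lparr>fobj = underlying C, farr = (\<lambda>(P, \<phi>, Q). \<phi>)\<rparr>"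

definition PDE_over :: "('o, 'a) cat \<Rightarrow> ('o, 'a, 'p, 'b) adj \<Rightarrow> 'o \<Rightarrow>
    ('a, 'a \<times> 'a \<times> 'a, 'a, 'a \<times> 'a \<times> 'a) adj \<Rightarrow>
    ('a, 'a \<times> 'a \<times> 'a, 'a, 'a \<times> 'a \<times> 'a) adj \<Rightarrow>
    (('a, 'a \<times> 'a \<times> 'a) gpde,
     ('a, 'a \<times> 'a \<times> 'a) gpde \<times> ('a \<times> 'a \<times> 'a) \<times> ('a, 'a \<times> 'a \<times> 'a) gpde) cat" where
  "PDE_over H A2 \<Sigma> B1 B2 =
    pde_category (slice H \<Sigma>) (slice H (fobj (inf_shape A2) \<Sigma>)) B1 B2"

end

theory Submission
  imports Defs
begin

text \<open>
  A formally integrable PDE is a coalgebra of the jet comonad in disguise. If \<open>e : \<E> \<rightarrow> JY\<close> is formally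
  integrable, inverting \<open>\<E>\<^sup>\<infinity> \<rightarrow> \<E>\<close> gives a map \<open>\<rho> : \<E> \<rightarrow> J\<E>\<close> with \<open>Je \<circ> \<rho> = \<Delta>\<^sub>Y \<circ> e\<close>, so that \<open>\<E>\<close> is a
  subcoalgebra of the cofree coalgebra \<open>JY\<close>; since \<open>e\<close>, \<open>Je\<close> and \<open>JJe\<close> are monomorphisms, \<open>\<rho>\<close> is
  unique and inherits the coalgebra laws (\<open>integrable_pde_coaction\<close>). Conversely the structure map of
  any coalgebra, being split by the counit, is a monomorphism, and as a PDE it is its own prolongation
  (\<open>coalgebra_pde\<close>).

  The morphisms agree as well. Through \<open>T \<stileturn> J\<close> the coalgebra \<open>\<E>\<close> is an algebra \<open>a : T\<E> \<rightarrow> \<E>\<close> of the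
  disk monad, and a formal solution \<open>TX \<rightarrow> \<E>\<close> is the same as a homomorphism from the free algebra on
  \<open>X\<close> (\<open>formal_solution_iff\<close>). Composition with a homomorphism preserves these, and a map that
  preserves the single solution \<open>a\<close> is a homomorphism (\<open>pde_morphism_iff\<close>).

  Now \<open>J = \<eta>\<^sup>* \<eta>\<^sub>*\<close> is a composite of two right adjoints and preserves all limits
  (\<open>jet_preserves_limit\<close>). A limit of the underlying objects of a diagram of coalgebras therefore
  carries a coalgebra structure for which the projections are homomorphisms, and with it is the limit
  of the diagram (\<open>PDE_limit\<close>). Limits of PDEs being unique up to isomorphism, every one of them has a
  limit as its underlying cone (\<open>underlying_limit\<close>).

  It remains that the slice of \<open>H\<close> over \<open>\<Sigma>\<close> has finite limits. They are built from the terminal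
  object and pullbacks (\<open>finite_limit_exists\<close>), the pullbacks of a slice are those of \<open>H\<close>, and \<open>H\<close> has
  them because pullbacks of sheaves are formed sectionwise (\<open>sheaf_has_pullbacks\<close>).
\<close>

section \<open>Arrows, functors and adjunctions\<close>

context category
begin

lemma Comp_arr [simp]:
  assumes "f \<in> Arr C" "g \<in> Arr C" "Dom C g = Cod C f"
  shows "g \<bullet> f \<in> Arr C" "Dom C (g \<bullet> f) = Dom C f" "Cod C (g \<bullet> f) = Cod C g"
  using Comp_hom[of f "Dom C f" "Cod C f" g "Cod C g"] assms by (auto simp: hom_def)

lemma Id_arr [simp]:
  assumes "x \<in> Obj C"
  shows "Id C x \<in> Arr C" "Dom C (Id C x) = x" "Cod C (Id C x) = x"
  using Id_hom[OF assms] by (auto simp: hom_def)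

lemma Comp_Id [simp]:
  assumes "f \<in> Arr C"
  shows "Cod C f = x \<Longrightarrow> Id C x \<bullet> f = f" "Dom C f = x \<Longrightarrow> f \<bullet> Id C x = f"
  using assms Comp_Id_left[of f "Dom C f" "Cod C f"] Comp_Id_right[of f "Dom C f" "Cod C f"]
  by (auto simp: hom_def)

lemma Comp_assoc' [simp]:
  assumes "f \<in> Arr C" "g \<in> Arr C" "h \<in> Arr C" "Dom C g = Cod C f" "Dom C h = Cod C g"
  shows "(h \<bullet> g) \<bullet> f = h \<bullet> (g \<bullet> f)"
  using Comp_assoc[of f "Dom C f" "Cod C f" g "Cod C g" h "Cod C h"] assms by (auto simp: hom_def)

lemma Dom_Cod_Obj [simp]:
  assumes "f \<in> Arr C"
  shows "Dom C f \<in> Obj C" "Cod C f \<in> Obj C"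
  using assms Dom_closed Cod_closed by auto

text \<open>
  A commuting square, in the form in which it applies inside a composite that is bracketed to the
  right.
\<close>

lemma Comp_extend:
  assumes "g \<bullet> f = k \<bullet> h" "f \<in> Arr C" "g \<in> Arr C" "h \<in> Arr C" "k \<in> Arr C"
    "Dom C g = Cod C f" "Dom C k = Cod C h" "z \<in> Arr C" "Dom C f = Cod C z" "Dom C h = Cod C z"
  shows "g \<bullet> (f \<bullet> z) = k \<bullet> (h \<bullet> z)"
  using assms Comp_assoc'[of z f g] Comp_assoc'[of z h k] by simp

lemma monicD:
  assumes "monic C f" "f \<bullet> g = f \<bullet> h" "g \<in> Arr C" "h \<in> Arr C"
    "Cod C g = Dom C f" "Cod C h = Dom C f" "Dom C g = Dom C h"
  shows "g = h"
  using assms unfolding monic_def hom_def by blast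

end

lemma functorD:
  assumes "is_functor C D F"
  shows functor_obj: "x \<in> Obj C \<Longrightarrow> fobj F x \<in> Obj D"
    and functor_arr: "f \<in> Arr C \<Longrightarrow> farr F f \<in> Arr D"
    and functor_Dom: "f \<in> Arr C \<Longrightarrow> Dom D (farr F f) = fobj F (Dom C f)"
    and functor_Cod: "f \<in> Arr C \<Longrightarrow> Cod D (farr F f) = fobj F (Cod C f)"
    and functor_Id: "x \<in> Obj C \<Longrightarrow> farr F (Id C x) = Id D (fobj F x)"
    and functor_Comp: "f \<in> Arr C \<Longrightarrow> g \<in> Arr C \<Longrightarrow> Dom C g = Cod C f \<Longrightarrow>
      farr F (g \<bullet>\<^bsub>C\<^esub> f) = farr F g \<bullet>\<^bsub>D\<^esub> farr F f"
  using assms unfolding is_functor_def hom_def by blast+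

lemma is_functorI:
  assumes "\<And>x. x \<in> Obj C \<Longrightarrow> fobj F x \<in> Obj D"
    and "\<And>f. f \<in> Arr C \<Longrightarrow> farr F f \<in> Arr D"
    and "\<And>f. f \<in> Arr C \<Longrightarrow> Dom D (farr F f) = fobj F (Dom C f)"
    and "\<And>f. f \<in> Arr C \<Longrightarrow> Cod D (farr F f) = fobj F (Cod C f)"
    and "\<And>x. x \<in> Obj C \<Longrightarrow> farr F (Id C x) = Id D (fobj F x)"
    and "\<And>f g. f \<in> Arr C \<Longrightarrow> g \<in> Arr C \<Longrightarrow> Dom C g = Cod C f \<Longrightarrow>
      farr F (g \<bullet>\<^bsub>C\<^esub> f) = farr F g \<bullet>\<^bsub>D\<^esub> farr F f"
  shows "is_functor C D F"
  using assms unfolding is_functor_def hom_def by auto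

lemma ftor_comp_simps [simp]:
  "fobj (ftor_comp G F) x = fobj G (fobj F x)"
  "farr (ftor_comp G F) f = farr G (farr F f)"
  by (simp_all add: ftor_comp_def)

lemma is_functor_comp:
  assumes F: "is_functor C D F" and G: "is_functor D E G"
  shows "is_functor C E (ftor_comp G F)"
  by (rule is_functorI) (simp_all add: functorD[OF F] functorD[OF G])

lemma ftor_comp_assoc: "ftor_comp (ftor_comp G F) E = ftor_comp G (ftor_comp F E)"
  by (simp add: ftor_comp_def)

lemma ftor_id_simps [simp]: "fobj ftor_id x = x" "farr ftor_id f = f"
  by (simp_all add: ftor_id_def)

lemma nat_transD:
  assumes "nat_trans C D F G \<alpha>"
  shows "x \<in> Obj C \<Longrightarrow> \<alpha> x \<in> Arr D"
    and "x \<in> Obj C \<Longrightarrow> Dom D (\<alpha> x) = fobj F x"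
    and "x \<in> Obj C \<Longrightarrow> Cod D (\<alpha> x) = fobj G x"
    and "f \<in> Arr C \<Longrightarrow> \<alpha> (Cod C f) \<bullet>\<^bsub>D\<^esub> farr F f = farr G f \<bullet>\<^bsub>D\<^esub> \<alpha> (Dom C f)"
  using assms unfolding nat_trans_def hom_def by blast+

locale adjoint_pair = C: category C + D: category D
  for C :: "('o, 'a) cat" and D :: "('p, 'b) cat" +
  fixes A :: "('o, 'a, 'p, 'b) adj"
  assumes adjunction: "adjunction C D A"
begin

abbreviation "F \<equiv> ladj A"
abbreviation "G \<equiv> radj A"
abbreviation "\<eta> \<equiv> adj_unit A"
abbreviation "\<epsilon> \<equiv> adj_counit A"

lemma left_functor: "is_functor C D F" and right_functor: "is_functor D C G"
  and unit_nat: "nat_trans C C ftor_id (ftor_comp G F) \<eta>"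
  and counit_nat: "nat_trans D D (ftor_comp F G) ftor_id \<epsilon>"
  using adjunction by (auto simp: adjunction_def)

lemmas functor_rules [simp] = functorD[OF left_functor] functorD[OF right_functor]

lemma unit_arr [simp]:
  assumes "x \<in> Obj C"
  shows "\<eta> x \<in> Arr C" "Dom C (\<eta> x) = x" "Cod C (\<eta> x) = fobj G (fobj F x)"
  using nat_transD[OF unit_nat] assms by auto

lemma counit_arr [simp]:
  assumes "y \<in> Obj D"
  shows "\<epsilon> y \<in> Arr D" "Dom D (\<epsilon> y) = fobj F (fobj G y)" "Cod D (\<epsilon> y) = y"
  using nat_transD[OF counit_nat] assms by auto

lemma unit_natural:
  "f \<in> Arr C \<Longrightarrow> farr G (farr F f) \<bullet>\<^bsub>C\<^esub> \<eta> (Dom C f) = \<eta> (Cod C f) \<bullet>\<^bsub>C\<^esub> f"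
  using nat_transD(4)[OF unit_nat] by auto

lemma counit_natural:
  "f \<in> Arr D \<Longrightarrow> \<epsilon> (Cod D f) \<bullet>\<^bsub>D\<^esub> farr F (farr G f) = f \<bullet>\<^bsub>D\<^esub> \<epsilon> (Dom D f)"
  using nat_transD(4)[OF counit_nat] by auto

lemma triangles:
  "x \<in> Obj C \<Longrightarrow> \<epsilon> (fobj F x) \<bullet>\<^bsub>D\<^esub> farr F (\<eta> x) = Id D (fobj F x)"
  "y \<in> Obj D \<Longrightarrow> farr G (\<epsilon> y) \<bullet>\<^bsub>C\<^esub> \<eta> (fobj G y) = Id C (fobj G y)"
  using adjunction by (auto simp: adjunction_def)

definition transpose_left :: "'p \<Rightarrow> 'a \<Rightarrow> 'b" where
  "transpose_left y v = \<epsilon> y \<bullet>\<^bsub>D\<^esub> farr F v"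

lemma transpose_left_arr [simp]:
  assumes "v \<in> Arr C" "Cod C v = fobj G y" "y \<in> Obj D"
  shows "transpose_left y v \<in> Arr D" "Dom D (transpose_left y v) = fobj F (Dom C v)"
    "Cod D (transpose_left y v) = y"
  using assms by (auto simp: transpose_left_def)

lemma transpose_right_arr [simp]:
  assumes "g \<in> Arr D" "Dom D g = fobj F x" "x \<in> Obj C"
  shows "transpose_right C A x g \<in> Arr C" "Dom C (transpose_right C A x g) = x"
    "Cod C (transpose_right C A x g) = fobj G (Cod D g)"
  using assms by (auto simp: transpose_right_def)

lemma transpose_right_left:
  assumes "v \<in> Arr C" "Cod C v = fobj G y" "y \<in> Obj D"
  shows "transpose_right C A (Dom C v) (transpose_left y v) = v"
proof -
  have "transpose_right C A (Dom C v) (transpose_left y v)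
      = farr G (\<epsilon> y) \<bullet>\<^bsub>C\<^esub> (farr G (farr F v) \<bullet>\<^bsub>C\<^esub> \<eta> (Dom C v))"
    using assms by (simp add: transpose_right_def transpose_left_def)
  also have "\<dots> = (farr G (\<epsilon> y) \<bullet>\<^bsub>C\<^esub> \<eta> (fobj G y)) \<bullet>\<^bsub>C\<^esub> v"
    using assms by (simp add: unit_natural)
  also have "\<dots> = v"
    using assms by (simp add: triangles del: C.Comp_assoc')
  finally show ?thesis .
qed

lemma transpose_left_right:
  assumes "g \<in> Arr D" "Dom D g = fobj F x" "x \<in> Obj C"
  shows "transpose_left (Cod D g) (transpose_right C A x g) = g"
proof -
  have "transpose_left (Cod D g) (transpose_right C A x g)
      = (\<epsilon> (Cod D g) \<bullet>\<^bsub>D\<^esub> farr F (farr G g)) \<bullet>\<^bsub>D\<^esub> farr F (\<eta> x)"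
    using assms by (simp add: transpose_right_def transpose_left_def)
  also have "\<dots> = g \<bullet>\<^bsub>D\<^esub> (\<epsilon> (fobj F x) \<bullet>\<^bsub>D\<^esub> farr F (\<eta> x))"
    using assms by (simp only: counit_natural) simp
  also have "\<dots> = g"
    using assms by (simp add: triangles)
  finally show ?thesis .
qed

lemma transpose_left_postcomp:
  assumes "v \<in> Arr C" "Cod C v = fobj G (Dom D g)" "g \<in> Arr D"
  shows "transpose_left (Cod D g) (farr G g \<bullet>\<^bsub>C\<^esub> v) = g \<bullet>\<^bsub>D\<^esub> transpose_left (Dom D g) v"
proof -
  have "transpose_left (Cod D g) (farr G g \<bullet>\<^bsub>C\<^esub> v)
      = (\<epsilon> (Cod D g) \<bullet>\<^bsub>D\<^esub> farr F (farr G g)) \<bullet>\<^bsub>D\<^esub> farr F v"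
    using assms by (simp add: transpose_left_def)
  also have "\<dots> = g \<bullet>\<^bsub>D\<^esub> transpose_left (Dom D g) v"
    using assms by (simp only: counit_natural) (simp add: transpose_left_def)
  finally show ?thesis .
qed

lemma transpose_right_postcomp:
  assumes "g \<in> Arr D" "Dom D g = fobj F x" "x \<in> Obj C" "h \<in> Arr D" "Dom D h = Cod D g"
  shows "transpose_right C A x (h \<bullet>\<^bsub>D\<^esub> g) = farr G h \<bullet>\<^bsub>C\<^esub> transpose_right C A x g"
  using assms by (simp add: transpose_right_def)

lemma transpose_left_inject:
  assumes "v \<in> Arr C" "w \<in> Arr C" "Cod C v = fobj G y" "Cod C w = fobj G y" "y \<in> Obj D"
    "Dom C v = Dom C w" "transpose_left y v = transpose_left y w"
  shows "v = w"
  by (metis assms transpose_right_left)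

text \<open>Equal composites with \<open>G m\<close> have transposes with equal composites with \<open>m\<close>.\<close>

lemma radj_monic:
  assumes "monic D m"
  shows "monic C (farr G m)"
  unfolding monic_def
proof (intro conjI allI ballI impI)
  have m: "m \<in> Arr D" using assms by (simp add: monic_def)
  then show "farr G m \<in> Arr C" by simp
  fix x g h
  assume "g \<in> hom C x (Dom C (farr G m))" "h \<in> hom C x (Dom C (farr G m))"
  then have gh: "g \<in> Arr C" "h \<in> Arr C" "Cod C g = fobj G (Dom D m)" "Cod C h = fobj G (Dom D m)"
    "Dom C g = Dom C h"
    using m by (auto simp: hom_def)
  assume "farr G m \<bullet>\<^bsub>C\<^esub> g = farr G m \<bullet>\<^bsub>C\<^esub> h"
  then have "m \<bullet>\<^bsub>D\<^esub> transpose_left (Dom D m) g = m \<bullet>\<^bsub>D\<^esub> transpose_left (Dom D m) h"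
    using transpose_left_postcomp[OF gh(1,3) m] transpose_left_postcomp[OF gh(2,4) m] by simp
  then have "transpose_left (Dom D m) g = transpose_left (Dom D m) h"
    by (rule D.monicD[OF assms]) (use m gh(1-4) in \<open>simp_all add: gh(5)\<close>)
  then show "g = h"
    by (rule transpose_left_inject[OF gh(1-4) D.Dom_Cod_Obj(1)[OF m] gh(5)])
qed

text \<open>
  Transposing a cone over \<open>G \<circ> T\<close> gives a cone over \<open>T\<close> with vertex in \<open>D\<close>, and a factorisation
  there transposes back.
\<close>

lemma radj_preserves_limit:
  assumes "category J" and T: "is_functor J D T" and lim: "is_limit J D T l \<pi>"
  shows "is_limit J C (ftor_comp G T) (fobj G l) (\<lambda>j. farr G (\<pi> j))"
proof -
  interpret J: category J by fact
  note [simp] = functorD[OF T]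
  have l [simp]: "l \<in> Obj D"
    and \<pi> [simp]: "\<And>j. j \<in> Obj J \<Longrightarrow> \<pi> j \<in> Arr D" "\<And>j. j \<in> Obj J \<Longrightarrow> Dom D (\<pi> j) = l"
      "\<And>j. j \<in> Obj J \<Longrightarrow> Cod D (\<pi> j) = fobj T j"
    and \<pi>_nat: "\<And>u. u \<in> Arr J \<Longrightarrow> farr T u \<bullet>\<^bsub>D\<^esub> \<pi> (Dom J u) = \<pi> (Cod J u)"
    and fac: "\<And>x \<kappa>. is_cone J D T x \<kappa> \<Longrightarrow> \<exists>!u. u \<in> hom D x l \<and> (\<forall>j \<in> Obj J. \<pi> j \<bullet>\<^bsub>D\<^esub> u = \<kappa> j)"
    using lim by (auto simp: is_limit_def is_cone_def hom_def)
  have cone: "is_cone J C (ftor_comp G T) (fobj G l) (\<lambda>j. farr G (\<pi> j))"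
    unfolding is_cone_def
  proof (intro conjI allI ballI)
    fix i j u assume "u \<in> hom J i j"
    then have u: "u \<in> Arr J" "i = Dom J u" "j = Cod J u" by (auto simp: hom_def)
    then show "farr (ftor_comp G T) u \<bullet>\<^bsub>C\<^esub> farr G (\<pi> i) = farr G (\<pi> j)"
      using \<pi>_nat[of u] by (simp flip: functor_Comp[OF right_functor])
  qed (simp_all add: hom_def)
  show ?thesis unfolding is_limit_def
  proof (intro conjI allI impI)
    fix x \<kappa> assume "is_cone J C (ftor_comp G T) x \<kappa>"
    then have x [simp]: "x \<in> Obj C"
      and \<kappa> [simp]: "\<And>j. j \<in> Obj J \<Longrightarrow> \<kappa> j \<in> Arr C" "\<And>j. j \<in> Obj J \<Longrightarrow> Dom C (\<kappa> j) = x"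
        "\<And>j. j \<in> Obj J \<Longrightarrow> Cod C (\<kappa> j) = fobj G (fobj T j)"
      and \<kappa>_nat: "\<And>u. u \<in> Arr J \<Longrightarrow> farr G (farr T u) \<bullet>\<^bsub>C\<^esub> \<kappa> (Dom J u) = \<kappa> (Cod J u)"
      by (auto simp: is_cone_def hom_def)
    let ?\<kappa> = "\<lambda>j. transpose_left (fobj T j) (\<kappa> j)"
    have "is_cone J D T (fobj F x) ?\<kappa>"
      unfolding is_cone_def
    proof (intro conjI allI ballI)
      fix i j u assume "u \<in> hom J i j"
      then have u: "u \<in> Arr J" "i = Dom J u" "j = Cod J u" by (auto simp: hom_def)
      then show "farr T u \<bullet>\<^bsub>D\<^esub> ?\<kappa> i = ?\<kappa> j"
        using \<kappa>_nat[of u] transpose_left_postcomp[of "\<kappa> i" "farr T u"] by simp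
    qed (simp_all add: hom_def)
    from ex1E[OF fac[OF this]] obtain u
      where u: "u \<in> hom D (fobj F x) l" "\<And>j. j \<in> Obj J \<Longrightarrow> \<pi> j \<bullet>\<^bsub>D\<^esub> u = ?\<kappa> j"
      and uniq: "\<And>v. v \<in> hom D (fobj F x) l \<Longrightarrow> (\<And>j. j \<in> Obj J \<Longrightarrow> \<pi> j \<bullet>\<^bsub>D\<^esub> v = ?\<kappa> j) \<Longrightarrow> v = u"
      by metis
    have u': "u \<in> Arr D" "Dom D u = fobj F x" "Cod D u = l" using u(1) by (auto simp: hom_def)
    show "\<exists>!u. u \<in> hom C x (fobj G l) \<and> (\<forall>j \<in> Obj J. farr G (\<pi> j) \<bullet>\<^bsub>C\<^esub> u = \<kappa> j)"
    proof (rule ex1I[of _ "transpose_right C A x u"], intro conjI ballI)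
      show "transpose_right C A x u \<in> hom C x (fobj G l)"
        using u' by (simp add: hom_def)
      fix j assume j: "j \<in> Obj J"
      have "farr G (\<pi> j) \<bullet>\<^bsub>C\<^esub> transpose_right C A x u = transpose_right C A x (?\<kappa> j)"
        using u' j transpose_right_postcomp[of u x "\<pi> j"] u(2)[OF j] by simp
      also have "\<dots> = \<kappa> j"
        using transpose_right_left[of "\<kappa> j" "fobj T j"] j by simp
      finally show "farr G (\<pi> j) \<bullet>\<^bsub>C\<^esub> transpose_right C A x u = \<kappa> j" .
    next
      fix v assume v: "v \<in> hom C x (fobj G l) \<and> (\<forall>j \<in> Obj J. farr G (\<pi> j) \<bullet>\<^bsub>C\<^esub> v = \<kappa> j)"
      then have v': "v \<in> Arr C" "Dom C v = x" "Cod C v = fobj G l" by (auto simp: hom_def)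
      have "transpose_left l v = u"
      proof (rule uniq)
        show "transpose_left l v \<in> hom D (fobj F x) l" using v' by (simp add: hom_def)
        fix j assume j: "j \<in> Obj J"
        show "\<pi> j \<bullet>\<^bsub>D\<^esub> transpose_left l v = ?\<kappa> j"
          using v v' j transpose_left_postcomp[of v "\<pi> j"] by simp
      qed
      then show "v = transpose_right C A x u"
        using transpose_right_left[of v l] v' by simp
    qed
  qed (rule cone)
qed

end

section \<open>The jet comonad\<close>

text \<open>
  Two adjunctions \<open>L \<stileturn> M \<stileturn> N\<close>; for the jets over \<open>\<Sigma>\<close> they are \<open>\<eta>\<^sub>! \<stileturn> \<eta>\<^sup>* \<stileturn> \<eta>\<^sub>*\<close>. The adjunction
  \<open>M \<stileturn> N\<close> makes \<open>J = M N\<close> a comonad; the other one makes \<open>M\<close>, and so \<open>J\<close>, preserve monomorphisms and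
  limits.
\<close>

locale jet_comonad = LM: adjoint_pair C D B1 + MN: adjoint_pair D C B2
  for C :: "('o, 'a) cat" (structure) and D :: "('p, 'b) cat" and B1 B2 +
  assumes middle: "radj B1 = ladj B2"
begin

abbreviation "J \<equiv> fobj (jet_functor B2)"
abbreviation "Jmap \<equiv> farr (jet_functor B2)"
abbreviation "jcounit \<equiv> jet_counit B2"
abbreviation "jcoprod \<equiv> jet_coproduct B2"
abbreviation "T \<equiv> fobj (disk_functor B1)"
abbreviation "tunit \<equiv> disk_unit B1"
abbreviation "adjunct \<equiv> jet_adjunct C D B1 B2"

lemma jet_is_functor: "is_functor C C (jet_functor B2)"
  unfolding jet_functor_def
  by (rule is_functor_comp[OF MN.right_functor MN.left_functor])

lemmas jet_functor_rules [simp] = functorD[OF jet_is_functor]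

lemma disk_obj [simp]: "x \<in> Obj C \<Longrightarrow> T x \<in> Obj C"
  by (simp add: disk_functor_def)

lemma jet_counit_arr [simp]:
  assumes "y \<in> Obj C"
  shows "jcounit y \<in> Arr C" "Dom C (jcounit y) = J y" "Cod C (jcounit y) = y"
  using assms by (simp_all add: jet_counit_def jet_functor_def)

lemma jet_coproduct_arr [simp]:
  assumes "y \<in> Obj C"
  shows "jcoprod y \<in> Arr C" "Dom C (jcoprod y) = J y" "Cod C (jcoprod y) = J (J y)"
  using assms by (simp_all add: jet_coproduct_def jet_functor_def)

lemma disk_unit_arr [simp]:
  assumes "x \<in> Obj C"
  shows "tunit x \<in> Arr C" "Dom C (tunit x) = x" "Cod C (tunit x) = T x"
  using assms by (simp_all add: disk_unit_def disk_functor_def)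

lemma jet_counit_natural:
  "f \<in> Arr C \<Longrightarrow> jcounit (Cod C f) \<bullet> Jmap f = f \<bullet> jcounit (Dom C f)"
  by (simp add: jet_counit_def jet_functor_def MN.counit_natural)

lemma jet_coproduct_natural:
  assumes "f \<in> Arr C"
  shows "jcoprod (Cod C f) \<bullet> Jmap f = Jmap (Jmap f) \<bullet> jcoprod (Dom C f)"
  using MN.unit_natural[of "farr (radj B2) f"] assms
  by (simp add: jet_coproduct_def jet_functor_def flip: functor_Comp[OF MN.left_functor])

lemma jet_counit_coproduct: "y \<in> Obj C \<Longrightarrow> jcounit (J y) \<bullet> jcoprod y = Id C (J y)"
  by (simp add: jet_counit_def jet_coproduct_def jet_functor_def MN.triangles)

lemma jet_map_counit_coproduct: "y \<in> Obj C \<Longrightarrow> Jmap (jcounit y) \<bullet> jcoprod y = Id C (J y)"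
  by (simp add: jet_counit_def jet_coproduct_def jet_functor_def MN.triangles
      flip: functor_Comp[OF MN.left_functor])

lemma jet_coproduct_coassoc:
  assumes "y \<in> Obj C"
  shows "Jmap (jcoprod y) \<bullet> jcoprod y = jcoprod (J y) \<bullet> jcoprod y"
  using MN.unit_natural[of "adj_unit B2 (fobj (radj B2) y)"] assms
  by (simp add: jet_coproduct_def jet_functor_def flip: functor_Comp[OF MN.left_functor])

lemma jet_monic: "monic C m \<Longrightarrow> monic C (Jmap m)"
  using LM.radj_monic[OF MN.radj_monic[of m]] by (simp add: jet_functor_def middle)

lemma jet_preserves_limit:
  assumes "category I" "is_functor I C G" "is_limit I C G l \<pi>"
  shows "is_limit I C (ftor_comp (jet_functor B2) G) (J l) (\<lambda>i. Jmap (\<pi> i))"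
  using LM.radj_preserves_limit[OF assms(1)
      is_functor_comp[OF assms(2) MN.right_functor] MN.radj_preserves_limit[OF assms]]
  by (simp add: jet_functor_def middle ftor_comp_assoc)

lemma adjunct_arr [simp]:
  assumes "\<sigma> \<in> Arr C" "Dom C \<sigma> = T x" "x \<in> Obj C"
  shows "adjunct x \<sigma> \<in> Arr C" "Dom C (adjunct x \<sigma>) = x" "Cod C (adjunct x \<sigma>) = J (Cod C \<sigma>)"
  using assms by (simp_all add: jet_adjunct_def disk_functor_def jet_functor_def middle)

lemma adjunct_postcomp:
  assumes "\<sigma> \<in> Arr C" "Dom C \<sigma> = T x" "x \<in> Obj C" "h \<in> Arr C" "Dom C h = Cod C \<sigma>"
  shows "adjunct x (h \<bullet> \<sigma>) = Jmap h \<bullet> adjunct x \<sigma>"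
  using assms
  by (simp add: jet_adjunct_def disk_functor_def jet_functor_def middle
      MN.transpose_right_postcomp LM.transpose_right_postcomp)

text \<open>
  The counit of \<open>M \<stileturn> N\<close> undoes the first of the two transpositions that make up the adjunct; what
  the second one leaves behind is the unit of \<open>L \<stileturn> M\<close>, which is \<open>\<eta>\<^sup>T\<close>.
\<close>

lemma counit_adjunct:
  assumes "\<sigma> \<in> Arr C" "Dom C \<sigma> = T x" "x \<in> Obj C"
  shows "jcounit (Cod C \<sigma>) \<bullet> adjunct x \<sigma> = \<sigma> \<bullet> tunit x"
proof -
  let ?l = "fobj (ladj B1) x"
  have d: "Dom C \<sigma> = fobj (ladj B2) ?l" using assms by (simp add: disk_functor_def middle)
  have "\<sigma> = MN.transpose_left (Cod C \<sigma>) (transpose_right D B2 ?l \<sigma>)"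
    using assms d by (simp add: MN.transpose_left_right)
  then have "\<sigma> \<bullet> tunit x
      = MN.transpose_left (Cod C \<sigma>) (transpose_right D B2 ?l \<sigma>) \<bullet> tunit x"
    by simp
  also have "\<dots> = jcounit (Cod C \<sigma>) \<bullet> adjunct x \<sigma>"
    using assms d
    by (simp add: MN.transpose_left_def disk_unit_def jet_counit_def jet_adjunct_def
        transpose_right_def[of C] middle)
  finally show ?thesis by simp
qed

lemma adjunct_surj:
  assumes "\<rho> \<in> Arr C" "Dom C \<rho> = x" "Cod C \<rho> = J y" "y \<in> Obj C"
  obtains \<sigma> where "\<sigma> \<in> Arr C" "Dom C \<sigma> = T x" "Cod C \<sigma> = y" "adjunct x \<sigma> = \<rho>"
proof -
  have x: "x \<in> Obj C" using assms by auto
  have c: "Cod C \<rho> = fobj (radj B1) (fobj (radj B2) y)"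
    using assms by (simp add: jet_functor_def middle)
  let ?\<sigma>' = "LM.transpose_left (fobj (radj B2) y) \<rho>"
  let ?\<sigma> = "MN.transpose_left y ?\<sigma>'"
  have \<sigma>': "?\<sigma>' \<in> Arr D" "Dom D ?\<sigma>' = fobj (ladj B1) x" "Cod D ?\<sigma>' = fobj (radj B2) y"
    using assms c by simp_all
  show thesis
  proof (rule that)
    show "?\<sigma> \<in> Arr C" "Dom C ?\<sigma> = T x" "Cod C ?\<sigma> = y"
      using \<sigma>' assms by (simp_all add: disk_functor_def middle)
    show "adjunct x ?\<sigma> = \<rho>"
      unfolding jet_adjunct_def
      using MN.transpose_right_left[OF \<sigma>'(1,3) assms(4)] LM.transpose_right_left[OF assms(1) c]
        \<sigma>' assms by simp
  qed
qed

section \<open>Formally integrable PDEs as coalgebras of jets\<close>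

definition coalgebra :: "'o \<Rightarrow> 'a \<Rightarrow> bool" where
  "coalgebra x \<rho> \<longleftrightarrow> \<rho> \<in> Arr C \<and> Dom C \<rho> = x \<and> Cod C \<rho> = J x \<and>
    jcounit x \<bullet> \<rho> = Id C x \<and> jcoprod x \<bullet> \<rho> = Jmap \<rho> \<bullet> \<rho>"

text \<open>
  The equation says that the inclusion of \<open>\<E>\<close> is a homomorphism to the cofree coalgebra \<open>JY\<close>. It has at
  most one solution, as \<open>J\<close> preserves monomorphisms; for a formally integrable PDE it has one.
\<close>

definition coaction :: "('o, 'a) gpde \<Rightarrow> 'a" where
  "coaction P = (THE \<rho>. \<rho> \<in> hom C (underlying C P) (J (underlying C P)) \<and>
     Jmap (pde_incl P) \<bullet> \<rho> = jcoprod (pde_bundle P) \<bullet> pde_incl P)"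

lemma coaction_eqI:
  assumes P: "generalized_pde C B2 P"
    and \<rho>: "\<rho> \<in> Arr C" "Dom C \<rho> = underlying C P" "Cod C \<rho> = J (underlying C P)"
    and eq: "Jmap (pde_incl P) \<bullet> \<rho> = jcoprod (pde_bundle P) \<bullet> pde_incl P"
  shows "coaction P = \<rho>"
  unfolding coaction_def
proof (rule the_equality)
  fix \<rho>'
  assume \<rho>': "\<rho>' \<in> hom C (underlying C P) (J (underlying C P)) \<and>
     Jmap (pde_incl P) \<bullet> \<rho>' = jcoprod (pde_bundle P) \<bullet> pde_incl P"
  have e: "pde_incl P \<in> Arr C" "monic C (pde_incl P)"
    using P by (auto simp: generalized_pde_def monic_def)
  show "\<rho>' = \<rho>"
    by (rule LM.C.monicD[OF jet_monic[OF e(2)]])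
      (use \<rho>' \<rho> eq e in \<open>auto simp: underlying_def hom_def\<close>)
qed (use \<rho> eq in \<open>simp add: hom_def\<close>)

text \<open>
  The inverse of \<open>\<E>\<^sup>\<infinity> \<rightarrow> \<E>\<close> followed by \<open>\<E>\<^sup>\<infinity> \<rightarrow> J\<E>\<close> restricts the coproduct of \<open>JY\<close> to \<open>\<E>\<close>; the
  coalgebra laws then hold because they hold for \<open>JY\<close> and \<open>J\<close> preserves monomorphisms.
\<close>

lemma integrable_pde_coaction:
  assumes P: "generalized_pde C B2 P" and int: "formally_integrable C B2 P"
  shows "coalgebra (underlying C P) (coaction P)"
    and "Jmap (pde_incl P) \<bullet> coaction P = jcoprod (pde_bundle P) \<bullet> pde_incl P"
proof -
  define e Y x where "e = pde_incl P" and "Y = pde_bundle P" and "x = underlying C P"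
  have Y [simp]: "Y \<in> Obj C" and e [simp]: "e \<in> Arr C" "Dom C e = x" "Cod C e = J Y"
    and mono: "monic C e"
    using P by (auto simp: generalized_pde_def e_def Y_def x_def underlying_def monic_def)
  have x [simp]: "x \<in> Obj C" using e by (metis LM.C.Dom_Cod_Obj(1))
  obtain p q where pq: "is_prolongation C B2 P p q" and iso: "is_iso C (jcounit x \<bullet> q)"
    using int by (auto simp: formally_integrable_def x_def)
  then have [simp]: "p \<in> Arr C" "q \<in> Arr C" "Dom C p = Dom C q" "Cod C p = J Y" "Cod C q = J x"
    and sq: "jcoprod Y \<bullet> p = Jmap e \<bullet> q"
    by (auto simp: is_prolongation_def is_pullback_def simp flip: e_def Y_def)
  obtain r where r [simp]: "r \<in> Arr C" "Dom C r = x" "Cod C r = Dom C q"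
    and inv: "(jcounit x \<bullet> q) \<bullet> r = Id C x"
    using iso by (auto simp: is_iso_def hom_def)
  \<comment> \<open>The prolongation includes into \<open>JY\<close> through \<open>\<E>\<close>.\<close>
  have "e \<bullet> (jcounit x \<bullet> q) = (e \<bullet> jcounit x) \<bullet> q" by simp
  also have "\<dots> = (jcounit (J Y) \<bullet> Jmap e) \<bullet> q"
    using jet_counit_natural[of e] by simp
  also have "\<dots> = (jcounit (J Y) \<bullet> jcoprod Y) \<bullet> p"
    using sq by simp
  also have "\<dots> = p" by (simp only: jet_counit_coproduct[OF Y]) simp
  finally have p: "p = e \<bullet> (jcounit x \<bullet> q)" by simp
  define \<rho> where "\<rho> = q \<bullet> r"
  have \<rho> [simp]: "\<rho> \<in> Arr C" "Dom C \<rho> = x" "Cod C \<rho> = J x"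
    by (simp_all add: \<rho>_def)
  have "Jmap e \<bullet> \<rho> = (Jmap e \<bullet> q) \<bullet> r" by (simp add: \<rho>_def)
  also have "\<dots> = jcoprod Y \<bullet> (p \<bullet> r)" by (simp flip: sq)
  also have "p \<bullet> r = e \<bullet> ((jcounit x \<bullet> q) \<bullet> r)" by (simp add: p)
  also have "\<dots> = e" by (simp only: inv) simp
  finally have eq: "Jmap e \<bullet> \<rho> = jcoprod Y \<bullet> e" .
  have co: "coaction P = \<rho>"
    by (rule coaction_eqI[OF P]) (use eq in \<open>simp_all flip: e_def Y_def x_def\<close>)
  \<comment> \<open>Both laws hold for \<open>JY\<close> and are pulled back along the monomorphisms \<open>e\<close> and \<open>JJe\<close>.\<close>
  have "e \<bullet> (jcounit x \<bullet> \<rho>) = (e \<bullet> jcounit x) \<bullet> \<rho>" by simp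
  also have "\<dots> = (jcounit (J Y) \<bullet> Jmap e) \<bullet> \<rho>"
    using jet_counit_natural[of e] by simp
  also have "\<dots> = (jcounit (J Y) \<bullet> jcoprod Y) \<bullet> e"
    using eq by simp
  also have "\<dots> = e \<bullet> Id C x" by (simp only: jet_counit_coproduct[OF Y]) simp
  finally have counit: "jcounit x \<bullet> \<rho> = Id C x"
    by (rule LM.C.monicD[OF mono]) simp_all
  have "Jmap (Jmap e) \<bullet> (jcoprod x \<bullet> \<rho>) = (jcoprod (J Y) \<bullet> Jmap e) \<bullet> \<rho>"
    using jet_coproduct_natural[of e] by (simp flip: LM.C.Comp_assoc')
  also have "\<dots> = jcoprod (J Y) \<bullet> (jcoprod Y \<bullet> e)"
    by (simp add: eq)
  also have "\<dots> = Jmap (jcoprod Y) \<bullet> (jcoprod Y \<bullet> e)"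
    by (rule LM.C.Comp_extend) (simp_all add: jet_coproduct_coassoc)
  also have "\<dots> = Jmap (jcoprod Y \<bullet> e) \<bullet> \<rho>"
    by (simp add: eq)
  also have "\<dots> = Jmap (Jmap e \<bullet> \<rho>) \<bullet> \<rho>"
    by (simp only: eq)
  also have "\<dots> = Jmap (Jmap e) \<bullet> (Jmap \<rho> \<bullet> \<rho>)"
    by simp
  finally have "jcoprod x \<bullet> \<rho> = Jmap \<rho> \<bullet> \<rho>"
    by (rule LM.C.monicD[OF jet_monic[OF jet_monic[OF mono]]]) simp_all
  with counit show "coalgebra (underlying C P) (coaction P)"
    by (simp add: coalgebra_def co flip: x_def)
  show "Jmap (pde_incl P) \<bullet> coaction P = jcoprod (pde_bundle P) \<bullet> pde_incl P"
    using eq by (simp add: co flip: e_def Y_def)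
qed

text \<open>
  The counit law makes the structure map a split monomorphism, so that a coalgebra is a PDE on
  itself. It is its own prolongation: composing \<open>\<Delta> \<circ> h = J\<rho> \<circ> k\<close> with \<open>J\<epsilon>\<close> and with \<open>\<epsilon>\<close> shows that
  \<open>h = k\<close> and that \<open>h\<close> factors through \<open>\<rho>\<close>.
\<close>

lemma coalgebra_pde:
  assumes \<rho>: "coalgebra x \<rho>"
  defines "P \<equiv> \<lparr>pde_bundle = x, pde_incl = \<rho>\<rparr>"
  shows "generalized_pde C B2 P" "formally_integrable C B2 P" "underlying C P = x"
    "coaction P = \<rho>"
proof -
  have \<rho>_arr [simp]: "\<rho> \<in> Arr C" "Dom C \<rho> = x" "Cod C \<rho> = J x"
    and counit: "jcounit x \<bullet> \<rho> = Id C x" and coassoc: "jcoprod x \<bullet> \<rho> = Jmap \<rho> \<bullet> \<rho>"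
    using \<rho> by (auto simp: coalgebra_def)
  have x [simp]: "x \<in> Obj C" using \<rho>_arr by (metis LM.C.Dom_Cod_Obj(1))
  have retract: "jcounit x \<bullet> (\<rho> \<bullet> g) = g" if "g \<in> Arr C" "Cod C g = x" for g
  proof -
    have "jcounit x \<bullet> (\<rho> \<bullet> g) = (jcounit x \<bullet> \<rho>) \<bullet> g" using that by simp
    then show ?thesis using that by (simp only: counit) simp
  qed
  have "monic C \<rho>"
    unfolding monic_def hom_def using retract by (auto, metis)
  then show P: "generalized_pde C B2 P"
    by (simp add: generalized_pde_def P_def)
  show u: "underlying C P = x" by (simp add: underlying_def P_def)
  show "coaction P = \<rho>"
    by (rule coaction_eqI[OF P]) (simp_all add: P_def underlying_def coassoc)
  have "is_prolongation C B2 P \<rho> \<rho>"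
    unfolding is_prolongation_def is_pullback_def
  proof (intro conjI allI ballI impI)
    fix z h k
    assume "h \<in> hom C z (Dom C (jcoprod (pde_bundle P)))" "k \<in> hom C z (Dom C (Jmap (pde_incl P)))"
      and "jcoprod (pde_bundle P) \<bullet> h = Jmap (pde_incl P) \<bullet> k"
    then have hk [simp]: "h \<in> Arr C" "k \<in> Arr C" "Dom C h = z" "Dom C k = z"
      "Cod C h = J x" "Cod C k = J x"
      and eq: "jcoprod x \<bullet> h = Jmap \<rho> \<bullet> k"
      by (auto simp: hom_def P_def)
    have z: "z \<in> Obj C" using hk by (metis LM.C.Dom_Cod_Obj(1))
    have "h = (Jmap (jcounit x) \<bullet> jcoprod x) \<bullet> h"
      by (simp only: jet_map_counit_coproduct[OF x]) simp
    also have "\<dots> = Jmap (jcounit x \<bullet> \<rho>) \<bullet> k" by (simp add: eq)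
    also have "\<dots> = k" by (simp only: counit) simp
    finally have hk': "h = k" .
    have "h = (jcounit (J x) \<bullet> jcoprod x) \<bullet> h"
      by (simp only: jet_counit_coproduct[OF x]) simp
    also have "\<dots> = (jcounit (J x) \<bullet> Jmap \<rho>) \<bullet> k" by (simp add: eq)
    also have "\<dots> = \<rho> \<bullet> (jcounit x \<bullet> k)"
      using jet_counit_natural[of \<rho>] by simp
    finally have "h = \<rho> \<bullet> (jcounit x \<bullet> h)" by (simp only: hk')
    then show "\<exists>!u. u \<in> hom C z (Dom C \<rho>) \<and> \<rho> \<bullet> u = h \<and> \<rho> \<bullet> u = k"
      using hk' retract by (intro ex1I[of _ "jcounit x \<bullet> h"]) (auto simp: hom_def)
  qed (simp_all add: P_def coassoc)
  moreover have "is_iso C (jcounit (underlying C P) \<bullet> \<rho>)"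
    unfolding u counit is_iso_def by (auto intro!: bexI[of _ "Id C x"] simp: hom_def)
  ultimately show "formally_integrable C B2 P"
    unfolding formally_integrable_def by blast
qed

text \<open>
  Cancelling the monomorphism \<open>Je\<close> removes the ambient bundle from the definition of a formal
  solution. In terms of the \<open>T\<close>-algebra corresponding to the coalgebra \<open>\<E>\<close>, the remaining equation
  says that \<open>s\<close> is a homomorphism from the free algebra \<open>TX\<close>.
\<close>

lemma formal_solution_iff:
  assumes P: "generalized_pde C B2 P" "formally_integrable C B2 P"
  shows "formal_solution_family C D B1 B2 P x s \<longleftrightarrow>
    x \<in> Obj C \<and> s \<in> hom C (T x) (underlying C P) \<and> coaction P \<bullet> (s \<bullet> tunit x) = adjunct x s"
proof -
  define e Y E \<rho> where "e = pde_incl P" and "Y = pde_bundle P" and "E = underlying C P"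
    and "\<rho> = coaction P"
  have Y [simp]: "Y \<in> Obj C" and e [simp]: "e \<in> Arr C" "Dom C e = E" "Cod C e = J Y"
    and mono: "monic C e"
    using P by (auto simp: generalized_pde_def e_def Y_def E_def underlying_def monic_def)
  have \<rho> [simp]: "\<rho> \<in> Arr C" "Dom C \<rho> = E" "Cod C \<rho> = J E" and eq: "Jmap e \<bullet> \<rho> = jcoprod Y \<bullet> e"
    using integrable_pde_coaction[OF P]
    by (auto simp: coalgebra_def simp flip: e_def Y_def E_def \<rho>_def)
  have "jcoprod Y \<bullet> ((e \<bullet> s) \<bullet> tunit x) = adjunct x (e \<bullet> s) \<longleftrightarrow>
      \<rho> \<bullet> (s \<bullet> tunit x) = adjunct x s"
    if [simp]: "x \<in> Obj C" "s \<in> Arr C" "Dom C s = T x" "Cod C s = E"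
  proof -
    have "jcoprod Y \<bullet> ((e \<bullet> s) \<bullet> tunit x) = jcoprod Y \<bullet> (e \<bullet> (s \<bullet> tunit x))" by simp
    also have "\<dots> = Jmap e \<bullet> (\<rho> \<bullet> (s \<bullet> tunit x))"
      by (rule LM.C.Comp_extend) (simp_all add: eq)
    moreover have "adjunct x (e \<bullet> s) = Jmap e \<bullet> adjunct x s"
      by (simp add: adjunct_postcomp)
    moreover have "Jmap e \<bullet> (\<rho> \<bullet> (s \<bullet> tunit x)) = Jmap e \<bullet> adjunct x s \<longleftrightarrow>
        \<rho> \<bullet> (s \<bullet> tunit x) = adjunct x s"
      using LM.C.monicD[OF jet_monic[OF mono], of "\<rho> \<bullet> (s \<bullet> tunit x)" "adjunct x s"] by auto
    ultimately show ?thesis by simp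
  qed
  then show ?thesis
    unfolding formal_solution_family_def Let_def
    by (auto simp: hom_def simp flip: e_def Y_def E_def \<rho>_def)
qed

text \<open>
  The family that detects the coalgebra equation is the algebra structure map \<open>a : TE \<rightarrow> E\<close>, the
  adjunct of \<open>\<rho>\<close>: it is a formal solution with \<open>a \<circ> \<eta>\<^sup>T = id\<close>, so requiring \<open>\<phi> \<circ> a\<close> to be a formal
  solution reads \<open>\<rho>' \<circ> \<phi> = J\<phi> \<circ> \<rho>\<close>.
\<close>

lemma pde_morphism_iff:
  assumes P: "generalized_pde C B2 P" "formally_integrable C B2 P"
    and Q: "generalized_pde C B2 Q" "formally_integrable C B2 Q"
  shows "pde_morphism C D B1 B2 P Q \<phi> \<longleftrightarrow> \<phi> \<in> hom C (underlying C P) (underlying C Q) \<and>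
    coaction Q \<bullet> \<phi> = Jmap \<phi> \<bullet> coaction P"
proof -
  define E \<rho> E' \<rho>' where "E = underlying C P" and "\<rho> = coaction P"
    and "E' = underlying C Q" and "\<rho>' = coaction Q"
  have \<rho> [simp]: "\<rho> \<in> Arr C" "Dom C \<rho> = E" "Cod C \<rho> = J E" and counit: "jcounit E \<bullet> \<rho> = Id C E"
    using integrable_pde_coaction(1)[OF P] by (auto simp: coalgebra_def simp flip: E_def \<rho>_def)
  have \<rho>' [simp]: "\<rho>' \<in> Arr C" "Dom C \<rho>' = E'" "Cod C \<rho>' = J E'"
    using integrable_pde_coaction(1)[OF Q] by (auto simp: coalgebra_def simp flip: E'_def \<rho>'_def)
  have E [simp]: "E \<in> Obj C" using \<rho> by (metis LM.C.Dom_Cod_Obj(1))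
  have "(\<forall>x s. x \<in> Obj C \<and> s \<in> hom C (T x) E \<and> \<rho> \<bullet> (s \<bullet> tunit x) = adjunct x s \<longrightarrow>
          \<phi> \<bullet> s \<in> hom C (T x) E' \<and> \<rho>' \<bullet> ((\<phi> \<bullet> s) \<bullet> tunit x) = adjunct x (\<phi> \<bullet> s)) \<longleftrightarrow>
      \<rho>' \<bullet> \<phi> = Jmap \<phi> \<bullet> \<rho>" (is "?solutions \<longleftrightarrow> ?coalg")
    if [simp]: "\<phi> \<in> Arr C" "Dom C \<phi> = E" "Cod C \<phi> = E'"
  proof
    assume sol: ?solutions
    obtain a where a [simp]: "a \<in> Arr C" "Dom C a = T E" "Cod C a = E" and adj: "adjunct E a = \<rho>"
      using adjunct_surj[OF \<rho> E] by metis
    have unit: "a \<bullet> tunit E = Id C E"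
      using counit_adjunct[of a E] by (simp add: adj counit)
    then have "\<rho>' \<bullet> ((\<phi> \<bullet> a) \<bullet> tunit E) = adjunct E (\<phi> \<bullet> a)"
      using sol[rule_format, of E a] by (simp add: hom_def adj)
    then show ?coalg
      by (simp add: unit adjunct_postcomp adj)
  next
    assume coalg: ?coalg
    show ?solutions
    proof (intro allI impI)
      fix x s
      assume s: "x \<in> Obj C \<and> s \<in> hom C (T x) E \<and> \<rho> \<bullet> (s \<bullet> tunit x) = adjunct x s"
      then have [simp]: "x \<in> Obj C" "s \<in> Arr C" "Dom C s = T x" "Cod C s = E"
        by (auto simp: hom_def)
      have "\<rho>' \<bullet> ((\<phi> \<bullet> s) \<bullet> tunit x) = \<rho>' \<bullet> (\<phi> \<bullet> (s \<bullet> tunit x))" by simp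
      also have "\<dots> = Jmap \<phi> \<bullet> (\<rho> \<bullet> (s \<bullet> tunit x))"
        by (rule LM.C.Comp_extend) (simp_all add: coalg)
      also have "\<dots> = adjunct x (\<phi> \<bullet> s)"
        using s by (simp add: adjunct_postcomp)
      finally show "\<phi> \<bullet> s \<in> hom C (T x) E' \<and> \<rho>' \<bullet> ((\<phi> \<bullet> s) \<bullet> tunit x) = adjunct x (\<phi> \<bullet> s)"
        by (simp add: hom_def)
    qed
  qed
  then show ?thesis
    unfolding pde_morphism_def formal_solution_iff[OF P] formal_solution_iff[OF Q]
    by (auto simp: hom_def simp flip: E_def \<rho>_def E'_def \<rho>'_def)
qed

end

section \<open>Limits of coalgebras\<close>

lemma is_limitD:
  assumes "is_limit I C G l \<pi>"
  shows "l \<in> Obj C" "i \<in> Obj I \<Longrightarrow> \<pi> i \<in> Arr C" "i \<in> Obj I \<Longrightarrow> Dom C (\<pi> i) = l"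
    "i \<in> Obj I \<Longrightarrow> Cod C (\<pi> i) = fobj G i"
    "m \<in> Arr I \<Longrightarrow> farr G m \<bullet>\<^bsub>C\<^esub> \<pi> (Dom I m) = \<pi> (Cod I m)"
  using assms unfolding is_limit_def is_cone_def hom_def by blast+

lemma is_coneI:
  assumes "x \<in> Obj C" "\<And>i. i \<in> Obj I \<Longrightarrow> \<kappa> i \<in> hom C x (fobj G i)"
    "\<And>m. m \<in> Arr I \<Longrightarrow> farr G m \<bullet>\<^bsub>C\<^esub> \<kappa> (Dom I m) = \<kappa> (Cod I m)"
  shows "is_cone I C G x \<kappa>"
  using assms unfolding is_cone_def hom_def by blast

lemma is_limitE:
  assumes "is_limit I C G l \<pi>" "is_cone I C G x \<kappa>"
  obtains u where "u \<in> Arr C" "Dom C u = x" "Cod C u = l"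
    "\<And>i. i \<in> Obj I \<Longrightarrow> \<pi> i \<bullet>\<^bsub>C\<^esub> u = \<kappa> i"
  using assms unfolding is_limit_def hom_def by blast

lemma (in category) is_limit_joint_monic:
  assumes lim: "is_limit I C G l \<pi>" and I: "category I" and G: "is_functor I C G"
    and u: "u \<in> Arr C" "v \<in> Arr C" "Dom C u = Dom C v" "Cod C u = l" "Cod C v = l"
    and eq: "\<And>i. i \<in> Obj I \<Longrightarrow> \<pi> i \<bullet> u = \<pi> i \<bullet> v"
  shows "u = v"
proof -
  interpret I: category I by fact
  note [simp] = is_limitD(1-4)[OF lim] functorD[OF G]
  have "is_cone I C G (Dom C u) (\<lambda>i. \<pi> i \<bullet> u)"
  proof (rule is_coneI)
    fix m assume m: "m \<in> Arr I"
    have "farr G m \<bullet> (\<pi> (Dom I m) \<bullet> u) = (farr G m \<bullet> \<pi> (Dom I m)) \<bullet> u"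
      using m u by simp
    then show "farr G m \<bullet> (\<pi> (Dom I m) \<bullet> u) = \<pi> (Cod I m) \<bullet> u"
      using is_limitD(5)[OF lim m] by simp
  qed (use u in \<open>simp_all add: hom_def\<close>)
  then have "\<exists>!w. w \<in> hom C (Dom C u) l \<and> (\<forall>i \<in> Obj I. \<pi> i \<bullet> w = \<pi> i \<bullet> u)"
    using lim unfolding is_limit_def by blast
  moreover have "u \<in> hom C (Dom C u) l" "v \<in> hom C (Dom C u) l"
    using u by (auto simp: hom_def)
  ultimately show ?thesis using eq by metis
qed

text \<open>
  If the legs \<open>\<pi>'\<close> factor through the limit by \<open>u\<close> and \<open>u\<close> has the retraction \<open>v\<close> over the diagram, then
  factorisations through \<open>l\<close> are moved to \<open>l'\<close> by \<open>v\<close>, and \<open>u\<close>, being split, reflects their uniqueness.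
\<close>

lemma (in category) is_limit_retract:
  assumes lim: "is_limit I C G l \<pi>" and I: "category I" and G: "is_functor I C G"
    and u: "u \<in> hom C l' l" and v: "v \<in> hom C l l'" and vu: "v \<bullet> u = Id C l'"
    and \<pi>u: "\<And>i. i \<in> Obj I \<Longrightarrow> \<pi> i \<bullet> u = \<pi>' i" and \<pi>v: "\<And>i. i \<in> Obj I \<Longrightarrow> \<pi>' i \<bullet> v = \<pi> i"
  shows "is_limit I C G l' \<pi>'"
proof -
  interpret I: category I by fact
  note [simp] = is_limitD(1-4)[OF lim] functorD[OF G]
  have u' [simp]: "u \<in> Arr C" "Dom C u = l'" "Cod C u = l"
    and v' [simp]: "v \<in> Arr C" "Dom C v = l" "Cod C v = l'"
    using u v by (auto simp: hom_def)
  have l' [simp]: "l' \<in> Obj C" using u' by (metis Dom_Cod_Obj(1))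
  have \<pi>': "\<pi>' i \<in> Arr C" "Dom C (\<pi>' i) = l'" "Cod C (\<pi>' i) = fobj G i" if "i \<in> Obj I" for i
    using that by (simp_all flip: \<pi>u)
  have cone: "is_cone I C G l' \<pi>'"
  proof (rule is_coneI)
    fix m assume m: "m \<in> Arr I"
    have "farr G m \<bullet> \<pi>' (Dom I m) = (farr G m \<bullet> \<pi> (Dom I m)) \<bullet> u"
      using m by (simp flip: \<pi>u)
    also have "\<dots> = \<pi>' (Cod I m)"
      using m by (simp add: is_limitD(5)[OF lim] \<pi>u)
    finally show "farr G m \<bullet> \<pi>' (Dom I m) = \<pi>' (Cod I m)" .
  qed (use \<pi>' in \<open>simp_all add: hom_def\<close>)
  show ?thesis unfolding is_limit_def
  proof (intro conjI allI impI)
    fix x \<kappa> assume "is_cone I C G x \<kappa>"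
    then obtain w where w: "w \<in> Arr C" "Dom C w = x" "Cod C w = l"
      "\<And>i. i \<in> Obj I \<Longrightarrow> \<pi> i \<bullet> w = \<kappa> i"
      by (rule is_limitE[OF lim]) blast
    show "\<exists>!w'. w' \<in> hom C x l' \<and> (\<forall>i \<in> Obj I. \<pi>' i \<bullet> w' = \<kappa> i)"
    proof (rule ex1I[of _ "v \<bullet> w"], intro conjI ballI)
      show "v \<bullet> w \<in> hom C x l'" using w by (simp add: hom_def)
      fix i assume i: "i \<in> Obj I"
      have "\<pi>' i \<bullet> (v \<bullet> w) = (\<pi>' i \<bullet> v) \<bullet> w"
        using i w \<pi>' by simp
      then show "\<pi>' i \<bullet> (v \<bullet> w) = \<kappa> i" using i w by (simp add: \<pi>v)
    next
      fix w' assume w'_cone: "w' \<in> hom C x l' \<and> (\<forall>i \<in> Obj I. \<pi>' i \<bullet> w' = \<kappa> i)"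
      then have w' [simp]: "w' \<in> Arr C" "Dom C w' = x" "Cod C w' = l'"
        by (auto simp: hom_def)
      have "u \<bullet> w' = w"
      proof (rule is_limit_joint_monic[OF lim I G])
        fix i assume i: "i \<in> Obj I"
        have "\<pi> i \<bullet> (u \<bullet> w') = (\<pi> i \<bullet> u) \<bullet> w'" using i by simp
        then show "\<pi> i \<bullet> (u \<bullet> w') = \<pi> i \<bullet> w"
          using i w w'_cone by (simp add: \<pi>u)
      qed (use w in simp_all)
      then have "v \<bullet> w = (v \<bullet> u) \<bullet> w'" by simp
      then show "w' = v \<bullet> w" by (simp only: vu) simp
    qed
  qed (rule cone)
qed

context jet_comonad
begin

abbreviation "PDE \<equiv> pde_category C D B1 B2"
abbreviation "U \<equiv> underlying_functor C"

lemma PDE_Obj: "P \<in> Obj PDE \<longleftrightarrow> generalized_pde C B2 P \<and> formally_integrable C B2 P"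
  by (simp add: pde_category_def)

lemma PDE_simps [simp]:
  "Dom PDE (P, \<phi>, Q) = P" "Cod PDE (P, \<phi>, Q) = Q" "Id PDE P = (P, Id C (underlying C P), P)"
  "(P', \<psi>, Q') \<bullet>\<^bsub>PDE\<^esub> (P, \<phi>, Q) = (P, \<psi> \<bullet> \<phi>, Q')"
  by (simp_all add: pde_category_def Let_def)

lemma underlying_functor_simps [simp]:
  "fobj U P = underlying C P" "farr U (P, \<phi>, Q) = \<phi>"
  by (simp_all add: underlying_functor_def)

lemma PDE_Arr:
  "(P, \<phi>, Q) \<in> Arr PDE \<longleftrightarrow> P \<in> Obj PDE \<and> Q \<in> Obj PDE \<and>
    \<phi> \<in> Arr C \<and> Dom C \<phi> = underlying C P \<and> Cod C \<phi> = underlying C Q \<and>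
    coaction Q \<bullet> \<phi> = Jmap \<phi> \<bullet> coaction P"
  using pde_morphism_iff[of P Q \<phi>] by (auto simp: pde_category_def hom_def)

lemma PDE_coaction:
  assumes "P \<in> Obj PDE"
  shows "coaction P \<in> Arr C" "Dom C (coaction P) = underlying C P"
    "Cod C (coaction P) = J (underlying C P)" "underlying C P \<in> Obj C"
    "jcounit (underlying C P) \<bullet> coaction P = Id C (underlying C P)"
    "jcoprod (underlying C P) \<bullet> coaction P = Jmap (coaction P) \<bullet> coaction P"
  using integrable_pde_coaction(1)[of P] assms LM.C.Dom_Cod_Obj(1)[of "coaction P"]
  by (auto simp: coalgebra_def PDE_Obj)

lemma PDE_category: "category PDE"
proof
  note [simp] = PDE_coaction(1-4)
  fix a b c P Q R S
  show "a \<in> Arr PDE \<Longrightarrow> Dom PDE a \<in> Obj PDE" "a \<in> Arr PDE \<Longrightarrow> Cod PDE a \<in> Obj PDE"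
    by (cases a; simp add: PDE_Arr)+
  show "P \<in> Obj PDE \<Longrightarrow> Id PDE P \<in> hom PDE P P"
    by (simp add: hom_def PDE_Arr)
  show "b \<bullet>\<^bsub>PDE\<^esub> a \<in> hom PDE P R" if ab: "a \<in> hom PDE P Q" "b \<in> hom PDE Q R"
  proof -
    from ab obtain \<phi> \<psi> where eq: "a = (P, \<phi>, Q)" "b = (Q, \<psi>, R)"
      by (cases a; cases b) (auto simp: hom_def)
    with ab have [simp]: "P \<in> Obj PDE" "Q \<in> Obj PDE" "R \<in> Obj PDE"
      and \<phi> [simp]: "\<phi> \<in> Arr C" "Dom C \<phi> = underlying C P" "Cod C \<phi> = underlying C Q"
      and \<psi> [simp]: "\<psi> \<in> Arr C" "Dom C \<psi> = underlying C Q" "Cod C \<psi> = underlying C R"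
      and \<phi>_co: "coaction Q \<bullet> \<phi> = Jmap \<phi> \<bullet> coaction P"
      and \<psi>_co: "coaction R \<bullet> \<psi> = Jmap \<psi> \<bullet> coaction Q"
      by (auto simp: hom_def PDE_Arr)
    have "coaction R \<bullet> (\<psi> \<bullet> \<phi>) = Jmap \<psi> \<bullet> (coaction Q \<bullet> \<phi>)"
      by (rule LM.C.Comp_extend) (simp_all add: \<psi>_co)
    then show ?thesis by (simp add: eq hom_def PDE_Arr \<phi>_co)
  qed
  show "a \<in> hom PDE P Q \<Longrightarrow> Id PDE Q \<bullet>\<^bsub>PDE\<^esub> a = a" "a \<in> hom PDE P Q \<Longrightarrow> a \<bullet>\<^bsub>PDE\<^esub> Id PDE P = a"
    by (cases a; auto simp: hom_def PDE_Arr)+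
  show "\<lbrakk>a \<in> hom PDE P Q; b \<in> hom PDE Q R; c \<in> hom PDE R S\<rbrakk>
      \<Longrightarrow> (c \<bullet>\<^bsub>PDE\<^esub> b) \<bullet>\<^bsub>PDE\<^esub> a = c \<bullet>\<^bsub>PDE\<^esub> (b \<bullet>\<^bsub>PDE\<^esub> a)"
    by (cases a; cases b; cases c) (auto simp: hom_def PDE_Arr)
qed

lemma underlying_is_functor: "is_functor PDE C U"
proof (rule is_functorI)
  fix a b
  show "a \<in> Arr PDE \<Longrightarrow> farr U a \<in> Arr C" "a \<in> Arr PDE \<Longrightarrow> Dom C (farr U a) = fobj U (Dom PDE a)"
    "a \<in> Arr PDE \<Longrightarrow> Cod C (farr U a) = fobj U (Cod PDE a)"
    by (cases a; simp add: PDE_Arr)+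
  show "farr U (b \<bullet>\<^bsub>PDE\<^esub> a) = farr U b \<bullet> farr U a"
    by (cases a; cases b; simp)
qed (simp_all add: PDE_coaction)

text \<open>
  As \<open>J\<close> preserves the limit, the coactions of the vertices induce one on the limit, and \<open>JJ\<close> of the
  limit being a limit too makes it coassociative. The resulting coalgebra is a PDE on itself.
\<close>

lemma PDE_limit:
  assumes I: "category I" and G: "is_functor I PDE G"
    and lim: "is_limit I C (ftor_comp U G) l \<pi>"
  obtains \<rho> where "underlying C \<lparr>pde_bundle = l, pde_incl = \<rho>\<rparr> = l"
    and "is_limit I PDE G \<lparr>pde_bundle = l, pde_incl = \<rho>\<rparr>
      (\<lambda>i. (\<lparr>pde_bundle = l, pde_incl = \<rho>\<rparr>, \<pi> i, fobj G i))"
proof -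
  interpret I: category I by fact
  have UG: "is_functor I C (ftor_comp U G)"
    by (rule is_functor_comp[OF G underlying_is_functor])
  have Jlim: "is_limit I C (ftor_comp (jet_functor B2) (ftor_comp U G)) (J l) (\<lambda>i. Jmap (\<pi> i))"
    by (rule jet_preserves_limit[OF I UG lim])
  have JUG: "is_functor I C (ftor_comp (jet_functor B2) (ftor_comp U G))"
    by (rule is_functor_comp[OF UG jet_is_functor])
  note JJlim = jet_preserves_limit[OF I JUG Jlim]
  note JJUG = is_functor_comp[OF JUG jet_is_functor]
  define E \<rho> where "E i = underlying C (fobj G i)" and "\<rho> i = coaction (fobj G i)" for i
  have [simp]: "fobj G i \<in> Obj PDE" if "i \<in> Obj I" for i
    using functor_obj[OF G that] .
  have \<rho> [simp]: "\<rho> i \<in> Arr C" "Dom C (\<rho> i) = E i" "Cod C (\<rho> i) = J (E i)" "E i \<in> Obj C"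
    and \<rho>_counit: "jcounit (E i) \<bullet> \<rho> i = Id C (E i)"
    and \<rho>_coassoc: "jcoprod (E i) \<bullet> \<rho> i = Jmap (\<rho> i) \<bullet> \<rho> i" if "i \<in> Obj I" for i
    using PDE_coaction[of "fobj G i"] that by (simp_all add: E_def \<rho>_def)
  define g where "g m = fst (snd (farr G m))" for m
  have Gm: "farr G m = (fobj G (Dom I m), g m, fobj G (Cod I m))" if "m \<in> Arr I" for m
    using functor_Dom[OF G that] functor_Cod[OF G that] by (cases "farr G m") (simp add: g_def)
  have g [simp]: "g m \<in> Arr C" "Dom C (g m) = E (Dom I m)" "Cod C (g m) = E (Cod I m)"
    and g_co: "\<rho> (Cod I m) \<bullet> g m = Jmap (g m) \<bullet> \<rho> (Dom I m)" if "m \<in> Arr I" for m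
    using functor_arr[OF G that] Gm[OF that] by (auto simp: PDE_Arr E_def \<rho>_def)
  have \<pi> [simp]: "l \<in> Obj C" "i \<in> Obj I \<Longrightarrow> \<pi> i \<in> Arr C" "i \<in> Obj I \<Longrightarrow> Dom C (\<pi> i) = l"
    "i \<in> Obj I \<Longrightarrow> Cod C (\<pi> i) = E i" for i
    using is_limitD(1-4)[OF lim] by (simp_all add: E_def)
  have \<pi>_nat: "g m \<bullet> \<pi> (Dom I m) = \<pi> (Cod I m)" if "m \<in> Arr I" for m
    using is_limitD(5)[OF lim that] Gm[OF that] by simp
  have "is_cone I C (ftor_comp (jet_functor B2) (ftor_comp U G)) l (\<lambda>i. \<rho> i \<bullet> \<pi> i)"
  proof (rule is_coneI)
    fix m assume m: "m \<in> Arr I"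
    have "Jmap (g m) \<bullet> (\<rho> (Dom I m) \<bullet> \<pi> (Dom I m)) = \<rho> (Cod I m) \<bullet> (g m \<bullet> \<pi> (Dom I m))"
      by (rule LM.C.Comp_extend) (use m in \<open>simp_all add: g_co\<close>)
    then show "farr (ftor_comp (jet_functor B2) (ftor_comp U G)) m \<bullet> (\<rho> (Dom I m) \<bullet> \<pi> (Dom I m))
        = \<rho> (Cod I m) \<bullet> \<pi> (Cod I m)"
      by (simp add: Gm[OF m] \<pi>_nat[OF m])
  qed (simp_all add: hom_def E_def)
  then obtain r where r [simp]: "r \<in> Arr C" "Dom C r = l" "Cod C r = J l"
    and r_\<pi>: "\<And>i. i \<in> Obj I \<Longrightarrow> Jmap (\<pi> i) \<bullet> r = \<rho> i \<bullet> \<pi> i"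
    by (rule is_limitE[OF Jlim]) blast
  have counit: "jcounit l \<bullet> r = Id C l"
  proof (rule LM.C.is_limit_joint_monic[OF lim I UG])
    fix i assume i: "i \<in> Obj I"
    have "\<pi> i \<bullet> (jcounit l \<bullet> r) = jcounit (E i) \<bullet> (Jmap (\<pi> i) \<bullet> r)"
      by (rule LM.C.Comp_extend) (use i jet_counit_natural[of "\<pi> i"] in simp_all)
    also have "\<dots> = (jcounit (E i) \<bullet> \<rho> i) \<bullet> \<pi> i"
      using i by (simp add: r_\<pi>)
    finally show "\<pi> i \<bullet> (jcounit l \<bullet> r) = \<pi> i \<bullet> Id C l"
      using i by (simp add: \<rho>_counit)
  qed simp_all
  have "jcoprod l \<bullet> r = Jmap r \<bullet> r"
  proof (rule LM.C.is_limit_joint_monic[OF JJlim I JJUG])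
    fix i assume i: "i \<in> Obj I"
    have "Jmap (Jmap (\<pi> i)) \<bullet> (jcoprod l \<bullet> r) = jcoprod (E i) \<bullet> (Jmap (\<pi> i) \<bullet> r)"
      by (rule LM.C.Comp_extend) (use i jet_coproduct_natural[of "\<pi> i"] in simp_all)
    also have "\<dots> = (jcoprod (E i) \<bullet> \<rho> i) \<bullet> \<pi> i"
      using i by (simp add: r_\<pi>)
    also have "\<dots> = Jmap (\<rho> i) \<bullet> (Jmap (\<pi> i) \<bullet> r)"
      using i by (simp add: \<rho>_coassoc r_\<pi>)
    also have "\<dots> = Jmap (\<rho> i \<bullet> \<pi> i) \<bullet> r"
      using i by simp
    also have "\<dots> = Jmap (Jmap (\<pi> i) \<bullet> r) \<bullet> r"
      using i by (simp only: r_\<pi>)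
    also have "\<dots> = Jmap (Jmap (\<pi> i)) \<bullet> (Jmap r \<bullet> r)"
      using i by simp
    finally show "Jmap (Jmap (\<pi> i)) \<bullet> (jcoprod l \<bullet> r) = Jmap (Jmap (\<pi> i)) \<bullet> (Jmap r \<bullet> r)" .
  qed simp_all
  with counit have coalg: "coalgebra l r" by (simp add: coalgebra_def)
  define L where "L = \<lparr>pde_bundle = l, pde_incl = r\<rparr>"
  have L [simp]: "L \<in> Obj PDE" "underlying C L = l" "coaction L = r"
    using coalgebra_pde[OF coalg] by (simp_all add: PDE_Obj L_def)
  have cone: "is_cone I PDE G L (\<lambda>i. (L, \<pi> i, fobj G i))"
  proof (rule is_coneI)
    fix m assume m: "m \<in> Arr I"
    then show "farr G m \<bullet>\<^bsub>PDE\<^esub> (L, \<pi> (Dom I m), fobj G (Dom I m)) =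
        (L, \<pi> (Cod I m), fobj G (Cod I m))"
      by (simp add: Gm \<pi>_nat)
  qed (simp_all add: hom_def PDE_Arr r_\<pi> flip: E_def \<rho>_def)
  have "is_limit I PDE G L (\<lambda>i. (L, \<pi> i, fobj G i))"
    unfolding is_limit_def
  proof (intro conjI allI impI)
    fix Q \<kappa> assume \<kappa>_cone: "is_cone I PDE G Q \<kappa>"
    define k where "k i = fst (snd (\<kappa> i))" for i
    have Q [simp]: "Q \<in> Obj PDE" using \<kappa>_cone by (simp add: is_cone_def)
    note Qco [simp] = PDE_coaction(1-4)[OF Q]
    have \<kappa>_hom: "\<kappa> i \<in> hom PDE Q (fobj G i)" if "i \<in> Obj I" for i
      using \<kappa>_cone that by (simp add: is_cone_def)
    have \<kappa>: "\<kappa> i = (Q, k i, fobj G i)" if "i \<in> Obj I" for i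
      using \<kappa>_hom[OF that] by (cases "\<kappa> i") (simp add: k_def hom_def)
    have k [simp]: "k i \<in> Arr C" "Dom C (k i) = underlying C Q" "Cod C (k i) = E i"
      and k_co: "\<rho> i \<bullet> k i = Jmap (k i) \<bullet> coaction Q" if "i \<in> Obj I" for i
      using \<kappa>_hom[OF that] \<kappa>[OF that] by (auto simp: hom_def PDE_Arr E_def \<rho>_def)
    have "is_cone I C (ftor_comp U G) (underlying C Q) k"
    proof (rule is_coneI)
      fix m assume m: "m \<in> Arr I"
      then have "farr G m \<bullet>\<^bsub>PDE\<^esub> \<kappa> (Dom I m) = \<kappa> (Cod I m)"
        using \<kappa>_cone by (auto simp: is_cone_def hom_def)
      then show "farr (ftor_comp U G) m \<bullet> k (Dom I m) = k (Cod I m)"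
        using m by (simp add: \<kappa> Gm)
    qed (simp_all add: hom_def E_def)
    then obtain u where u [simp]: "u \<in> Arr C" "Dom C u = underlying C Q" "Cod C u = l"
      and \<pi>_u: "\<And>i. i \<in> Obj I \<Longrightarrow> \<pi> i \<bullet> u = k i"
      by (rule is_limitE[OF lim]) blast
    have "r \<bullet> u = Jmap u \<bullet> coaction Q"
    proof (rule LM.C.is_limit_joint_monic[OF Jlim I JUG])
      fix i assume i: "i \<in> Obj I"
      have "Jmap (\<pi> i) \<bullet> (r \<bullet> u) = \<rho> i \<bullet> (\<pi> i \<bullet> u)"
        by (rule LM.C.Comp_extend) (use i in \<open>simp_all add: r_\<pi>\<close>)
      also have "\<dots> = Jmap (\<pi> i \<bullet> u) \<bullet> coaction Q"
        using i by (simp only: \<pi>_u k_co)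
      finally show "Jmap (\<pi> i) \<bullet> (r \<bullet> u) = Jmap (\<pi> i) \<bullet> (Jmap u \<bullet> coaction Q)"
        using i by simp
    qed simp_all
    then have u_arr: "(Q, u, L) \<in> Arr PDE" by (simp add: PDE_Arr)
    show "\<exists>!v. v \<in> hom PDE Q L \<and> (\<forall>i \<in> Obj I. (L, \<pi> i, fobj G i) \<bullet>\<^bsub>PDE\<^esub> v = \<kappa> i)"
    proof (rule ex1I[of _ "(Q, u, L)"], intro conjI ballI)
      fix v assume v: "v \<in> hom PDE Q L \<and> (\<forall>i \<in> Obj I. (L, \<pi> i, fobj G i) \<bullet>\<^bsub>PDE\<^esub> v = \<kappa> i)"
      then obtain w where w: "v = (Q, w, L)" by (cases v) (auto simp: hom_def)
      then have w_arr: "w \<in> Arr C" "Dom C w = underlying C Q" "Cod C w = l"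
        using v by (auto simp: hom_def PDE_Arr)
      have \<pi>_w: "\<pi> i \<bullet> w = k i" if i: "i \<in> Obj I" for i
        using v[THEN conjunct2, rule_format, OF i] by (simp add: w \<kappa>[OF i])
      have "w = u"
        by (rule LM.C.is_limit_joint_monic[OF lim I UG]) (simp_all add: w_arr \<pi>_w \<pi>_u)
      then show "v = (Q, u, L)" by (simp add: w)
    qed (use u_arr \<pi>_u \<kappa> in \<open>simp_all add: hom_def\<close>)
  qed (rule cone)
  then show thesis by (rule that[of r, folded L_def, OF L(2)])
qed

text \<open>
  Any limit of PDEs is a retract of the one with underlying object \<open>l\<close>, by maps commuting with the
  projections, and the underlying functor keeps this.
\<close>

lemma underlying_limit:
  assumes I: "category I" and G: "is_functor I PDE G"
    and lim: "is_limit I C (ftor_comp U G) l \<pi>" and Lim: "is_limit I PDE G L \<tau>"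
  shows "is_limit I C (ftor_comp U G) (fobj U L) (\<lambda>i. farr U (\<tau> i))"
proof -
  interpret I: category I by fact
  interpret PDE: category PDE by (rule PDE_category)
  obtain \<rho> where l: "underlying C \<lparr>pde_bundle = l, pde_incl = \<rho>\<rparr> = l"
    and Lim': "is_limit I PDE G \<lparr>pde_bundle = l, pde_incl = \<rho>\<rparr>
      (\<lambda>i. (\<lparr>pde_bundle = l, pde_incl = \<rho>\<rparr>, \<pi> i, fobj G i))"
    using PDE_limit[OF I G lim] .
  let ?L = "\<lparr>pde_bundle = l, pde_incl = \<rho>\<rparr>"
  have cones: "is_cone I PDE G L \<tau>" "is_cone I PDE G ?L (\<lambda>i. (?L, \<pi> i, fobj G i))"
    using Lim Lim' by (simp_all add: is_limit_def)
  obtain u where u: "u \<in> Arr PDE" "Dom PDE u = L" "Cod PDE u = ?L"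
    "\<And>i. i \<in> Obj I \<Longrightarrow> (?L, \<pi> i, fobj G i) \<bullet>\<^bsub>PDE\<^esub> u = \<tau> i"
    by (rule is_limitE[OF Lim' cones(1)]) blast
  obtain v where v: "v \<in> Arr PDE" "Dom PDE v = ?L" "Cod PDE v = L"
    "\<And>i. i \<in> Obj I \<Longrightarrow> \<tau> i \<bullet>\<^bsub>PDE\<^esub> v = (?L, \<pi> i, fobj G i)"
    by (rule is_limitE[OF Lim cones(2)]) blast
  note [simp] = is_limitD(1-4)[OF Lim]
  have vu: "v \<bullet>\<^bsub>PDE\<^esub> u = Id PDE L"
  proof (rule PDE.is_limit_joint_monic[OF Lim I G])
    fix i assume i: "i \<in> Obj I"
    have "\<tau> i \<bullet>\<^bsub>PDE\<^esub> (v \<bullet>\<^bsub>PDE\<^esub> u) = (\<tau> i \<bullet>\<^bsub>PDE\<^esub> v) \<bullet>\<^bsub>PDE\<^esub> u"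
      using i u(1-3) v(1-3) by (simp del: PDE_simps)
    also have "\<dots> = \<tau> i" by (simp only: u(4)[OF i] v(4)[OF i])
    also have "\<dots> = \<tau> i \<bullet>\<^bsub>PDE\<^esub> Id PDE L"
      using i PDE.Comp_Id(2)[of "\<tau> i" L] by (simp del: PDE_simps)
    finally show "\<tau> i \<bullet>\<^bsub>PDE\<^esub> (v \<bullet>\<^bsub>PDE\<^esub> u) = \<tau> i \<bullet>\<^bsub>PDE\<^esub> Id PDE L" .
  qed (use u v in \<open>simp_all del: PDE_simps\<close>)
  note Ucomp = functor_Comp[OF underlying_is_functor]
  show ?thesis
  proof (rule LM.C.is_limit_retract[OF lim I is_functor_comp[OF G underlying_is_functor]])
    show "farr U u \<in> hom C (fobj U L) l" "farr U v \<in> hom C l (fobj U L)"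
      using functorD(2-4)[OF underlying_is_functor] u(1-3) v(1-3) l by (simp_all add: hom_def)
    show "farr U v \<bullet> farr U u = Id C (fobj U L)"
      using Ucomp[of u v] vu u v by simp
    fix i assume i: "i \<in> Obj I"
    have "farr U ((?L, \<pi> i, fobj G i) \<bullet>\<^bsub>PDE\<^esub> u) = \<pi> i \<bullet> farr U u"
      by (cases u) simp
    then show "\<pi> i \<bullet> farr U u = farr U (\<tau> i)"
      using u(4) i by simp
    have "farr U (\<tau> i \<bullet>\<^bsub>PDE\<^esub> v) = farr U (\<tau> i) \<bullet> farr U v"
      by (rule Ucomp) (use i v in simp_all)
    then show "farr U (\<tau> i) \<bullet> farr U v = \<pi> i"
      using v(4) i by simp
  qed
qed

end

section \<open>Finite limits from pullbacks\<close>

definition has_pullbacks :: "('o, 'a) cat \<Rightarrow> bool" where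
  "has_pullbacks C \<longleftrightarrow> (\<forall>f \<in> Arr C. \<forall>g \<in> Arr C. Cod C f = Cod C g \<longrightarrow> (\<exists>p q. is_pullback C f g p q))"

lemma (in category) is_pullbackD:
  assumes "is_pullback C f g p q"
  shows "p \<in> Arr C" "q \<in> Arr C" "Dom C p = Dom C q" "Cod C p = Dom C f" "Cod C q = Dom C g"
    "f \<bullet> p = g \<bullet> q"
  using assms by (simp_all add: is_pullback_def)

lemma (in category) is_pullback_lift:
  assumes "is_pullback C f g p q" "h \<in> Arr C" "k \<in> Arr C" "Dom C h = Dom C k"
    "Cod C h = Dom C f" "Cod C k = Dom C g" "f \<bullet> h = g \<bullet> k"
  obtains u where "u \<in> Arr C" "Dom C u = Dom C k" "Cod C u = Dom C q" "p \<bullet> u = h" "q \<bullet> u = k"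
proof -
  have "h \<in> hom C (Dom C k) (Dom C f)" "k \<in> hom C (Dom C k) (Dom C g)"
    using assms by (simp_all add: hom_def)
  then have "\<exists>!u. u \<in> hom C (Dom C k) (Dom C p) \<and> p \<bullet> u = h \<and> q \<bullet> u = k"
    using assms(1,7) unfolding is_pullback_def by blast
  then show thesis using that is_pullbackD(3)[OF assms(1)] by (auto simp: hom_def)
qed

lemma (in category) is_pullback_unique:
  assumes pb: "is_pullback C f g p q" and u: "u \<in> Arr C" "Cod C u = Dom C q"
    and v: "v \<in> Arr C" "Cod C v = Dom C q" and uv: "Dom C u = Dom C v"
    and eq: "p \<bullet> u = p \<bullet> v" "q \<bullet> u = q \<bullet> v"
  shows "u = v"
proof -
  note [simp] = is_pullbackD(1-5)[OF pb]
  have fg: "f \<in> Arr C" "g \<in> Arr C" "Cod C f = Cod C g" using pb by (simp_all add: is_pullback_def)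
  have "p \<bullet> u \<in> hom C (Dom C u) (Dom C f)" "q \<bullet> u \<in> hom C (Dom C u) (Dom C g)"
    using u by (simp_all add: hom_def)
  moreover have "f \<bullet> (p \<bullet> u) = g \<bullet> (q \<bullet> u)"
    by (rule Comp_extend) (use u fg is_pullbackD(6)[OF pb] in simp_all)
  ultimately have "\<exists>!w. w \<in> hom C (Dom C u) (Dom C p) \<and> p \<bullet> w = p \<bullet> u \<and> q \<bullet> w = q \<bullet> u"
    using pb unfolding is_pullback_def by blast
  moreover have "u \<in> hom C (Dom C u) (Dom C p)" "v \<in> hom C (Dom C u) (Dom C p)"
    using u v uv by (simp_all add: hom_def)
  ultimately show ?thesis using eq by metis
qed

context category
begin

lemma terminal_arr:
  assumes "terminal C t" "x \<in> Obj C"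
  obtains b where "b \<in> Arr C" "Dom C b = x" "Cod C b = t"
  using assms unfolding terminal_def hom_def by blast

lemma terminal_unique:
  assumes "terminal C t" "f \<in> Arr C" "g \<in> Arr C" "Dom C f = Dom C g" "Cod C f = t" "Cod C g = t"
  shows "f = g"
proof -
  have "\<exists>!h. h \<in> hom C (Dom C f) t" using assms by (simp add: terminal_def)
  moreover have "f \<in> hom C (Dom C f) t" "g \<in> hom C (Dom C f) t"
    using assms by (simp_all add: hom_def)
  ultimately show ?thesis by blast
qed

lemma product_exists:
  assumes t: "terminal C t" and pbs: "has_pullbacks C" and x: "x \<in> Obj C" and y: "y \<in> Obj C"
  obtains p q where "p \<in> Arr C" "q \<in> Arr C" "Dom C p = Dom C q" "Cod C p = x" "Cod C q = y"
    and "\<And>h k. \<lbrakk>h \<in> Arr C; k \<in> Arr C; Dom C h = Dom C k; Cod C h = x; Cod C k = y\<rbrakk> \<Longrightarrow>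
      \<exists>u \<in> hom C (Dom C h) (Dom C p). p \<bullet> u = h \<and> q \<bullet> u = k"
    and "\<And>u v. \<lbrakk>u \<in> Arr C; v \<in> Arr C; Dom C u = Dom C v; Cod C u = Dom C p; Cod C v = Dom C p;
      p \<bullet> u = p \<bullet> v; q \<bullet> u = q \<bullet> v\<rbrakk> \<Longrightarrow> u = v"
proof -
  obtain b where b: "b \<in> Arr C" "Dom C b = x" "Cod C b = t" by (rule terminal_arr[OF t x])
  obtain c where c: "c \<in> Arr C" "Dom C c = y" "Cod C c = t" by (rule terminal_arr[OF t y])
  obtain p q where pb: "is_pullback C b c p q"
    using pbs b c unfolding has_pullbacks_def by metis
  note pq = is_pullbackD[OF pb]
  show thesis
  proof (rule that[of p q])
    fix h k
    assume hk: "h \<in> Arr C" "k \<in> Arr C" "Dom C h = Dom C k" "Cod C h = x" "Cod C k = y"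
    have "b \<bullet> h = c \<bullet> k"
      by (rule terminal_unique[OF t]) (use hk b c in simp_all)
    then obtain u where "u \<in> Arr C" "Dom C u = Dom C k" "Cod C u = Dom C q" "p \<bullet> u = h" "q \<bullet> u = k"
      by (rule is_pullback_lift[OF pb hk(1-3), rotated 2]) (simp_all add: hk b c)
    then show "\<exists>u \<in> hom C (Dom C h) (Dom C p). p \<bullet> u = h \<and> q \<bullet> u = k"
      by (intro bexI[of _ u]) (simp_all add: hom_def hk pq)
  next
    fix u v
    assume "u \<in> Arr C" "v \<in> Arr C" "Dom C u = Dom C v" "Cod C u = Dom C p" "Cod C v = Dom C p"
      "p \<bullet> u = p \<bullet> v" "q \<bullet> u = q \<bullet> v"
    then show "u = v" using is_pullback_unique[OF pb, of u v] pq by simp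
  qed (use pq b c in simp_all)
qed

text \<open>The equalizer of \<open>f\<close> and \<open>g\<close> is the pullback of their graphs.\<close>

lemma equalizer_exists:
  assumes t: "terminal C t" and pbs: "has_pullbacks C"
    and fg: "f \<in> Arr C" "g \<in> Arr C" "Dom C f = Dom C g" "Cod C f = Cod C g"
  obtains e where "e \<in> Arr C" "Cod C e = Dom C f" "f \<bullet> e = g \<bullet> e" "monic C e"
    and "\<And>h. \<lbrakk>h \<in> Arr C; Cod C h = Dom C f; f \<bullet> h = g \<bullet> h\<rbrakk> \<Longrightarrow>
      \<exists>u \<in> hom C (Dom C h) (Dom C e). e \<bullet> u = h"
proof -
  have x: "Dom C f \<in> Obj C" and y: "Cod C f \<in> Obj C" using fg by auto
  obtain p q where pq [simp]: "p \<in> Arr C" "q \<in> Arr C" "Dom C p = Dom C q" "Cod C p = Dom C f"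
      "Cod C q = Cod C f"
    and ex: "\<And>h k. \<lbrakk>h \<in> Arr C; k \<in> Arr C; Dom C h = Dom C k; Cod C h = Dom C f; Cod C k = Cod C f\<rbrakk>
      \<Longrightarrow> \<exists>u \<in> hom C (Dom C h) (Dom C p). p \<bullet> u = h \<and> q \<bullet> u = k"
    and uniq: "\<And>u v. \<lbrakk>u \<in> Arr C; v \<in> Arr C; Dom C u = Dom C v; Cod C u = Dom C p; Cod C v = Dom C p;
      p \<bullet> u = p \<bullet> v; q \<bullet> u = q \<bullet> v\<rbrakk> \<Longrightarrow> u = v"
    by (rule product_exists[OF t pbs x y]) blast
  have graph: "\<exists>k. k \<in> Arr C \<and> Dom C k = Dom C f \<and> Cod C k = Dom C q \<and> p \<bullet> k = Id C (Dom C f) \<and> q \<bullet> k = h"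
    if "h \<in> Arr C" "Dom C h = Dom C f" "Cod C h = Cod C f" for h
    using ex[of "Id C (Dom C f)" h] that x by (auto simp: hom_def)
  obtain k where k [simp]: "k \<in> Arr C" "Dom C k = Dom C f" "Cod C k = Dom C q"
    and pk: "p \<bullet> k = Id C (Dom C f)" and qk: "q \<bullet> k = f"
    using graph[of f] fg by auto
  obtain l where l [simp]: "l \<in> Arr C" "Dom C l = Dom C f" "Cod C l = Dom C q"
    and pl: "p \<bullet> l = Id C (Dom C f)" and ql: "q \<bullet> l = g"
    using graph[of g] fg by auto
  obtain d e where pb: "is_pullback C k l d e"
    using pbs k l unfolding has_pullbacks_def by metis
  note de [simp] = is_pullbackD(1-5)[OF pb]
  have "d = (p \<bullet> k) \<bullet> d" unfolding pk by simp
  also have "\<dots> = p \<bullet> (l \<bullet> e)" using is_pullbackD(6)[OF pb] by simp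
  also have "\<dots> = (p \<bullet> l) \<bullet> e" by simp
  also have "\<dots> = e" unfolding pl by simp
  finally have de_eq: "d = e" .
  have "f \<bullet> e = q \<bullet> (k \<bullet> d)" unfolding qk[symmetric] using de_eq by simp
  also have "\<dots> = q \<bullet> (l \<bullet> e)" using is_pullbackD(6)[OF pb] by simp
  also have "\<dots> = g \<bullet> e" unfolding ql[symmetric] by simp
  finally have fe: "f \<bullet> e = g \<bullet> e" .
  show thesis
  proof (rule that[of e])
    show "monic C e"
      unfolding monic_def hom_def using is_pullback_unique[OF pb] de_eq by auto
    fix h assume h: "h \<in> Arr C" "Cod C h = Dom C f" and eq: "f \<bullet> h = g \<bullet> h"
    have "k \<bullet> h = l \<bullet> h"
    proof (rule uniq)
      have "p \<bullet> (k \<bullet> h) = (p \<bullet> k) \<bullet> h" using h by simp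
      also have "\<dots> = (p \<bullet> l) \<bullet> h" by (simp only: pk pl)
      finally show "p \<bullet> (k \<bullet> h) = p \<bullet> (l \<bullet> h)" using h by simp
      have "q \<bullet> (k \<bullet> h) = (q \<bullet> k) \<bullet> h" using h by simp
      also have "\<dots> = (q \<bullet> l) \<bullet> h" by (simp only: qk ql eq)
      finally show "q \<bullet> (k \<bullet> h) = q \<bullet> (l \<bullet> h)" using h by simp
    qed (use h in simp_all)
    then obtain u where "u \<in> Arr C" "Dom C u = Dom C h" "Cod C u = Dom C e" "e \<bullet> u = h"
      using is_pullback_lift[OF pb h(1) h(1)] h by auto
    then show "\<exists>u \<in> hom C (Dom C h) (Dom C e). e \<bullet> u = h" by (auto simp: hom_def)
  qed (use fe in simp_all)
qed

text \<open>
  Cones over the objects in \<open>S\<close> that are compatible with the arrows in \<open>F\<close> only. A limit is a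
  universal such cone for \<open>S\<close> and \<open>F\<close> the sets of all objects and arrows, and the two sets can be
  enlarged one element at a time: by a product and by an equalizer.
\<close>

definition partial_cone ::
    "('j, 'k) cat \<Rightarrow> 'j set \<Rightarrow> 'k set \<Rightarrow> ('j, 'k, 'o, 'a) ftor \<Rightarrow> 'o \<Rightarrow> ('j \<Rightarrow> 'a) \<Rightarrow> bool" where
  "partial_cone I S F G x \<kappa> \<longleftrightarrow> x \<in> Obj C \<and> (\<forall>i \<in> S. \<kappa> i \<in> hom C x (fobj G i)) \<and>
    (\<forall>m \<in> F. farr G m \<bullet> \<kappa> (Dom I m) = \<kappa> (Cod I m))"

definition partial_limit ::
    "('j, 'k) cat \<Rightarrow> 'j set \<Rightarrow> 'k set \<Rightarrow> ('j, 'k, 'o, 'a) ftor \<Rightarrow> 'o \<Rightarrow> ('j \<Rightarrow> 'a) \<Rightarrow> bool" where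
  "partial_limit I S F G l \<pi> \<longleftrightarrow> partial_cone I S F G l \<pi> \<and>
    (\<forall>x \<kappa>. partial_cone I S F G x \<kappa> \<longrightarrow> (\<exists>u \<in> hom C x l. \<forall>i \<in> S. \<pi> i \<bullet> u = \<kappa> i)) \<and>
    (\<forall>x. \<forall>u \<in> hom C x l. \<forall>v \<in> hom C x l. (\<forall>i \<in> S. \<pi> i \<bullet> u = \<pi> i \<bullet> v) \<longrightarrow> u = v)"

lemma finite_product_exists:
  assumes t: "terminal C t" and pbs: "has_pullbacks C" and "finite S"
    and G: "\<And>i. i \<in> S \<Longrightarrow> fobj G i \<in> Obj C"
  shows "\<exists>l \<pi>. partial_limit I S {} G l \<pi>"
  using assms(3,4)
proof (induction S)
  case empty
  have "t \<in> Obj C" "\<exists>u. u \<in> hom C x t" if "x \<in> Obj C" for x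
    using t that unfolding terminal_def by blast+
  moreover have "u = v" if "u \<in> hom C x t" "v \<in> hom C x t" for u v x
    using terminal_unique[OF t, of u v] that by (simp add: hom_def)
  ultimately have "partial_limit I {} {} G t (\<lambda>_. undefined)"
    using t unfolding partial_limit_def partial_cone_def terminal_def by blast
  then show ?case by blast
next
  case (insert j S)
  then obtain l \<pi> where "partial_limit I S {} G l \<pi>" by auto
  then have l: "l \<in> Obj C"
    and \<pi>: "\<And>i. i \<in> S \<Longrightarrow> \<pi> i \<in> Arr C" "\<And>i. i \<in> S \<Longrightarrow> Dom C (\<pi> i) = l"
      "\<And>i. i \<in> S \<Longrightarrow> Cod C (\<pi> i) = fobj G i"
    and fac: "\<And>x \<kappa>. \<lbrakk>x \<in> Obj C; \<forall>i \<in> S. \<kappa> i \<in> hom C x (fobj G i)\<rbrakk> \<Longrightarrow>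
      \<exists>u \<in> hom C x l. \<forall>i \<in> S. \<pi> i \<bullet> u = \<kappa> i"
    and \<pi>_uniq: "\<And>x u v. \<lbrakk>u \<in> hom C x l; v \<in> hom C x l; \<forall>i \<in> S. \<pi> i \<bullet> u = \<pi> i \<bullet> v\<rbrakk> \<Longrightarrow> u = v"
    by (auto simp: partial_limit_def partial_cone_def hom_def)
  have Gj: "fobj G j \<in> Obj C" using insert.prems by simp
  obtain p q where pq [simp]: "p \<in> Arr C" "q \<in> Arr C" "Dom C p = Dom C q" "Cod C p = l"
      "Cod C q = fobj G j"
    and ex: "\<And>h k. \<lbrakk>h \<in> Arr C; k \<in> Arr C; Dom C h = Dom C k; Cod C h = l; Cod C k = fobj G j\<rbrakk>
      \<Longrightarrow> \<exists>u \<in> hom C (Dom C h) (Dom C p). p \<bullet> u = h \<and> q \<bullet> u = k"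
    and uniq: "\<And>u v. \<lbrakk>u \<in> Arr C; v \<in> Arr C; Dom C u = Dom C v; Cod C u = Dom C p; Cod C v = Dom C p;
      p \<bullet> u = p \<bullet> v; q \<bullet> u = q \<bullet> v\<rbrakk> \<Longrightarrow> u = v"
    by (rule product_exists[OF t pbs l Gj]) blast
  define \<tau> where "\<tau> i = (if i = j then q else \<pi> i \<bullet> p)" for i
  have \<tau>_S: "\<tau> i = \<pi> i \<bullet> p" if "i \<in> S" for i
    using that insert.hyps by (auto simp: \<tau>_def)
  have \<tau>_j: "\<tau> j = q" by (simp add: \<tau>_def)
  have "partial_limit I (insert j S) {} G (Dom C q) \<tau>"
    unfolding partial_limit_def
  proof (intro conjI allI impI ballI)
    show "partial_cone I (insert j S) {} G (Dom C q) \<tau>"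
      using \<pi> by (auto simp: partial_cone_def hom_def \<tau>_S \<tau>_j)
  next
    fix x \<kappa> assume "partial_cone I (insert j S) {} G x \<kappa>"
    then have x: "x \<in> Obj C" and \<kappa>: "\<forall>i \<in> S. \<kappa> i \<in> hom C x (fobj G i)"
      and \<kappa>j: "\<kappa> j \<in> Arr C" "Dom C (\<kappa> j) = x" "Cod C (\<kappa> j) = fobj G j"
      by (auto simp: partial_cone_def hom_def)
    obtain u where u: "u \<in> Arr C" "Dom C u = x" "Cod C u = l" and \<pi>u: "\<forall>i \<in> S. \<pi> i \<bullet> u = \<kappa> i"
      using fac[OF x \<kappa>] by (auto simp: hom_def)
    obtain v where v: "v \<in> Arr C" "Dom C v = x" "Cod C v = Dom C q" and pv: "p \<bullet> v = u" "q \<bullet> v = \<kappa> j"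
      using ex[of u "\<kappa> j"] u \<kappa>j by (auto simp: hom_def)
    have "\<tau> i \<bullet> v = \<kappa> i" if "i \<in> insert j S" for i
    proof (cases "i = j")
      case False
      with that have "i \<in> S" by simp
      then show ?thesis using \<pi> \<pi>u v pv by (simp add: \<tau>_S)
    qed (simp add: \<tau>_j pv)
    then show "\<exists>v \<in> hom C x (Dom C q). \<forall>i \<in> insert j S. \<tau> i \<bullet> v = \<kappa> i"
      using v by (intro bexI[of _ v]) (auto simp: hom_def)
  next
    fix x u v
    assume uv: "u \<in> hom C x (Dom C q)" "v \<in> hom C x (Dom C q)"
      and eq: "\<forall>i \<in> insert j S. \<tau> i \<bullet> u = \<tau> i \<bullet> v"
    from uv have uv' [simp]: "u \<in> Arr C" "v \<in> Arr C" "Dom C u = x" "Dom C v = x"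
      "Cod C u = Dom C q" "Cod C v = Dom C q"
      by (auto simp: hom_def)
    have "\<forall>i \<in> S. \<pi> i \<bullet> (p \<bullet> u) = \<pi> i \<bullet> (p \<bullet> v)"
    proof
      fix i assume i: "i \<in> S"
      have "\<pi> i \<bullet> (p \<bullet> w) = \<tau> i \<bullet> w" if "w \<in> Arr C" "Cod C w = Dom C q" for w
        using \<pi> i that by (simp add: \<tau>_S)
      then show "\<pi> i \<bullet> (p \<bullet> u) = \<pi> i \<bullet> (p \<bullet> v)" using eq i by simp
    qed
    then have "p \<bullet> u = p \<bullet> v"
      by (rule \<pi>_uniq[of _ x, rotated 2]) (simp_all add: hom_def)
    moreover have "q \<bullet> u = q \<bullet> v" using eq by (simp add: \<tau>_j)
    ultimately show "u = v" by (rule uniq[rotated 5]) simp_all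
  qed
  then show ?case by blast
qed

lemma partial_limit_exists:
  assumes t: "terminal C t" and pbs: "has_pullbacks C"
    and I: "finite_category I" and G: "is_functor I C G" and "finite F" "F \<subseteq> Arr I"
  shows "\<exists>l \<pi>. partial_limit I (Obj I) F G l \<pi>"
  using assms(5,6)
proof (induction F)
  case empty
  show ?case
    by (rule finite_product_exists[OF t pbs]) (use I functor_obj[OF G] in \<open>auto simp: finite_category_def\<close>)
next
  case (insert m F)
  interpret I: category I using I by (simp add: finite_category_def)
  note [simp] = functorD[OF G]
  from insert obtain l \<pi> where "partial_limit I (Obj I) F G l \<pi>" by auto
  then have l [simp]: "l \<in> Obj C"
    and \<pi> [simp]: "\<And>i. i \<in> Obj I \<Longrightarrow> \<pi> i \<in> Arr C" "\<And>i. i \<in> Obj I \<Longrightarrow> Dom C (\<pi> i) = l"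
      "\<And>i. i \<in> Obj I \<Longrightarrow> Cod C (\<pi> i) = fobj G i"
    and \<pi>F: "\<And>n. n \<in> F \<Longrightarrow> farr G n \<bullet> \<pi> (Dom I n) = \<pi> (Cod I n)"
    and fac: "\<And>x \<kappa>. partial_cone I (Obj I) F G x \<kappa> \<Longrightarrow>
      \<exists>u \<in> hom C x l. \<forall>i \<in> Obj I. \<pi> i \<bullet> u = \<kappa> i"
    and \<pi>_uniq: "\<And>x u v. \<lbrakk>u \<in> hom C x l; v \<in> hom C x l; \<forall>i \<in> Obj I. \<pi> i \<bullet> u = \<pi> i \<bullet> v\<rbrakk> \<Longrightarrow> u = v"
    by (auto simp: partial_limit_def partial_cone_def hom_def)
  have m [simp]: "m \<in> Arr I" and F: "\<And>n. n \<in> F \<Longrightarrow> n \<in> Arr I" using insert.prems by auto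
  obtain e where e [simp]: "e \<in> Arr C" "Cod C e = l"
    and eq: "(farr G m \<bullet> \<pi> (Dom I m)) \<bullet> e = \<pi> (Cod I m) \<bullet> e" and mono: "monic C e"
    and ex: "\<And>h. \<lbrakk>h \<in> Arr C; Cod C h = l; (farr G m \<bullet> \<pi> (Dom I m)) \<bullet> h = \<pi> (Cod I m) \<bullet> h\<rbrakk> \<Longrightarrow>
      \<exists>u \<in> hom C (Dom C h) (Dom C e). e \<bullet> u = h"
    by (rule equalizer_exists[OF t pbs, of "farr G m \<bullet> \<pi> (Dom I m)" "\<pi> (Cod I m)"])
      (simp_all del: Comp_assoc')
  have "partial_limit I (Obj I) (insert m F) G (Dom C e) (\<lambda>i. \<pi> i \<bullet> e)"
    unfolding partial_limit_def
  proof (intro conjI allI impI ballI)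
    have "farr G n \<bullet> (\<pi> (Dom I n) \<bullet> e) = \<pi> (Cod I n) \<bullet> e" if "n \<in> F" for n
    proof -
      have "farr G n \<bullet> (\<pi> (Dom I n) \<bullet> e) = (farr G n \<bullet> \<pi> (Dom I n)) \<bullet> e"
        using F[OF that] by simp
      then show ?thesis using that by (simp only: \<pi>F)
    qed
    then show "partial_cone I (Obj I) (insert m F) G (Dom C e) (\<lambda>i. \<pi> i \<bullet> e)"
      using eq by (auto simp: partial_cone_def hom_def)
  next
    fix x \<kappa> assume \<kappa>_cone: "partial_cone I (Obj I) (insert m F) G x \<kappa>"
    then have "partial_cone I (Obj I) F G x \<kappa>" by (simp add: partial_cone_def)
    from fac[OF this] obtain u where u: "u \<in> Arr C" "Dom C u = x" "Cod C u = l"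
      and \<pi>u: "\<And>i. i \<in> Obj I \<Longrightarrow> \<pi> i \<bullet> u = \<kappa> i"
      by (auto simp: hom_def)
    have "(farr G m \<bullet> \<pi> (Dom I m)) \<bullet> u = \<pi> (Cod I m) \<bullet> u"
      using \<kappa>_cone u by (simp add: \<pi>u partial_cone_def)
    then obtain v where v: "v \<in> Arr C" "Dom C v = x" "Cod C v = Dom C e" and ev: "e \<bullet> v = u"
      using ex[of u] u by (auto simp: hom_def)
    then show "\<exists>v \<in> hom C x (Dom C e). \<forall>i \<in> Obj I. (\<pi> i \<bullet> e) \<bullet> v = \<kappa> i"
      using \<pi>u by (intro bexI[of _ v]) (auto simp: hom_def)
  next
    fix x u v
    assume uv: "u \<in> hom C x (Dom C e)" "v \<in> hom C x (Dom C e)"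
      and eq: "\<forall>i \<in> Obj I. (\<pi> i \<bullet> e) \<bullet> u = (\<pi> i \<bullet> e) \<bullet> v"
    from uv have uv' [simp]: "u \<in> Arr C" "v \<in> Arr C" "Dom C u = x" "Dom C v = x"
      "Cod C u = Dom C e" "Cod C v = Dom C e"
      by (auto simp: hom_def)
    have "e \<bullet> u = e \<bullet> v"
      by (rule \<pi>_uniq[of _ x]) (use eq in \<open>simp_all add: hom_def\<close>)
    then show "u = v" by (rule monicD[OF mono]) simp_all
  qed
  then show ?case by blast
qed

theorem finite_limit_exists:
  assumes "terminal C t" "has_pullbacks C" "finite_category I" "is_functor I C G"
  shows "\<exists>l \<pi>. is_limit I C G l \<pi>"
proof -
  have "finite (Arr I)" using assms(3) by (simp add: finite_category_def)
  then obtain l \<pi> where lim: "partial_limit I (Obj I) (Arr I) G l \<pi>"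
    using partial_limit_exists[OF assms] by blast
  have cone_iff: "partial_cone I (Obj I) (Arr I) G x \<kappa> \<longleftrightarrow> is_cone I C G x \<kappa>" for x \<kappa>
    by (auto simp: partial_cone_def is_cone_def hom_def)
  have "is_limit I C G l \<pi>"
    unfolding is_limit_def
  proof (intro conjI allI impI)
    show "is_cone I C G l \<pi>" using lim cone_iff by (simp add: partial_limit_def)
    fix x \<kappa> assume "is_cone I C G x \<kappa>"
    then obtain u where u: "u \<in> hom C x l" "\<forall>i \<in> Obj I. \<pi> i \<bullet> u = \<kappa> i"
      using lim unfolding partial_limit_def cone_iff by blast
    show "\<exists>!u. u \<in> hom C x l \<and> (\<forall>i \<in> Obj I. \<pi> i \<bullet> u = \<kappa> i)"
    proof (rule ex1I[of _ u])
      fix v assume v: "v \<in> hom C x l \<and> (\<forall>i \<in> Obj I. \<pi> i \<bullet> v = \<kappa> i)"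
      then have "\<forall>i \<in> Obj I. \<pi> i \<bullet> v = \<pi> i \<bullet> u" using u by simp
      then show "v = u" using v u(1) lim unfolding partial_limit_def by blast
    qed (use u in simp)
  qed
  then show ?thesis by blast
qed

end

section \<open>Slices\<close>

lemma slice_simps [simp]:
  "Dom (slice C s) (f, h, g) = f" "Cod (slice C s) (f, h, g) = g"
  "Id (slice C s) f = (f, Id C (Dom C f), f)"
  "(f', h', g') \<bullet>\<^bsub>slice C s\<^esub> (f, h, g) = (f, h' \<bullet>\<^bsub>C\<^esub> h, g')"
  by (simp_all add: slice_def)

lemma slice_Obj: "f \<in> Obj (slice C s) \<longleftrightarrow> f \<in> Arr C \<and> Cod C f = s"
  by (simp add: slice_def)

lemma slice_Arr:
  "(f, h, g) \<in> Arr (slice C s) \<longleftrightarrow> f \<in> Arr C \<and> Cod C f = s \<and> g \<in> Arr C \<and> Cod C g = s \<and>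
    h \<in> Arr C \<and> Dom C h = Dom C f \<and> Cod C h = Dom C g \<and> g \<bullet>\<^bsub>C\<^esub> h = f"
  by (auto simp: slice_def hom_def)

context category
begin

lemma slice_category: "category (slice C s)"
proof
  fix a b c f g h k
  show "a \<in> Arr (slice C s) \<Longrightarrow> Dom (slice C s) a \<in> Obj (slice C s)"
    "a \<in> Arr (slice C s) \<Longrightarrow> Cod (slice C s) a \<in> Obj (slice C s)"
    by (cases a; simp add: slice_Arr slice_Obj)+
  show "f \<in> Obj (slice C s) \<Longrightarrow> Id (slice C s) f \<in> hom (slice C s) f f"
    by (simp add: hom_def slice_Arr slice_Obj)
  show "b \<bullet>\<^bsub>slice C s\<^esub> a \<in> hom (slice C s) f h"
    if ab: "a \<in> hom (slice C s) f g" "b \<in> hom (slice C s) g h"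
  proof -
    obtain u v where uv: "a = (f, u, g)" "b = (g, v, h)"
      using ab by (cases a; cases b) (auto simp: hom_def)
    have u: "u \<in> Arr C" "Dom C u = Dom C f" "Cod C u = Dom C g" "g \<bullet> u = f"
      and v: "v \<in> Arr C" "Dom C v = Dom C g" "Cod C v = Dom C h" "h \<bullet> v = g"
      and fh: "f \<in> Arr C" "Cod C f = s" "h \<in> Arr C" "Cod C h = s"
      using ab unfolding uv by (simp_all add: hom_def slice_Arr)
    have "h \<bullet> (v \<bullet> u) = (h \<bullet> v) \<bullet> u" using u(1-3) v(1-3) fh by simp
    also have "\<dots> = f" by (simp only: u(4) v(4))
    finally show ?thesis
      using u(1-3) v(1-3) fh by (simp add: uv hom_def slice_Arr)
  qed
  show "a \<in> hom (slice C s) f g \<Longrightarrow> Id (slice C s) g \<bullet>\<^bsub>slice C s\<^esub> a = a"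
    "a \<in> hom (slice C s) f g \<Longrightarrow> a \<bullet>\<^bsub>slice C s\<^esub> Id (slice C s) f = a"
    by (cases a; auto simp: hom_def slice_Arr)+
  show "\<lbrakk>a \<in> hom (slice C s) f g; b \<in> hom (slice C s) g h; c \<in> hom (slice C s) h k\<rbrakk>
      \<Longrightarrow> (c \<bullet>\<^bsub>slice C s\<^esub> b) \<bullet>\<^bsub>slice C s\<^esub> a = c \<bullet>\<^bsub>slice C s\<^esub> (b \<bullet>\<^bsub>slice C s\<^esub> a)"
    by (cases a; cases b; cases c) (auto simp: hom_def slice_Arr)
qed

lemma slice_terminal:
  assumes s: "s \<in> Obj C"
  shows "terminal (slice C s) (Id C s)"
  unfolding terminal_def
proof (intro conjI ballI)
  show "Id C s \<in> Obj (slice C s)" using s by (simp add: slice_Obj)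
  fix f assume f: "f \<in> Obj (slice C s)"
  show "\<exists>!a. a \<in> hom (slice C s) f (Id C s)"
  proof (rule ex1I[of _ "(f, f, Id C s)"])
    show "(f, f, Id C s) \<in> hom (slice C s) f (Id C s)"
      using s f by (simp add: hom_def slice_Arr slice_Obj)
    fix a assume "a \<in> hom (slice C s) f (Id C s)"
    then show "a = (f, f, Id C s)"
      using s by (cases a) (auto simp: hom_def slice_Arr)
  qed
qed

text \<open>
  A pullback of the underlying arrows has the composites to \<open>s\<close> through its two projections equal, so
  that it lies over \<open>s\<close> in one way.
\<close>

lemma slice_has_pullbacks:
  assumes "has_pullbacks C"
  shows "has_pullbacks (slice C s)"
  unfolding has_pullbacks_def
proof (intro ballI impI)
  let ?S = "slice C s"
  fix f g assume f: "f \<in> Arr ?S" and g: "g \<in> Arr ?S" and fg: "Cod ?S f = Cod ?S g"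
  obtain a h c where f_eq: "f = (a, h, c)" by (cases f)
  obtain b k where g_eq: "g = (b, k, c)" using fg by (cases g) (auto simp: f_eq)
  have [simp]: "a \<in> Arr C" "Cod C a = s" "c \<in> Arr C" "Cod C c = s" "h \<in> Arr C" "Dom C h = Dom C a"
    "Cod C h = Dom C c" "b \<in> Arr C" "Cod C b = s" "k \<in> Arr C" "Dom C k = Dom C b"
    "Cod C k = Dom C c"
    and ch: "c \<bullet> h = a" and ck: "c \<bullet> k = b"
    using f g by (auto simp: f_eq g_eq slice_Arr)
  obtain p q where pb: "is_pullback C h k p q"
    using assms unfolding has_pullbacks_def by fastforce
  note pq [simp] = is_pullbackD(1-5)[OF pb]
  have "a \<bullet> p = c \<bullet> (h \<bullet> p)" unfolding ch[symmetric] by simp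
  also have "\<dots> = c \<bullet> (k \<bullet> q)" by (simp add: is_pullbackD(6)[OF pb])
  also have "\<dots> = b \<bullet> q" unfolding ck[symmetric] by simp
  finally have apbq: "a \<bullet> p = b \<bullet> q" .
  have "is_pullback ?S f g (a \<bullet> p, p, a) (a \<bullet> p, q, b)"
    unfolding is_pullback_def
  proof (intro conjI allI ballI impI)
    show "f \<bullet>\<^bsub>?S\<^esub> (a \<bullet> p, p, a) = g \<bullet>\<^bsub>?S\<^esub> (a \<bullet> p, q, b)"
      by (simp add: f_eq g_eq is_pullbackD(6)[OF pb])
    fix z h' k'
    assume h': "h' \<in> hom ?S z (Dom ?S f)" and k': "k' \<in> hom ?S z (Dom ?S g)"
      and eq: "f \<bullet>\<^bsub>?S\<^esub> h' = g \<bullet>\<^bsub>?S\<^esub> k'"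
    obtain x y where xy: "h' = (z, x, a)" "k' = (z, y, b)"
      using h' k' by (cases h'; cases k') (auto simp: hom_def f_eq g_eq)
    have [simp]: "z \<in> Arr C" "Cod C z = s" "x \<in> Arr C" "Dom C x = Dom C z" "Cod C x = Dom C a"
      "y \<in> Arr C" "Dom C y = Dom C z" "Cod C y = Dom C b"
      and ax: "a \<bullet> x = z" and hxky: "h \<bullet> x = k \<bullet> y"
      using h' k' eq by (auto simp: xy hom_def slice_Arr f_eq g_eq)
    obtain u where u [simp]: "u \<in> Arr C" "Dom C u = Dom C z" "Cod C u = Dom C q"
      and pu: "p \<bullet> u = x" "q \<bullet> u = y"
      by (rule is_pullback_lift[OF pb, of x y]) (simp_all add: hxky)
    show "\<exists>!w. w \<in> hom ?S z (Dom ?S (a \<bullet> p, p, a)) \<and>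
      (a \<bullet> p, p, a) \<bullet>\<^bsub>?S\<^esub> w = h' \<and> (a \<bullet> p, q, b) \<bullet>\<^bsub>?S\<^esub> w = k'"
    proof (rule ex1I[of _ "(z, u, a \<bullet> p)"], intro conjI)
      show "(z, u, a \<bullet> p) \<in> hom ?S z (Dom ?S (a \<bullet> p, p, a))"
        by (simp add: hom_def slice_Arr pu ax)
      fix w
      assume w: "w \<in> hom ?S z (Dom ?S (a \<bullet> p, p, a)) \<and>
        (a \<bullet> p, p, a) \<bullet>\<^bsub>?S\<^esub> w = h' \<and> (a \<bullet> p, q, b) \<bullet>\<^bsub>?S\<^esub> w = k'"
      then obtain v where v: "w = (z, v, a \<bullet> p)" by (cases w) (auto simp: hom_def)
      have "v = u"
        by (rule is_pullback_unique[OF pb]) (use w pu in \<open>auto simp: v xy hom_def slice_Arr\<close>)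
      then show "w = (z, u, a \<bullet> p)" by (simp add: v)
    qed (simp_all add: xy pu)
  qed (use f g apbq in \<open>simp_all add: f_eq g_eq slice_Arr\<close>)
  then show "\<exists>p q. is_pullback ?S f g p q" by blast
qed

end

section \<open>Pullbacks in a Grothendieck topos\<close>

text \<open>
  The pullback of \<open>F f\<close> and \<open>F g\<close> in \<open>S\<close> is carried back by \<open>G\<close> and the inverse of \<open>\<alpha>\<close>. Cones over \<open>f, g\<close>
  are factored by going to \<open>S\<close> and back. Two factorisations \<open>v, w\<close> of the same cone have
  \<open>\<beta> \<circ> F v = \<beta> \<circ> F w\<close> by uniqueness in \<open>S\<close>; as \<open>\<beta>\<close> is invertible and \<open>F\<close> is faithful (by \<open>\<alpha>\<close>), they
  are equal.
\<close>

lemma has_pullbacks_equivalent: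
  assumes H: "category H" and S: "category S" and "equivalent_categories H S" and pbs: "has_pullbacks S"
  shows "has_pullbacks H"
  unfolding has_pullbacks_def
proof (intro ballI impI)
  interpret H: category H by fact
  interpret S: category S by fact
  obtain F G \<alpha> \<beta> where F: "is_functor H S F" and G: "is_functor S H G"
    and \<alpha>: "nat_trans H H ftor_id (ftor_comp G F) \<alpha>" and \<alpha>_iso: "\<And>x. x \<in> Obj H \<Longrightarrow> is_iso H (\<alpha> x)"
    and \<beta>: "nat_trans S S (ftor_comp F G) ftor_id \<beta>" and \<beta>_iso: "\<And>x. x \<in> Obj S \<Longrightarrow> is_iso S (\<beta> x)"
    using assms(3) unfolding equivalent_categories_def nat_iso_def by blast
  note [simp] = functorD[OF F] functorD[OF G]
  have [simp]: "\<alpha> x \<in> Arr H" "Dom H (\<alpha> x) = x" "Cod H (\<alpha> x) = fobj G (fobj F x)" if "x \<in> Obj H" for x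
    using nat_transD(1-3)[OF \<alpha>] that by simp_all
  have [simp]: "\<beta> x \<in> Arr S" "Dom S (\<beta> x) = fobj F (fobj G x)" "Cod S (\<beta> x) = x" if "x \<in> Obj S" for x
    using nat_transD(1-3)[OF \<beta>] that by simp_all
  have \<alpha>_nat: "farr G (farr F v) \<bullet>\<^bsub>H\<^esub> \<alpha> (Dom H v) = \<alpha> (Cod H v) \<bullet>\<^bsub>H\<^esub> v" if "v \<in> Arr H" for v
    using nat_transD(4)[OF \<alpha> that] by simp
  have \<beta>_nat: "\<beta> (Cod S v) \<bullet>\<^bsub>S\<^esub> farr F (farr G v) = v \<bullet>\<^bsub>S\<^esub> \<beta> (Dom S v)" if "v \<in> Arr S" for v
    using nat_transD(4)[OF \<beta> that] by simp
  define \<alpha>' where "\<alpha>' x = (SOME a. a \<in> hom H (fobj G (fobj F x)) x \<and>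
    a \<bullet>\<^bsub>H\<^esub> \<alpha> x = Id H x \<and> \<alpha> x \<bullet>\<^bsub>H\<^esub> a = Id H (fobj G (fobj F x)))" for x
  have "\<alpha>' x \<in> hom H (fobj G (fobj F x)) x \<and> \<alpha>' x \<bullet>\<^bsub>H\<^esub> \<alpha> x = Id H x \<and>
      \<alpha> x \<bullet>\<^bsub>H\<^esub> \<alpha>' x = Id H (fobj G (fobj F x))" if "x \<in> Obj H" for x
    unfolding \<alpha>'_def by (rule someI_ex) (use \<alpha>_iso[OF that] that in \<open>auto simp: is_iso_def\<close>)
  then have \<alpha>' [simp]: "\<alpha>' x \<in> Arr H" "Dom H (\<alpha>' x) = fobj G (fobj F x)" "Cod H (\<alpha>' x) = x"
    and \<alpha>'\<alpha>: "\<alpha>' x \<bullet>\<^bsub>H\<^esub> \<alpha> x = Id H x" and \<alpha>\<alpha>': "\<alpha> x \<bullet>\<^bsub>H\<^esub> \<alpha>' x = Id H (fobj G (fobj F x))"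
    if "x \<in> Obj H" for x
    using that by (auto simp: hom_def)
  have \<alpha>_cancel: "a = b" if "\<alpha> x \<bullet>\<^bsub>H\<^esub> a = \<alpha> x \<bullet>\<^bsub>H\<^esub> b" "a \<in> Arr H" "b \<in> Arr H" "Cod H a = x" "Cod H b = x"
    for a b x
  proof -
    have x: "x \<in> Obj H" using that by auto
    have "a = (\<alpha>' x \<bullet>\<^bsub>H\<^esub> \<alpha> x) \<bullet>\<^bsub>H\<^esub> a" using that x by (simp only: \<alpha>'\<alpha>) simp
    also have "\<dots> = (\<alpha>' x \<bullet>\<^bsub>H\<^esub> \<alpha> x) \<bullet>\<^bsub>H\<^esub> b" using that x by simp
    also have "\<dots> = b" using that x by (simp only: \<alpha>'\<alpha>) simp
    finally show ?thesis .
  qed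
  have \<alpha>'_nat: "\<alpha>' (Cod H v) \<bullet>\<^bsub>H\<^esub> farr G (farr F v) = v \<bullet>\<^bsub>H\<^esub> \<alpha>' (Dom H v)" if [simp]: "v \<in> Arr H" for v
  proof (rule \<alpha>_cancel)
    have "\<alpha> (Cod H v) \<bullet>\<^bsub>H\<^esub> (\<alpha>' (Cod H v) \<bullet>\<^bsub>H\<^esub> farr G (farr F v))
        = (\<alpha> (Cod H v) \<bullet>\<^bsub>H\<^esub> \<alpha>' (Cod H v)) \<bullet>\<^bsub>H\<^esub> farr G (farr F v)"
      by simp
    also have "\<dots> = farr G (farr F v) \<bullet>\<^bsub>H\<^esub> (\<alpha> (Dom H v) \<bullet>\<^bsub>H\<^esub> \<alpha>' (Dom H v))"
      by (simp add: \<alpha>\<alpha>' del: functor_Comp[OF G])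
    also have "\<dots> = \<alpha> (Cod H v) \<bullet>\<^bsub>H\<^esub> (v \<bullet>\<^bsub>H\<^esub> \<alpha>' (Dom H v))"
      by (rule H.Comp_extend) (simp_all add: \<alpha>_nat)
    finally show "\<alpha> (Cod H v) \<bullet>\<^bsub>H\<^esub> (\<alpha>' (Cod H v) \<bullet>\<^bsub>H\<^esub> farr G (farr F v)) =
      \<alpha> (Cod H v) \<bullet>\<^bsub>H\<^esub> (v \<bullet>\<^bsub>H\<^esub> \<alpha>' (Dom H v))" .
  qed simp_all
  have F_faithful: "v = w"
    if "farr F v = farr F w" "v \<in> Arr H" "w \<in> Arr H" "Dom H v = Dom H w" "Cod H v = Cod H w" for v w
  proof (rule \<alpha>_cancel)
    show "\<alpha> (Cod H v) \<bullet>\<^bsub>H\<^esub> v = \<alpha> (Cod H v) \<bullet>\<^bsub>H\<^esub> w"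
      using \<alpha>_nat[OF that(2)] \<alpha>_nat[OF that(3)] that by metis
  qed (use that in simp_all)
  have \<beta>_cancel: "a = b"
    if ab: "\<beta> x \<bullet>\<^bsub>S\<^esub> a = \<beta> x \<bullet>\<^bsub>S\<^esub> b" "a \<in> Arr S" "b \<in> Arr S"
      "Cod S a = fobj F (fobj G x)" "Cod S b = fobj F (fobj G x)" and x: "x \<in> Obj S" for a b x
  proof -
    obtain r where r: "r \<in> Arr S" "Dom S r = x" "Cod S r = fobj F (fobj G x)"
      and inv: "r \<bullet>\<^bsub>S\<^esub> \<beta> x = Id S (fobj F (fobj G x))"
      using \<beta>_iso[OF x] x by (auto simp: is_iso_def hom_def)
    have "a = (r \<bullet>\<^bsub>S\<^esub> \<beta> x) \<bullet>\<^bsub>S\<^esub> a" using ab(2,4) by (simp only: inv) simp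
    also have "\<dots> = (r \<bullet>\<^bsub>S\<^esub> \<beta> x) \<bullet>\<^bsub>S\<^esub> b" using ab x r by simp
    also have "\<dots> = b" using ab(3,5) by (simp only: inv) simp
    finally show ?thesis .
  qed
  fix f g assume [simp]: "f \<in> Arr H" "g \<in> Arr H" and fg: "Cod H f = Cod H g"
  then obtain p q where pb: "is_pullback S (farr F f) (farr F g) p q"
    using pbs unfolding has_pullbacks_def by (metis functor_Cod[OF F] functor_arr[OF F])
  note pq [simp] = S.is_pullbackD(1-5)[OF pb, simplified]
  let ?p = "\<alpha>' (Dom H f) \<bullet>\<^bsub>H\<^esub> farr G p" and ?q = "\<alpha>' (Dom H g) \<bullet>\<^bsub>H\<^esub> farr G q"
  have comp: "h \<bullet>\<^bsub>H\<^esub> (\<alpha>' (Dom H h) \<bullet>\<^bsub>H\<^esub> farr G r) = \<alpha>' (Cod H h) \<bullet>\<^bsub>H\<^esub> farr G (farr F h \<bullet>\<^bsub>S\<^esub> r)"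
    if "h \<in> Arr H" "r \<in> Arr S" "Cod S r = fobj F (Dom H h)" for h r
  proof -
    have "h \<bullet>\<^bsub>H\<^esub> (\<alpha>' (Dom H h) \<bullet>\<^bsub>H\<^esub> farr G r)
        = \<alpha>' (Cod H h) \<bullet>\<^bsub>H\<^esub> (farr G (farr F h) \<bullet>\<^bsub>H\<^esub> farr G r)"
      by (rule H.Comp_extend) (use that in \<open>simp_all add: \<alpha>'_nat\<close>)
    then show ?thesis using that by simp
  qed
  have lift: "\<alpha>' (Cod H h) \<bullet>\<^bsub>H\<^esub> (farr G r \<bullet>\<^bsub>H\<^esub> (farr G u \<bullet>\<^bsub>H\<^esub> \<alpha> (Dom H h))) = h"
    if "h \<in> Arr H" "u \<in> Arr S" "r \<in> Arr S" "Dom S u = fobj F (Dom H h)" "Dom S r = Cod S u"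
      "Cod S r = fobj F (Cod H h)" "r \<bullet>\<^bsub>S\<^esub> u = farr F h" for h r u
  proof -
    have "\<alpha>' (Cod H h) \<bullet>\<^bsub>H\<^esub> (farr G r \<bullet>\<^bsub>H\<^esub> (farr G u \<bullet>\<^bsub>H\<^esub> \<alpha> (Dom H h)))
        = \<alpha>' (Cod H h) \<bullet>\<^bsub>H\<^esub> (farr G (r \<bullet>\<^bsub>S\<^esub> u) \<bullet>\<^bsub>H\<^esub> \<alpha> (Dom H h))"
      using that(1-6) by simp
    also have "\<dots> = \<alpha>' (Cod H h) \<bullet>\<^bsub>H\<^esub> (\<alpha> (Cod H h) \<bullet>\<^bsub>H\<^esub> h)"
      using that(1) by (simp only: that(7) \<alpha>_nat)
    also have "\<dots> = (\<alpha>' (Cod H h) \<bullet>\<^bsub>H\<^esub> \<alpha> (Cod H h)) \<bullet>\<^bsub>H\<^esub> h"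
      using that(1) by simp
    also have "\<dots> = h"
      using that(1) by (simp add: \<alpha>'\<alpha> del: H.Comp_assoc')
    finally show ?thesis .
  qed
  have F_lift: "r \<bullet>\<^bsub>S\<^esub> (\<beta> (Dom S r) \<bullet>\<^bsub>S\<^esub> farr F v) = r \<bullet>\<^bsub>S\<^esub> (\<beta> (Dom S r) \<bullet>\<^bsub>S\<^esub> farr F w)"
    if "\<alpha>' x \<bullet>\<^bsub>H\<^esub> (farr G r \<bullet>\<^bsub>H\<^esub> v) = \<alpha>' x \<bullet>\<^bsub>H\<^esub> (farr G r \<bullet>\<^bsub>H\<^esub> w)" and [simp]: "r \<in> Arr S"
      "Cod S r = fobj F x" "x \<in> Obj H" "v \<in> Arr H" "Cod H v = fobj G (Dom S r)" "w \<in> Arr H"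
      "Cod H w = fobj G (Dom S r)" for r v w x
  proof -
    have "farr G r \<bullet>\<^bsub>H\<^esub> v = (\<alpha> x \<bullet>\<^bsub>H\<^esub> \<alpha>' x) \<bullet>\<^bsub>H\<^esub> (farr G r \<bullet>\<^bsub>H\<^esub> v)"
      by (simp only: \<alpha>\<alpha>' \<open>x \<in> Obj H\<close>) simp
    also have "\<dots> = (\<alpha> x \<bullet>\<^bsub>H\<^esub> \<alpha>' x) \<bullet>\<^bsub>H\<^esub> (farr G r \<bullet>\<^bsub>H\<^esub> w)"
      using that(1) by simp
    also have "\<dots> = farr G r \<bullet>\<^bsub>H\<^esub> w"
      by (simp only: \<alpha>\<alpha>' \<open>x \<in> Obj H\<close>) simp
    finally have Gr: "farr G r \<bullet>\<^bsub>H\<^esub> v = farr G r \<bullet>\<^bsub>H\<^esub> w" .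
    have *: "r \<bullet>\<^bsub>S\<^esub> (\<beta> (Dom S r) \<bullet>\<^bsub>S\<^esub> farr F y) = \<beta> (Cod S r) \<bullet>\<^bsub>S\<^esub> farr F (farr G r \<bullet>\<^bsub>H\<^esub> y)"
      if "y \<in> Arr H" "Cod H y = fobj G (Dom S r)" for y
    proof -
      have "r \<bullet>\<^bsub>S\<^esub> (\<beta> (Dom S r) \<bullet>\<^bsub>S\<^esub> farr F y)
          = \<beta> (Cod S r) \<bullet>\<^bsub>S\<^esub> (farr F (farr G r) \<bullet>\<^bsub>S\<^esub> farr F y)"
        by (rule S.Comp_extend) (use that \<beta>_nat[of r] in simp_all)
      then show ?thesis using that by simp
    qed
    show ?thesis using *[of v] *[of w] by (simp only: Gr) simp
  qed
  have "is_pullback H f g ?p ?q"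
    unfolding is_pullback_def
  proof (intro conjI allI ballI impI)
    show "f \<bullet>\<^bsub>H\<^esub> ?p = g \<bullet>\<^bsub>H\<^esub> ?q"
      using comp[of f p] comp[of g q] S.is_pullbackD(6)[OF pb] fg by (simp del: functor_Comp[OF G])
    fix z h k assume "h \<in> hom H z (Dom H f)" "k \<in> hom H z (Dom H g)" and fhgk: "f \<bullet>\<^bsub>H\<^esub> h = g \<bullet>\<^bsub>H\<^esub> k"
    then have hk [simp]: "h \<in> Arr H" "Dom H h = z" "Cod H h = Dom H f"
      "k \<in> Arr H" "Dom H k = z" "Cod H k = Dom H g"
      by (simp_all add: hom_def)
    have z [simp]: "z \<in> Obj H" using hk by (metis H.Dom_Cod_Obj(1))
    have "farr F f \<bullet>\<^bsub>S\<^esub> farr F h = farr F g \<bullet>\<^bsub>S\<^esub> farr F k"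
      using fhgk by (simp flip: functor_Comp[OF F])
    then obtain u where u [simp]: "u \<in> Arr S" "Dom S u = fobj F z" "Cod S u = Dom S q"
      and pu: "p \<bullet>\<^bsub>S\<^esub> u = farr F h" and qu: "q \<bullet>\<^bsub>S\<^esub> u = farr F k"
      by (rule S.is_pullback_lift[OF pb, rotated 5]) simp_all
    show "\<exists>!v. v \<in> hom H z (Dom H ?p) \<and> ?p \<bullet>\<^bsub>H\<^esub> v = h \<and> ?q \<bullet>\<^bsub>H\<^esub> v = k"
    proof (rule ex_ex1I)
      have "?p \<bullet>\<^bsub>H\<^esub> (farr G u \<bullet>\<^bsub>H\<^esub> \<alpha> z) = h" "?q \<bullet>\<^bsub>H\<^esub> (farr G u \<bullet>\<^bsub>H\<^esub> \<alpha> z) = k"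
        using lift[of h u p] lift[of k u q] by (simp_all add: pu qu)
      then show "\<exists>v. v \<in> hom H z (Dom H ?p) \<and> ?p \<bullet>\<^bsub>H\<^esub> v = h \<and> ?q \<bullet>\<^bsub>H\<^esub> v = k"
        by (intro exI[of _ "farr G u \<bullet>\<^bsub>H\<^esub> \<alpha> z"]) (simp add: hom_def)
      fix v w
      assume v: "v \<in> hom H z (Dom H ?p) \<and> ?p \<bullet>\<^bsub>H\<^esub> v = h \<and> ?q \<bullet>\<^bsub>H\<^esub> v = k"
        and w: "w \<in> hom H z (Dom H ?p) \<and> ?p \<bullet>\<^bsub>H\<^esub> w = h \<and> ?q \<bullet>\<^bsub>H\<^esub> w = k"
      have [simp]: "v \<in> Arr H" "Dom H v = z" "Cod H v = fobj G (Dom S q)"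
        "w \<in> Arr H" "Dom H w = z" "Cod H w = fobj G (Dom S q)"
        using v w by (simp_all add: hom_def)
      have eqs: "\<alpha>' (Dom H f) \<bullet>\<^bsub>H\<^esub> (farr G p \<bullet>\<^bsub>H\<^esub> v) = \<alpha>' (Dom H f) \<bullet>\<^bsub>H\<^esub> (farr G p \<bullet>\<^bsub>H\<^esub> w)"
        "\<alpha>' (Dom H g) \<bullet>\<^bsub>H\<^esub> (farr G q \<bullet>\<^bsub>H\<^esub> v) = \<alpha>' (Dom H g) \<bullet>\<^bsub>H\<^esub> (farr G q \<bullet>\<^bsub>H\<^esub> w)"
        using v w by simp_all
      have "p \<bullet>\<^bsub>S\<^esub> (\<beta> (Dom S p) \<bullet>\<^bsub>S\<^esub> farr F v) = p \<bullet>\<^bsub>S\<^esub> (\<beta> (Dom S p) \<bullet>\<^bsub>S\<^esub> farr F w)"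
        "q \<bullet>\<^bsub>S\<^esub> (\<beta> (Dom S q) \<bullet>\<^bsub>S\<^esub> farr F v) = q \<bullet>\<^bsub>S\<^esub> (\<beta> (Dom S q) \<bullet>\<^bsub>S\<^esub> farr F w)"
        by (rule F_lift[OF eqs(1)], simp_all) (rule F_lift[OF eqs(2)], simp_all)
      then have "\<beta> (Dom S q) \<bullet>\<^bsub>S\<^esub> farr F v = \<beta> (Dom S q) \<bullet>\<^bsub>S\<^esub> farr F w"
        unfolding pq(3) by (rule S.is_pullback_unique[OF pb, rotated 5]) simp_all
      then have "farr F v = farr F w"
        by (rule \<beta>_cancel) simp_all
      then show "v = w"
        by (rule F_faithful) simp_all
    qed
  qed (simp_all add: fg)
  then show "\<exists>p q. is_pullback H f g p q" by blast
qed

lemma sheaf_category_simps [simp]: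
  "F \<in> Obj (sheaf_category C K) \<longleftrightarrow> sheaf C K F"
  "Dom (sheaf_category C K) (F, \<alpha>, G) = F" "Cod (sheaf_category C K) (F, \<alpha>, G) = G"
  "Id (sheaf_category C K) F = (F, \<lambda>c \<in> Obj C. \<lambda>s \<in> sections F c. s, F)"
  "(F', \<beta>, G) \<bullet>\<^bsub>sheaf_category C K\<^esub> (F, \<alpha>, G') =
    (F, \<lambda>c \<in> Obj C. \<lambda>s \<in> sections F c. \<beta> c (\<alpha> c s), G)"
  by (simp_all add: sheaf_category_def)

lemma sheaf_category_Arr:
  "(F, \<alpha>, G) \<in> Arr (sheaf_category C K) \<longleftrightarrow> sheaf C K F \<and> sheaf C K G \<and>
    \<alpha> \<in> (\<Pi>\<^sub>E c \<in> Obj C. sections F c \<rightarrow>\<^sub>E sections G c) \<and>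
    (\<forall>f \<in> Arr C. \<forall>s \<in> sections F (Cod C f).
       \<alpha> (Dom C f) (restr F f s) = restr G f (\<alpha> (Cod C f) s))"
  by (simp add: sheaf_category_def)

lemma sheaf_map_ext:
  assumes "\<alpha> \<in> (\<Pi>\<^sub>E c \<in> A. X c \<rightarrow>\<^sub>E Y c)" "\<beta> \<in> (\<Pi>\<^sub>E c \<in> A. X c \<rightarrow>\<^sub>E Z c)"
    and "\<And>c s. c \<in> A \<Longrightarrow> s \<in> X c \<Longrightarrow> \<alpha> c s = \<beta> c s"
  shows "\<alpha> = \<beta>"
proof
  fix c show "\<alpha> c = \<beta> c"
  proof (cases "c \<in> A")
    case True
    then have "\<alpha> c \<in> X c \<rightarrow>\<^sub>E Y c" "\<beta> c \<in> X c \<rightarrow>\<^sub>E Z c" using assms by auto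
    then show ?thesis
      using assms(3)[OF True] by (intro extensionalityI[of _ "X c"]) (auto simp: PiE_iff)
  next
    case False
    then show ?thesis using assms(1,2) by (metis PiE_arb)
  qed
qed

lemma presheaf_restr:
  assumes "presheaf C F" "f \<in> Arr C" "s \<in> sections F (Cod C f)"
  shows "restr F f s \<in> sections F (Dom C f)"
  using assms unfolding presheaf_def by blast

context category
begin

lemma sheaf_category_category:
  "category (sheaf_category C K ::
    (('o, 'a, 'u) psh, ('o, 'a, 'u) psh \<times> ('o \<Rightarrow> 'u \<Rightarrow> 'u) \<times> ('o, 'a, 'u) psh) cat)"
  (is "category ?S")
proof
  fix a b c F G X Y
  show "a \<in> Arr ?S \<Longrightarrow> Dom ?S a \<in> Obj ?S" "a \<in> Arr ?S \<Longrightarrow> Cod ?S a \<in> Obj ?S"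
    by (cases a; simp add: sheaf_category_Arr)+
  show "F \<in> Obj ?S \<Longrightarrow> Id ?S F \<in> hom ?S F F"
    by (auto simp: hom_def sheaf_category_Arr sheaf_def presheaf_restr)
  show "b \<bullet>\<^bsub>?S\<^esub> a \<in> hom ?S F X" if ab: "a \<in> hom ?S F G" "b \<in> hom ?S G X"
  proof -
    obtain \<alpha> \<beta> where eq: "a = (F, \<alpha>, G)" "b = (G, \<beta>, X)"
      using ab by (cases a; cases b) (auto simp: hom_def)
    have F: "presheaf C F" "sheaf C K F" "sheaf C K X"
      and \<alpha>: "\<And>c s. c \<in> Obj C \<Longrightarrow> s \<in> sections F c \<Longrightarrow> \<alpha> c s \<in> sections G c"
        "\<And>f s. f \<in> Arr C \<Longrightarrow> s \<in> sections F (Cod C f) \<Longrightarrow>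
          \<alpha> (Dom C f) (restr F f s) = restr G f (\<alpha> (Cod C f) s)"
      and \<beta>: "\<And>c s. c \<in> Obj C \<Longrightarrow> s \<in> sections G c \<Longrightarrow> \<beta> c s \<in> sections X c"
        "\<And>f s. f \<in> Arr C \<Longrightarrow> s \<in> sections G (Cod C f) \<Longrightarrow>
          \<beta> (Dom C f) (restr G f s) = restr X f (\<beta> (Cod C f) s)"
      using ab unfolding eq by (auto simp: hom_def sheaf_category_Arr sheaf_def)
    show ?thesis
      using F by (auto simp: eq hom_def sheaf_category_Arr presheaf_restr \<alpha> \<beta>)
  qed
  show "Id ?S G \<bullet>\<^bsub>?S\<^esub> a = a" "a \<bullet>\<^bsub>?S\<^esub> Id ?S F = a" if a: "a \<in> hom ?S F G"
  proof -
    obtain \<alpha> where eq: "a = (F, \<alpha>, G)" using a by (cases a) (auto simp: hom_def)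
    have \<alpha>: "\<alpha> \<in> (\<Pi>\<^sub>E c \<in> Obj C. sections F c \<rightarrow>\<^sub>E sections G c)"
      using a by (simp add: eq hom_def sheaf_category_Arr)
    then have \<alpha>': "\<And>c s. c \<in> Obj C \<Longrightarrow> s \<in> sections F c \<Longrightarrow> \<alpha> c s \<in> sections G c" by auto
    have "(\<lambda>c \<in> Obj C. \<lambda>s \<in> sections F c. (\<lambda>c \<in> Obj C. \<lambda>s \<in> sections G c. s) c (\<alpha> c s)) = \<alpha>"
      by (rule sheaf_map_ext[OF _ \<alpha>]) (auto simp: \<alpha>')
    then show "Id ?S G \<bullet>\<^bsub>?S\<^esub> a = a" by (simp add: eq)
    have "(\<lambda>c \<in> Obj C. \<lambda>s \<in> sections F c. \<alpha> c ((\<lambda>c \<in> Obj C. \<lambda>s \<in> sections F c. s) c s)) = \<alpha>"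
      by (rule sheaf_map_ext[OF _ \<alpha>]) (auto simp: \<alpha>')
    then show "a \<bullet>\<^bsub>?S\<^esub> Id ?S F = a" by (simp add: eq)
  qed
  show "(c \<bullet>\<^bsub>?S\<^esub> b) \<bullet>\<^bsub>?S\<^esub> a = c \<bullet>\<^bsub>?S\<^esub> (b \<bullet>\<^bsub>?S\<^esub> a)"
    if abc: "a \<in> hom ?S F G" "b \<in> hom ?S G X" "c \<in> hom ?S X Y"
  proof -
    obtain \<alpha> \<beta> \<gamma> where eq: "a = (F, \<alpha>, G)" "b = (G, \<beta>, X)" "c = (X, \<gamma>, Y)"
      using abc by (cases a; cases b; cases c) (auto simp: hom_def)
    have "\<And>c s. c \<in> Obj C \<Longrightarrow> s \<in> sections F c \<Longrightarrow> \<alpha> c s \<in> sections G c"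
      using abc(1) unfolding eq by (auto simp: hom_def sheaf_category_Arr)
    then show ?thesis by (simp add: eq cong: restrict_cong)
  qed
qed

end

lemma small_product:
  fixes A B :: "'u set"
  assumes inf: "infinite (UNIV :: 'u set)" and A: "small A" and B: "small B"
  shows "A \<times> B \<prec> (UNIV :: 'u set)"
proof -
  have *: "X \<times> Y \<prec> (UNIV :: 'u set)" if "infinite X" "Y \<lesssim> X" "small X" for X Y :: "'u set"
  proof -
    have "X \<times> Y \<lesssim> X \<times> X" using that by (intro times_lepoll_mono) auto
    also have "X \<times> X \<approx> X" using that(1) by (metis card_of_Times_same_infinite card_of_ordIso eqpoll_def)
    also have "X \<prec> (UNIV :: 'u set)" using that(3) by (simp add: small_def)
    finally show ?thesis .
  qed
  have swap: "A \<times> B \<approx> B \<times> A" by (rule times_commute_eqpoll)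
  show ?thesis
  proof (cases "finite A \<and> finite B")
    case True
    then show ?thesis using inf by (simp add: finite_lesspoll_infinite)
  next
    case False
    then consider "infinite A" "B \<lesssim> A" | "infinite B" "A \<lesssim> B"
      using ordLeq_total[OF card_of_Well_order card_of_Well_order, of A B]
      by (metis card_of_ordLeq card_of_ordLeq_finite lepoll_def)
    then show ?thesis
      using *[of A B] *[of B A] A B eq_lesspoll_trans[OF swap] by cases auto
  qed
qed

text \<open>
  Sections of the fibre product are pairs, coded as elements of \<open>'u\<close>; being infinite, \<open>'u\<close> has room
  for them.
\<close>

definition pair_code :: "'u \<times> 'u \<Rightarrow> 'u" where
  "pair_code = (SOME f. inj f)"

lemma inj_pair_code:
  assumes "infinite (UNIV :: 'u set)"
  shows "inj (pair_code :: 'u \<times> 'u \<Rightarrow> 'u)"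
proof -
  have "\<exists>f :: 'u \<times> 'u \<Rightarrow> 'u. inj f"
    using card_of_Times_same_infinite[OF assms] card_of_ordIso[of "(UNIV :: 'u set) \<times> (UNIV :: 'u set)" UNIV]
    by (auto simp: bij_betw_def)
  then show ?thesis unfolding pair_code_def by (rule someI_ex)
qed

definition fibre_product ::
    "('o, 'a, 'u) psh \<Rightarrow> ('o \<Rightarrow> 'u \<Rightarrow> 'u) \<Rightarrow> ('o, 'a, 'u) psh \<Rightarrow> ('o \<Rightarrow> 'u \<Rightarrow> 'u) \<Rightarrow> ('o, 'a, 'u) psh" where
  "fibre_product A \<alpha> B \<beta> = \<lparr>
     sections = (\<lambda>c. pair_code ` {(a, b). a \<in> sections A c \<and> b \<in> sections B c \<and> \<alpha> c a = \<beta> c b}),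
     restr = (\<lambda>f. pair_code \<circ> map_prod (restr A f) (restr B f) \<circ> inv pair_code)\<rparr>"

lemma sheaf_amalgamation:
  assumes "sheaf C K F" "c \<in> Obj C" "S \<in> K c" "matching_family C F S x"
  shows "\<exists>!s. s \<in> sections F c \<and> (\<forall>f \<in> S. restr F f s = x f)"
  using assms unfolding sheaf_def by blast

text \<open>
  The fibre product is a sheaf: a matching family of pairs is amalgamated in \<open>A\<close> and in \<open>B\<close>, and the
  images of the two results in \<open>X\<close> agree because both amalgamate the same matching family of \<open>X\<close>.
\<close>

lemma sheaf_has_pullbacks:
  fixes C :: "('o, 'a) cat"
  assumes C: "category C" and top: "grothendieck_topology C K" and inf: "infinite (UNIV :: 'u set)"
  shows "has_pullbacks (sheaf_category C K ::
    (('o, 'a, 'u) psh, ('o, 'a, 'u) psh \<times> ('o \<Rightarrow> 'u \<Rightarrow> 'u) \<times> ('o, 'a, 'u) psh) cat)"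
    (is "has_pullbacks ?S")
  unfolding has_pullbacks_def
proof (intro ballI impI)
  interpret category C by fact
  fix f g assume f: "f \<in> Arr ?S" and g: "g \<in> Arr ?S" and fg: "Cod ?S f = Cod ?S g"
  obtain A \<alpha> X where f_eq: "f = (A, \<alpha>, X)" by (cases f)
  obtain B \<beta> where g_eq: "g = (B, \<beta>, X)" using fg by (cases g) (auto simp: f_eq)
  have A: "sheaf C K A" and B: "sheaf C K B" and X: "sheaf C K X"
    and \<alpha>: "\<And>c s. c \<in> Obj C \<Longrightarrow> s \<in> sections A c \<Longrightarrow> \<alpha> c s \<in> sections X c"
      "\<And>f s. f \<in> Arr C \<Longrightarrow> s \<in> sections A (Cod C f) \<Longrightarrow>
        \<alpha> (Dom C f) (restr A f s) = restr X f (\<alpha> (Cod C f) s)"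
    and \<beta>: "\<And>c s. c \<in> Obj C \<Longrightarrow> s \<in> sections B c \<Longrightarrow> \<beta> c s \<in> sections X c"
      "\<And>f s. f \<in> Arr C \<Longrightarrow> s \<in> sections B (Cod C f) \<Longrightarrow>
        \<beta> (Dom C f) (restr B f s) = restr X f (\<beta> (Cod C f) s)"
    using f g unfolding f_eq g_eq by (auto simp: sheaf_category_Arr)
  have psh: "presheaf C A" "presheaf C B" using A B by (simp_all add: sheaf_def)
  define P where "P = fibre_product A \<alpha> B \<beta>"
  note inj = inj_pair_code[OF inf]
  define dec :: "'u \<Rightarrow> 'u \<times> 'u" where "dec = inv pair_code"
  have dec [simp]: "dec (pair_code s) = s" for s by (simp add: dec_def inv_f_f[OF inj])
  note [simp] = inj_eq[OF inj]
  have P_sec: "s \<in> sections P c \<longleftrightarrow> (\<exists>a b. s = pair_code (a, b) \<and> a \<in> sections A c \<and>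
      b \<in> sections B c \<and> \<alpha> c a = \<beta> c b)" for s c
    by (auto simp: P_def fibre_product_def)
  have P_restr: "restr P f s = pair_code (restr A f (fst (dec s)), restr B f (snd (dec s)))" for f s
    by (simp add: P_def fibre_product_def dec_def map_prod_def case_prod_beta)
  have P_psh: "presheaf C P"
    unfolding presheaf_def
  proof (intro conjI ballI allI)
    fix c assume c: "c \<in> Obj C"
    have "sections P c \<lesssim> pair_code ` (sections A c \<times> sections B c)"
      by (rule subset_imp_lepoll) (auto simp: P_sec)
    also have "\<dots> \<lesssim> sections A c \<times> sections B c" by (rule image_lepoll)
    also have "\<dots> \<prec> (UNIV :: 'u set)"
      using psh c by (intro small_product[OF inf]) (auto simp: presheaf_def)
    finally show "small (sections P c)" unfolding small_def .
  next
    fix f s assume "f \<in> Arr C" "s \<in> sections P (Cod C f)"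
    then show "restr P f s \<in> sections P (Dom C f)"
      using psh by (auto simp: P_sec P_restr presheaf_restr \<alpha> \<beta>)
  next
    fix c s assume "c \<in> Obj C" "s \<in> sections P c"
    then show "restr P (Id C c) s = s"
      using psh by (auto simp: P_sec P_restr presheaf_def)
  next
    fix b c d f g s assume "f \<in> hom C b c" "g \<in> hom C c d" "s \<in> sections P d"
    then show "restr P (g \<bullet>\<^bsub>C\<^esub> f) s = restr P f (restr P g s)"
      using psh unfolding presheaf_def by (auto simp: P_sec P_restr)
  qed
  have P: "sheaf C K P"
    unfolding sheaf_def
  proof (intro conjI ballI allI impI P_psh)
    fix c S x assume c: "c \<in> Obj C" and S: "S \<in> K c" and x: "matching_family C P S x"
    have S_arr: "f \<in> Arr C" "Cod C f = c" if "f \<in> S" for f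
      using top c S that unfolding grothendieck_topology_def sieves_def by blast+
    define a b where "a f = fst (dec (x f))" and "b f = snd (dec (x f))" for f
    have x_sec: "x f = pair_code (a f, b f)" "a f \<in> sections A (Dom C f)"
      "b f \<in> sections B (Dom C f)" "\<alpha> (Dom C f) (a f) = \<beta> (Dom C f) (b f)" if "f \<in> S" for f
    proof -
      have "x f \<in> sections P (Dom C f)" using x that by (simp add: matching_family_def)
      then show "x f = pair_code (a f, b f)" "a f \<in> sections A (Dom C f)"
        "b f \<in> sections B (Dom C f)" "\<alpha> (Dom C f) (a f) = \<beta> (Dom C f) (b f)"
        by (auto simp: P_sec a_def b_def)
    qed
    have x_comp: "a (f \<bullet>\<^bsub>C\<^esub> g) = restr A g (a f)" "b (f \<bullet>\<^bsub>C\<^esub> g) = restr B g (b f)"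
      if "f \<in> S" "g \<in> Arr C" "Cod C g = Dom C f" for f g
    proof -
      have "x (f \<bullet>\<^bsub>C\<^esub> g) = restr P g (x f)" using x that by (simp add: matching_family_def)
      then show "a (f \<bullet>\<^bsub>C\<^esub> g) = restr A g (a f)" "b (f \<bullet>\<^bsub>C\<^esub> g) = restr B g (b f)"
        by (simp_all add: a_def b_def P_restr)
    qed
    have match: "matching_family C A S a" "matching_family C B S b"
      using x_sec x_comp by (auto simp: matching_family_def)
    obtain sa where sa: "sa \<in> sections A c" "\<And>f. f \<in> S \<Longrightarrow> restr A f sa = a f"
      and sa_uniq: "\<And>s. s \<in> sections A c \<Longrightarrow> \<forall>f \<in> S. restr A f s = a f \<Longrightarrow> s = sa"
      using sheaf_amalgamation[OF A c S match(1)] by (rule ex1E) blast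
    obtain sb where sb: "sb \<in> sections B c" "\<And>f. f \<in> S \<Longrightarrow> restr B f sb = b f"
      and sb_uniq: "\<And>s. s \<in> sections B c \<Longrightarrow> \<forall>f \<in> S. restr B f s = b f \<Longrightarrow> s = sb"
      using sheaf_amalgamation[OF B c S match(2)] by (rule ex1E) blast
    have "matching_family C X S (\<lambda>f. \<alpha> (Dom C f) (a f))"
      unfolding matching_family_def
    proof (intro conjI ballI impI)
      fix f assume f: "f \<in> S"
      then show "\<alpha> (Dom C f) (a f) \<in> sections X (Dom C f)"
        using \<alpha>(1) x_sec(2) S_arr(1) by simp
      fix g assume g: "g \<in> Arr C" "Cod C g = Dom C f"
      then show "\<alpha> (Dom C (f \<bullet>\<^bsub>C\<^esub> g)) (a (f \<bullet>\<^bsub>C\<^esub> g)) = restr X g (\<alpha> (Dom C f) (a f))"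
        using \<alpha>(2)[OF g(1), of "a f"] x_sec(2)[OF f] S_arr(1)[OF f] x_comp(1)[OF f g] by simp
    qed
    from sheaf_amalgamation[OF X c S this]
    have X_uniq: "s = t" if "s \<in> sections X c" "t \<in> sections X c"
      "\<forall>f \<in> S. restr X f s = \<alpha> (Dom C f) (a f)" "\<forall>f \<in> S. restr X f t = \<alpha> (Dom C f) (a f)" for s t
      using that by blast
    have ab: "\<alpha> c sa = \<beta> c sb"
    proof (rule X_uniq)
      show "\<forall>f \<in> S. restr X f (\<alpha> c sa) = \<alpha> (Dom C f) (a f)"
        using \<alpha>(2)[of _ sa] S_arr sa by fastforce
      show "\<forall>f \<in> S. restr X f (\<beta> c sb) = \<alpha> (Dom C f) (a f)"
        using \<beta>(2)[of _ sb] S_arr sb x_sec(4) by fastforce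
    qed (simp_all add: \<alpha> \<beta> c sa sb)
    show "\<exists>!s. s \<in> sections P c \<and> (\<forall>f \<in> S. restr P f s = x f)"
    proof (rule ex1I[of _ "pair_code (sa, sb)"])
      show "pair_code (sa, sb) \<in> sections P c \<and> (\<forall>f \<in> S. restr P f (pair_code (sa, sb)) = x f)"
        using sa sb ab x_sec(1) by (auto simp: P_sec P_restr)
      fix s assume s: "s \<in> sections P c \<and> (\<forall>f \<in> S. restr P f s = x f)"
      then obtain a' b' where s_eq: "s = pair_code (a', b')" and ab': "a' \<in> sections A c" "b' \<in> sections B c"
        by (auto simp: P_sec)
      have "restr A f a' = a f" "restr B f b' = b f" if "f \<in> S" for f
      proof -
        have "dec (restr P f s) = dec (x f)" using s that by simp
        then show "restr A f a' = a f" "restr B f b' = b f"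
          using x_sec(1)[OF that] by (simp_all add: P_restr s_eq)
      qed
      then have "a' = sa" "b' = sb" using sa_uniq sb_uniq ab' by blast+
      then show "s = pair_code (sa, sb)" by (simp add: s_eq)
    qed
  qed
  let ?\<pi>1 = "\<lambda>c \<in> Obj C. \<lambda>s \<in> sections P c. fst (dec s)"
  let ?\<pi>2 = "\<lambda>c \<in> Obj C. \<lambda>s \<in> sections P c. snd (dec s)"
  have P_dec: "fst (dec s) \<in> sections A c" "snd (dec s) \<in> sections B c"
    "\<alpha> c (fst (dec s)) = \<beta> c (snd (dec s))" "pair_code (dec s) = s" if "s \<in> sections P c" for s c
    using that by (auto simp: P_sec)
  have \<pi>1: "(P, ?\<pi>1, A) \<in> Arr ?S" and \<pi>2: "(P, ?\<pi>2, B) \<in> Arr ?S"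
    using P A B presheaf_restr[OF P_psh] P_dec
    by (auto simp: sheaf_category_Arr) (auto simp: P_restr)
  have "is_pullback ?S f g (P, ?\<pi>1, A) (P, ?\<pi>2, B)"
    unfolding is_pullback_def
  proof (intro conjI allI ballI impI)
    show "f \<bullet>\<^bsub>?S\<^esub> (P, ?\<pi>1, A) = g \<bullet>\<^bsub>?S\<^esub> (P, ?\<pi>2, B)"
      by (simp add: f_eq g_eq P_dec cong: restrict_cong)
    fix Z h k assume h: "h \<in> hom ?S Z (Dom ?S f)" and k: "k \<in> hom ?S Z (Dom ?S g)"
      and eq: "f \<bullet>\<^bsub>?S\<^esub> h = g \<bullet>\<^bsub>?S\<^esub> k"
    obtain \<zeta> \<xi> where hk_eq: "h = (Z, \<zeta>, A)" "k = (Z, \<xi>, B)"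
      using h k by (cases h; cases k) (auto simp: hom_def f_eq g_eq)
    have "(Z, \<zeta>, A) \<in> Arr ?S" "(Z, \<xi>, B) \<in> Arr ?S"
      using h k unfolding hk_eq hom_def by blast+
    then have Z: "sheaf C K Z"
      and \<zeta>_ext: "\<zeta> \<in> (\<Pi>\<^sub>E c \<in> Obj C. sections Z c \<rightarrow>\<^sub>E sections A c)"
      and \<xi>_ext: "\<xi> \<in> (\<Pi>\<^sub>E c \<in> Obj C. sections Z c \<rightarrow>\<^sub>E sections B c)"
      and \<zeta>_nat: "\<And>f s. f \<in> Arr C \<Longrightarrow> s \<in> sections Z (Cod C f) \<Longrightarrow>
        \<zeta> (Dom C f) (restr Z f s) = restr A f (\<zeta> (Cod C f) s)"
      and \<xi>_nat: "\<And>f s. f \<in> Arr C \<Longrightarrow> s \<in> sections Z (Cod C f) \<Longrightarrow>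
        \<xi> (Dom C f) (restr Z f s) = restr B f (\<xi> (Cod C f) s)"
      unfolding sheaf_category_Arr by blast+
    have Z_psh: "presheaf C Z" using Z by (simp add: sheaf_def)
    have \<zeta>: "\<zeta> c s \<in> sections A c" and \<xi>: "\<xi> c s \<in> sections B c"
      if "c \<in> Obj C" "s \<in> sections Z c" for c s
      using \<zeta>_ext \<xi>_ext that by auto
    have square: "(\<lambda>c \<in> Obj C. \<lambda>s \<in> sections Z c. \<alpha> c (\<zeta> c s)) = (\<lambda>c \<in> Obj C. \<lambda>s \<in> sections Z c. \<beta> c (\<xi> c s))"
      using eq by (simp add: f_eq g_eq hk_eq)
    have \<alpha>\<zeta>: "\<alpha> c (\<zeta> c s) = \<beta> c (\<xi> c s)" if "c \<in> Obj C" "s \<in> sections Z c" for c s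
      using fun_cong[OF fun_cong[OF square, of c], of s] that by simp
    let ?u = "\<lambda>c \<in> Obj C. \<lambda>s \<in> sections Z c. pair_code (\<zeta> c s, \<xi> c s)"
    show "\<exists>!w. w \<in> hom ?S Z (Dom ?S (P, ?\<pi>1, A)) \<and> (P, ?\<pi>1, A) \<bullet>\<^bsub>?S\<^esub> w = h \<and> (P, ?\<pi>2, B) \<bullet>\<^bsub>?S\<^esub> w = k"
    proof (rule ex1I[of _ "(Z, ?u, P)"], intro conjI)
      have u: "pair_code (\<zeta> c s, \<xi> c s) \<in> sections P c" if "c \<in> Obj C" "s \<in> sections Z c" for c s
        using that \<zeta> \<xi> \<alpha>\<zeta> by (auto simp: P_sec)
      then show "(Z, ?u, P) \<in> hom ?S Z (Dom ?S (P, ?\<pi>1, A))"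
        using Z P by (auto simp: hom_def sheaf_category_Arr presheaf_restr[OF Z_psh] P_restr \<zeta>_nat \<xi>_nat)
      have "(\<lambda>c \<in> Obj C. \<lambda>s \<in> sections Z c. ?\<pi>1 c (?u c s)) = \<zeta>"
        by (rule sheaf_map_ext[OF _ \<zeta>_ext]) (auto simp: \<zeta> u)
      then show "(P, ?\<pi>1, A) \<bullet>\<^bsub>?S\<^esub> (Z, ?u, P) = h" by (simp add: hk_eq)
      have "(\<lambda>c \<in> Obj C. \<lambda>s \<in> sections Z c. ?\<pi>2 c (?u c s)) = \<xi>"
        by (rule sheaf_map_ext[OF _ \<xi>_ext]) (auto simp: \<xi> u)
      then show "(P, ?\<pi>2, B) \<bullet>\<^bsub>?S\<^esub> (Z, ?u, P) = k" by (simp add: hk_eq)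
      fix w
      assume w: "w \<in> hom ?S Z (Dom ?S (P, ?\<pi>1, A)) \<and> (P, ?\<pi>1, A) \<bullet>\<^bsub>?S\<^esub> w = h \<and> (P, ?\<pi>2, B) \<bullet>\<^bsub>?S\<^esub> w = k"
      then obtain \<omega> where w_eq: "w = (Z, \<omega>, P)" by (cases w) (auto simp: hom_def)
      have \<omega>_ext: "\<omega> \<in> (\<Pi>\<^sub>E c \<in> Obj C. sections Z c \<rightarrow>\<^sub>E sections P c)"
        using w by (simp add: w_eq hom_def sheaf_category_Arr)
      have \<omega>1: "(\<lambda>c \<in> Obj C. \<lambda>s \<in> sections Z c. ?\<pi>1 c (\<omega> c s)) = \<zeta>"
        and \<omega>2: "(\<lambda>c \<in> Obj C. \<lambda>s \<in> sections Z c. ?\<pi>2 c (\<omega> c s)) = \<xi>"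
        using w by (simp_all add: w_eq hk_eq)
      have "\<omega> = ?u"
      proof (rule sheaf_map_ext[OF \<omega>_ext])
        show "?u \<in> (\<Pi>\<^sub>E c \<in> Obj C. sections Z c \<rightarrow>\<^sub>E sections P c)" using u by auto
        fix c s assume cs: "c \<in> Obj C" "s \<in> sections Z c"
        then have \<omega>: "\<omega> c s \<in> sections P c" using \<omega>_ext by auto
        have "fst (dec (\<omega> c s)) = \<zeta> c s" "snd (dec (\<omega> c s)) = \<xi> c s"
          using cs \<omega> by (simp_all flip: \<omega>1 \<omega>2)
        then have "dec (\<omega> c s) = (\<zeta> c s, \<xi> c s)" by (metis prod.collapse)
        then show "\<omega> c s = ?u c s" using cs P_dec(4)[OF \<omega>] by simp
      qed
      then show "w = (Z, ?u, P)" by (simp only: w_eq)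
    qed
  qed (use f g \<pi>1 \<pi>2 in \<open>simp_all add: f_eq g_eq\<close>)
  then show "\<exists>p q. is_pullback ?S f g p q" by blast
qed

theorem grothendieck_topos_has_pullbacks:
  assumes U: "grothendieck_universe TYPE('u)" and H: "grothendieck_topos TYPE('u) H"
  shows "has_pullbacks H"
proof -
  obtain C :: "('u, 'u) cat" and K where "category C" "grothendieck_topology C K"
    and "equivalent_categories H (sheaf_category C K ::
      (('u, 'u, 'u) psh, ('u, 'u, 'u) psh \<times> ('u \<Rightarrow> 'u \<Rightarrow> 'u) \<times> ('u, 'u, 'u) psh) cat)"
    and "category H"
    using H unfolding grothendieck_topos_def by blast
  moreover have "infinite (UNIV :: 'u set)" using U by (simp add: grothendieck_universe_def)
  ultimately show ?thesis
    using has_pullbacks_equivalent category.sheaf_category_category sheaf_has_pullbacks by metis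
qed

section \<open>Finite limits of PDEs\<close>

theorem corollary3p58:
  fixes H :: "('o, 'a) cat" and R :: "('p, 'b) cat"
    and A1 :: "('p, 'b, 'o, 'a) adj" and A2 :: "('o, 'a, 'p, 'b) adj"
    and A3 :: "('p, 'b, 'o, 'a) adj"
    and V \<Sigma> :: 'o
    and B1 B2 :: "('a, 'a \<times> 'a \<times> 'a, 'a, 'a \<times> 'a \<times> 'a) adj"
    and J :: "('j, 'k) cat"
    and D :: "('j, 'k, ('a, 'a \<times> 'a \<times> 'a) gpde,
      ('a, 'a \<times> 'a \<times> 'a) gpde \<times> ('a \<times> 'a \<times> 'a) \<times> ('a, 'a \<times> 'a \<times> 'a) gpde) ftor"
  assumes "differentially_cohesive TYPE('u) H R A1 A2 A3"
    and "group_object H V"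
    and "is_manifold H A2 V \<Sigma>"
    and "base_change_triple H (inf_unit A2 \<Sigma>) B1 B2"
    and "finite_category J"
    and "is_functor J (PDE_over H A2 \<Sigma> B1 B2) D"
  shows "(\<exists>L \<pi>. is_limit J (PDE_over H A2 \<Sigma> B1 B2) D L \<pi>) \<and>
    (\<forall>L \<pi>. is_limit J (PDE_over H A2 \<Sigma> B1 B2) D L \<pi> \<longrightarrow>
       is_limit J (slice H \<Sigma>) (ftor_comp (underlying_functor (slice H \<Sigma>)) D)
         (fobj (underlying_functor (slice H \<Sigma>)) L)
         (\<lambda>j. farr (underlying_functor (slice H \<Sigma>)) (\<pi> j)))"
proof -
  interpret H: category H
    using assms(1) by (simp add: differentially_cohesive_def grothendieck_topos_def)
  let ?S = "slice H \<Sigma>" and ?U = "underlying_functor (slice H \<Sigma>)"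
  have pbs: "has_pullbacks H"
    using assms(1) unfolding differentially_cohesive_def
    by (blast intro: grothendieck_topos_has_pullbacks)
  have \<Sigma>: "\<Sigma> \<in> Obj H" using assms(3) by (simp add: is_manifold_def)
  have "nat_trans H H ftor_id (inf_shape A2) (inf_unit A2)"
    using assms(1)
    unfolding differentially_cohesive_def adjunction_def inf_shape_def inf_unit_def by blast
  note \<eta> = nat_transD(2,3)[OF this \<Sigma>]
  have base: "adjunction ?S (slice H (fobj (inf_shape A2) \<Sigma>)) B1"
    "adjunction (slice H (fobj (inf_shape A2) \<Sigma>)) ?S B2" "radj B1 = ladj B2"
    using assms(4) by (simp_all add: base_change_triple_def \<eta>)
  interpret jet_comonad ?S "slice H (fobj (inf_shape A2) \<Sigma>)" B1 B2
    by (intro jet_comonad.intro adjoint_pair.intro adjoint_pair_axioms.intro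
        jet_comonad_axioms.intro H.slice_category base)
  have J: "category J" using assms(5) by (simp add: finite_category_def)
  have D: "is_functor J (pde_category ?S (slice H (fobj (inf_shape A2) \<Sigma>)) B1 B2) D"
    using assms(6) by (simp add: PDE_over_def)
  obtain l \<pi> where lim: "is_limit J ?S (ftor_comp ?U D) l \<pi>"
    using category.finite_limit_exists[OF H.slice_category H.slice_terminal[OF \<Sigma>]
        H.slice_has_pullbacks[OF pbs] assms(5) is_functor_comp[OF D underlying_is_functor]]
    by blast
  show ?thesis
    unfolding PDE_over_def
  proof (intro conjI allI impI)
    show "\<exists>L \<tau>. is_limit J PDE D L \<tau>"
      by (rule PDE_limit[OF J D lim]) blast
    fix L \<tau> assume "is_limit J PDE D L \<tau>"
    then show "is_limit J ?S (ftor_comp ?U D) (fobj ?U L) (\<lambda>j. farr ?U (\<tau> j))"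
      by (rule underlying_limit[OF J D lim])
  qed
qed

end
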